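(* Let $r_2,r_4\in\mathbb{Q}$ satisfy $$0\le-2r_2-5r_4<8,\qquad 0\le-r_4<8,\qquad(-2r_2-5r_4)+(-r_4)>8.$$ Let $D\in\mathbb{Z}_{\ge1}$ with $Dr_2,Dr_4\in2\mathbb{Z}$, let $\chi:\widetilde{\Gamma_0(4)}^D\to\mathbb{C}^\times$ be the character of $\eta(\tau)^{-2r_2-4r_4}\eta(2\tau)^{r_2}\eta(4\tau)^{r_4}$, $k=\frac12(-r_2-3r_4)$, and $$E_{I,k}(\tau;r_2,r_4)=\sum_{\gamma\in\langle\widetilde T\rangle\backslash\widetilde{\Gamma_0(4)}^D}\chi(\gamma)^{-1}\cdot(1|_k\gamma)(\tau).$$ Then $$\eta(\tau)^{-2r_2-4r_4}\eta(2\tau)^{r_2}\eta(4\tau)^{r_4}=\frac1{2D}E_{I,k}(\tau;r_2,r_4).$$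
   Context: $e(x)=\exp(2\pi ix)$, $q=e(\tau)$; $z^r=\exp(r\log z)$ with $-\pi<\operatorname{Im}\log z\le\pi$. $\widetilde{\Gamma_0(4)}^D$ is the group of pairs $(\gamma,\varepsilon(c\tau+d)^{1/D})$, $\gamma=\begin{pmatrix}a&b\\c&d\end{pmatrix}\in\Gamma_0(4)$, $\varepsilon^D=1$, with product $(\gamma_1,\phi_1)(\gamma_2,\phi_2)=(\gamma_1\gamma_2,\phi_1(\gamma_2\tau)\phi_2(\tau))$; $\widetilde\gamma=(\gamma,(c\tau+d)^{1/D})$; $T=\begin{pmatrix}1&1\\0&1\end{pmatrix}$; $(f|_k(\gamma,\phi))(\tau)=\phi(\tau)^{-Dk}f(\gamma\tau)$, so $1|_k(\gamma,\phi)=\phi^{-Dk}$. $\eta(\tau)=q^{1/24}\prod(1-q^n)$, $\eta(n\tau)^r=\exp(r\log\eta(n\tau))$ with $\log\eta(\tau)=\log\eta(i)+\int_i^\tau\eta'/\eta$, $\log\eta(i)$ real. Dedekind sum $s(h,c)=\sum_{r\bmod c}((r/c))((hr/c))$, $((x))=x-\lfloor x\rfloor-\frac12$ ($x\notin\mathbb{Z}$), $0$ otherwise; $\Psi\begin{pmatrix}a&b\\c&d\end{pmatrix}=\frac{a+d}c+12s(-d,c)-3$ ($c>0$), $\frac{a+d}c+12s(d,-c)+3$ ($c<0$), $b$ ($c=0,a>0$), $-b-6$ ($c=0,a<0$). Character of $\prod_{n\mid N}\eta(n\tau)^{r_n}$ ($Dr_n\in 2\mathbb{Z}$, $k_0=\frac12\sum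 r_n$): $\chi(\gamma,\varepsilon(c\tau+d)^{1/D})=\varepsilon^{-Dk_0}e\big(\frac1{24}\sum_{n\mid N}r_n\Psi\begin{pmatrix}a&bn\\c/n&d\end{pmatrix}\big)$. *)

theory Defs
  imports "HOL-Complex_Analysis.Complex_Analysis"
begin

text \<open>Integer 2x2 matrices (a,b,c,d) = [[a,b],[c,d]].\<close>
type_synonym mat2 = "int \<times> int \<times> int \<times> int"

definition ee :: "complex \<Rightarrow> complex" where
  "ee x = exp (2 * of_real pi * \<i> * x)"

fun mmul :: "mat2 \<Rightarrow> mat2 \<Rightarrow> mat2" where
  "mmul (a, b, c, d) (a', b', c', d') =
     (a*a' + b*c', a*b' + b*d', c*a' + d*c', c*b' + d*d')"

fun mob :: "mat2 \<Rightarrow> complex \<Rightarrow> complex" where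
  "mob (a, b, c, d) \<tau> = (of_int a * \<tau> + of_int b) / (of_int c * \<tau> + of_int d)"

definition Gamma0_4 :: "mat2 set" where
  "Gamma0_4 = {(a, b, c, d). a*d - b*c = 1 \<and> 4 dvd c}"

text \<open>An element (gamma, eps (c tau + d)^(1/D)) of the D-fold cover is represented by the
  pair (gamma, eps); the automorphy factor is recovered by autf.  Complex powers use the
  principal branch (Isabelle's powr/Ln, with -pi < Im Ln z <= pi).\<close>
definition GammaT :: "nat \<Rightarrow> (mat2 \<times> complex) set" where
  "GammaT D = {(M, \<epsilon>). M \<in> Gamma0_4 \<and> \<epsilon> ^ D = 1}"

fun autf :: "nat \<Rightarrow> mat2 \<times> complex \<Rightarrow> complex \<Rightarrow> complex" where
  "autf D ((a, b, c, d), \<epsilon>) \<tau> = \<epsilon> * (of_int c * \<tau> + of_int d) powr of_real (1 / real D)"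

text \<open>T~^n = (T^n, (0 tau + 1)^(1/D)) = ((1,n,0,1), 1).  The right coset <T~> g is the set of
  group elements h with h = T~^n g for some integer n, the group law being
  (g1,phi1)(g2,phi2) = (g1 g2, phi1(g2 tau) phi2(tau)) (functions compared on the upper half plane).\<close>
definition Ttilde_pow :: "int \<Rightarrow> mat2 \<times> complex" where
  "Ttilde_pow n = ((1, n, 0, 1), 1)"

definition Tcoset :: "nat \<Rightarrow> mat2 \<times> complex \<Rightarrow> (mat2 \<times> complex) set" where
  "Tcoset D g = {h \<in> GammaT D. \<exists>n::int.
      fst h = mmul (fst (Ttilde_pow n)) (fst g) \<and>
      (\<forall>\<tau>. Im \<tau> > 0 \<longrightarrow> autf D h \<tau> = autf D (Ttilde_pow n) (mob (fst g) \<tau>) * autf D g \<tau>)}"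

definition Tcosets :: "nat \<Rightarrow> (mat2 \<times> complex) set set" where
  "Tcosets D = Tcoset D ` GammaT D"

definition sawtooth :: "real \<Rightarrow> real" where
  "sawtooth x = (if x \<in> \<int> then 0 else x - of_int \<lfloor>x\<rfloor> - 1/2)"

definition dedekind_sum :: "int \<Rightarrow> int \<Rightarrow> real" where
  "dedekind_sum h c = (\<Sum>r\<in>{0..<c}. sawtooth (of_int r / of_int c) * sawtooth (of_int (h*r) / of_int c))"

fun Psi :: "mat2 \<Rightarrow> real" where
  "Psi (a, b, c, d) =
     (if c > 0 then of_int (a + d) / of_int c + 12 * dedekind_sum (-d) c - 3
      else if c < 0 then of_int (a + d) / of_int c + 12 * dedekind_sum d (-c) + 3
      else if a > 0 then of_int b
      else - of_int b - 6)"

fun eta_char :: "nat \<Rightarrow> nat \<Rightarrow> (nat \<Rightarrow> real) \<Rightarrow> mat2 \<times> complex \<Rightarrow> complex" where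
  "eta_char N D r ((a, b, c, d), \<epsilon>) =
     \<epsilon> powr of_real (- real D * ((1/2) * (\<Sum>n\<in>{n. n dvd N}. r n))) *
     ee (of_real ((1/24) * (\<Sum>n\<in>{n. n dvd N}. r n * Psi (a, b * int n, c div int n, d))))"

definition slash_one :: "nat \<Rightarrow> real \<Rightarrow> mat2 \<times> complex \<Rightarrow> complex \<Rightarrow> complex" where
  "slash_one D k g \<tau> = (autf D g \<tau>) powr of_real (- real D * k)"

definition eta :: "complex \<Rightarrow> complex" where
  "eta \<tau> = ee (\<tau> / 24) * (\<Prod>n. (1 - ee \<tau> ^ Suc n))"

definition logeta :: "complex \<Rightarrow> complex" where
  "logeta \<tau> = Ln (eta \<i>) + contour_integral (linepath \<i> \<tau>) (\<lambda>z. deriv eta z / eta z)"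

definition eta_pow :: "nat \<Rightarrow> real \<Rightarrow> complex \<Rightarrow> complex" where
  "eta_pow n r \<tau> = exp (of_real r * logeta (of_nat n * \<tau>))"

definition eta_quot :: "nat \<Rightarrow> (nat \<Rightarrow> real) \<Rightarrow> complex \<Rightarrow> complex" where
  "eta_quot N r \<tau> = (\<Prod>n\<in>{n. n dvd N}. eta_pow n (r n) \<tau>)"

definition rvec :: "rat \<Rightarrow> rat \<Rightarrow> nat \<Rightarrow> real" where
  "rvec r2 r4 n = (if n = 1 then real_of_rat (-2*r2 - 4*r4)
                   else if n = 2 then real_of_rat r2
                   else if n = 4 then real_of_rat r4 else 0)"

definition EIk_term :: "nat \<Rightarrow> rat \<Rightarrow> rat \<Rightarrow> complex \<Rightarrow> (mat2 \<times> complex) set \<Rightarrow> complex" where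
  "EIk_term D r2 r4 \<tau> C =
     (let g = (SOME g. g \<in> C) in
      inverse (eta_char 4 D (rvec r2 r4) g) * slash_one D (real_of_rat ((-r2 - 3*r4)/2)) g \<tau>)"

end

theory Submission
  imports Defs
begin

text \<open>
  Write \<open>f\<close> for the eta quotient. Because \<open>\<chi>\<close> is its character, the summand attached to the coset of
  \<open>\<gamma>\<close> is \<open>f(\<tau>) / f(\<gamma>\<tau>)\<close>, so the claim says that the sum of \<open>1 / f(\<gamma>\<tau>)\<close> over all rows \<open>(c, d)\<close> of
  \<open>\<Gamma>\<^sub>0(4)\<close> equals 2. The hypotheses say that \<open>f\<close> has order 0 at \<open>\<infinity>\<close>, orders less than 1 at the cusps
  0 and 1/2, and weight \<open>k > 2\<close>. Hence the sum converges absolutely, it is visibly invariant under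
  \<open>\<Gamma>\<^sub>0(4)\<close>, and in the local coordinate \<open>q\<close> of each cusp it is \<open>O(|q| ^ (-x))\<close> with \<open>x < 1\<close>, so that the
  singularity is removable. The maximum principle makes it constant, and at \<open>\<infinity>\<close> only the two rows
  \<open>(0, \<plusminus>1)\<close> survive.

  That \<open>\<chi>\<close> is the character of \<open>f\<close> is Dedekind's transformation law for \<open>log \<eta>\<close>. It is reduced to
  \<open>\<tau> \<mapsto> -1/\<tau>\<close> by the Euclidean algorithm and the reciprocity law for Dedekind sums; the inversion
  formula itself follows from the quasi-modularity of the logarithmic derivative.
\<close>

section \<open>Lattice sums\<close>

text \<open>The orders of \<open>f\<close> at the cusps 0 and 1/2 are (-2 r2 - 5 r4)/8 and -r4/8,
  and order 0 at infinity is the relation r1 + 2 r2 + 4 r4 = 0 between the three exponents. The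
  orders at 0 and 1/2 add up to k/2, so the third inequality of the theorem says k > 2. Since
  \<open>f\<close> has no zeros in the upper half plane, dividing by it replaces a real weight and a
  multiplier by plain invariance. The conditions on D make Dk an integer: the powers of \<epsilon>
  in the character and in the slash factor then cancel, every row is met once for each D-th root of
  unity, and this multiplicity D together with the value 2 yields 2D. The delicate point is the
  branch of the logarithms. The exponents are fractional, so the transformation law must hold for
  log \<eta> itself and not merely for \<eta> up to a 24th root of unity; this is why the inversion
  formula is obtained by integrating a derivative and why Dedekind sums enter exactly.\<close>

lemma has_sum_int_halves:
  fixes f :: "int \<Rightarrow> 'a::banach"
  assumes "((\<lambda>n. f (int n)) has_sum a) UNIV" "((\<lambda>n. f (- 1 - int n)) has_sum b) UNIV"
  shows "(f has_sum (a + b)) UNIV"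
proof -
  have "(f has_sum a) {0..}"
    using assms(1)
    by (subst (asm) has_sum_reindex_bij_witness[of UNIV nat int "{0..}" f _ a a]) auto
  moreover have "(f has_sum b) {..<0}"
    using assms(2)
    by (subst (asm) has_sum_reindex_bij_witness[of UNIV "\<lambda>k. nat (-1-k)" "\<lambda>n. - 1 - int n" "{..<0}" f _ b b]) auto
  moreover have "UNIV = {0..} \<union> {..<(0::int)}" by auto
  ultimately show ?thesis
    by (metis has_sum_Un_disjoint disjoint_iff atLeast_iff lessThan_iff not_less)
qed

lemma summable_on_int_halves:
  fixes f :: "int \<Rightarrow> 'a::banach"
  assumes "(\<lambda>n. f (int n)) summable_on UNIV" "(\<lambda>n. f (- 1 - int n)) summable_on UNIV"
  shows "f summable_on UNIV"
  using assms has_sum_int_halves unfolding summable_on_def by blast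

lemma summable_on_int_powr:
  assumes "s > 1"
  shows "(\<lambda>n::int. (1 + \<bar>real_of_int n\<bar>) powr (-s)) summable_on UNIV"
proof (rule summable_on_int_halves)
  have s: "summable (\<lambda>n. real n powr (-s))"
    using assms by (simp add: summable_real_powr_iff)
  have s1: "summable (\<lambda>n. real (Suc n) powr (-s))"
    using s by (subst summable_Suc_iff)
  have s2: "summable (\<lambda>n. real (Suc (Suc n)) powr (-s))"
    using s1 by (subst summable_Suc_iff[of "\<lambda>n. real (Suc n) powr (-s)"])
  show "(\<lambda>n. (1 + \<bar>real_of_int (int n)\<bar>) powr (-s)) summable_on UNIV"
    using s1 by (subst summable_on_UNIV_nonneg_real_iff) (auto simp: add_ac)
  have "1 + \<bar>real_of_int (- 1 - int n)\<bar> = real (Suc (Suc n))" for n by simp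
  then show "(\<lambda>n. (1 + \<bar>real_of_int (- 1 - int n)\<bar>) powr (-s)) summable_on UNIV"
    using s2 by (subst summable_on_UNIV_nonneg_real_iff) auto
qed

text \<open>Since (1 + |c|)(1 + |d|) \<le> (2 (|c| + |d|))^2 away from the origin, the double series
  is dominated by a product of two one-dimensional series with exponent k/2 > 1. The term at the
  origin is 0 because \<open>0 powr x = 0\<close>.\<close>

lemma summable_on_lattice_powr:
  assumes "k > 2"
  shows "(\<lambda>(c::int, d::int). (\<bar>real_of_int c\<bar> + \<bar>real_of_int d\<bar>) powr (-k)) summable_on UNIV"
proof -
  define g where "g = (\<lambda>n::int. (1 + \<bar>real_of_int n\<bar>) powr (-(k/2)))"
  have g: "g summable_on UNIV"
    unfolding g_def using summable_on_int_powr[of "k/2"] assms by simp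
  have g0: "g n \<ge> 0" for n by (simp add: g_def)
  have "(\<lambda>p. norm ((\<lambda>(c, d). g c * g d) p)) summable_on (UNIV \<times> UNIV)"
    unfolding Infinite_Sum.abs_summable_on_Sigma_iff
    using g g0 by (auto simp: abs_mult infsum_cmult_right' intro!: summable_on_cmult_right summable_on_cmult_left)
  then have "(\<lambda>(c, d). g c * g d) summable_on UNIV"
    by (simp add: abs_summable_summable)
  then have "(\<lambda>p. 2 powr k * (case p of (c, d) \<Rightarrow> g c * g d)) summable_on UNIV"
    by (rule summable_on_cmult_right)
  then show ?thesis
  proof (rule summable_on_comparison_test)
    fix p :: "int \<times> int"
    obtain c d where p: "p = (c, d)" by force
    show "(case p of (c, d) \<Rightarrow> (\<bar>real_of_int c\<bar> + \<bar>real_of_int d\<bar>) powr (-k)) \<le> 2 powr k * (case p of (c, d) \<Rightarrow> g c * g d)"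
    proof (cases "c = 0 \<and> d = 0")
      case True
      then show ?thesis using g0 by (simp add: p)
    next
      case False
      define x y where "x = \<bar>real_of_int c\<bar>" and "y = \<bar>real_of_int d\<bar>"
      have xy: "x \<ge> 0" "y \<ge> 0" "x + y \<ge> 1"
        using False unfolding x_def y_def by linarith+
      have "(1 + x) * (1 + y) \<le> (1 + x + y)\<^sup>2"
        using xy by (simp add: power2_eq_square algebra_simps)
      also have "\<dots> \<le> (2 * (x + y))\<^sup>2"
        using xy by (intro power_mono) auto
      finally have "(1 + x) * (1 + y) \<le> (2 * (x + y))\<^sup>2" .
      then have "((2 * (x + y))\<^sup>2) powr (-(k/2)) \<le> ((1 + x) * (1 + y)) powr (-(k/2))"
        using xy assms by (intro powr_mono2') auto
      also have "((2 * (x + y))\<^sup>2) powr (-(k/2)) = (2 * (x + y)) powr (-k)"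
        using xy by (simp add: powr_powr flip: powr_numeral)
      also have "\<dots> = 2 powr (-k) * (x + y) powr (-k)"
        using xy by (subst powr_mult) auto
      finally have "2 powr k * (2 powr (-k) * (x + y) powr (-k)) \<le> 2 powr k * ((1 + x) * (1 + y)) powr (-(k/2))"
        by (intro mult_left_mono) auto
      then have "(x + y) powr (-k) \<le> 2 powr k * ((1 + x) * (1 + y)) powr (-(k/2))"
        by (simp add: powr_minus flip: mult.assoc)
      then show ?thesis using xy by (simp add: p g_def x_def y_def powr_mult)
    qed
  qed auto
qed

text \<open>The imaginary part controls c, and then the real part controls d. The constant depends
  only on \<open>y0\<close> and \<open>R\<close>, which makes the later majorants uniform in
  \<tau>.\<close>

lemma norm_linear_form_ge:
  assumes "y0 > 0" "Im \<tau> \<ge> y0" "\<bar>Re \<tau>\<bar> \<le> R"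
  shows "\<bar>real_of_int c\<bar> + \<bar>real_of_int d\<bar> \<le> (1 + (1 + R) / y0) * cmod (of_int c * \<tau> + of_int d)"
proof -
  let ?z = "of_int c * \<tau> + of_int d"
  have R: "R \<ge> 0" using assms by linarith
  have "\<bar>real_of_int c\<bar> * y0 \<le> \<bar>real_of_int c\<bar> * \<bar>Im \<tau>\<bar>"
    using assms by (intro mult_left_mono) auto
  also have "\<dots> = \<bar>Im ?z\<bar>" by (simp add: abs_mult)
  also have "\<dots> \<le> cmod ?z" by (rule abs_Im_le_cmod)
  finally have 1: "\<bar>real_of_int c\<bar> \<le> cmod ?z / y0" using assms by (simp add: field_simps)
  have "\<bar>real_of_int d\<bar> \<le> \<bar>Re ?z\<bar> + \<bar>real_of_int c\<bar> * \<bar>Re \<tau>\<bar>"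
    by (simp flip: abs_mult)
  also have "\<dots> \<le> cmod ?z + \<bar>real_of_int c\<bar> * R"
    using assms by (intro add_mono abs_Re_le_cmod mult_left_mono) auto
  finally have "\<bar>real_of_int c\<bar> + \<bar>real_of_int d\<bar> \<le> cmod ?z + \<bar>real_of_int c\<bar> * (1 + R)"
    by (simp add: algebra_simps)
  also have "\<dots> \<le> cmod ?z + cmod ?z / y0 * (1 + R)"
    using 1 R by (intro add_mono mult_right_mono) auto
  finally show ?thesis by (simp add: algebra_simps)
qed

lemma linear_form_powr_le:
  assumes "y0 > 0" "Im \<tau> \<ge> y0" "\<bar>Re \<tau>\<bar> \<le> R" "k \<ge> 0" "(c, d) \<noteq> (0, 0)"
  shows "cmod (of_int c * \<tau> + of_int d) powr (-k)
         \<le> (1 + (1 + R) / y0) powr k * (\<bar>real_of_int c\<bar> + \<bar>real_of_int d\<bar>) powr (-k)"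
proof -
  define A where "A = 1 + (1 + R) / y0"
  define s where "s = \<bar>real_of_int c\<bar> + \<bar>real_of_int d\<bar>"
  have "R \<ge> 0" using assms by linarith
  then have A: "A > 0" using assms(1) by (simp add: A_def add_pos_nonneg)
  have s: "s > 0" using assms(5) unfolding s_def by (auto simp: add_pos_nonneg add_nonneg_pos)
  have "s \<le> A * cmod (of_int c * \<tau> + of_int d)"
    unfolding s_def A_def by (rule norm_linear_form_ge) fact+
  then have "s / A \<le> cmod (of_int c * \<tau> + of_int d)" using A by (simp add: field_simps)
  then have "cmod (of_int c * \<tau> + of_int d) powr (-k) \<le> (s / A) powr (-k)"
    using assms A s by (intro powr_mono2') auto
  also have "\<dots> = A powr k * s powr (-k)"
    using A s by (simp add: powr_divide powr_minus field_simps)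
  finally show ?thesis unfolding A_def s_def .
qed

lemma summable_on_linear_form_powr:
  assumes "k > 2" "Im \<tau> > 0"
  shows "(\<lambda>(c::int, d::int). cmod (of_int c * \<tau> + of_int d) powr (-k)) summable_on UNIV"
proof (rule summable_on_comparison_test[OF summable_on_cmult_right[OF summable_on_lattice_powr[OF assms(1)]]])
  fix p :: "int \<times> int"
  obtain c d where p: "p = (c, d)" by force
  show "(case p of (c, d) \<Rightarrow> cmod (of_int c * \<tau> + of_int d) powr (-k)) \<le>
        (1 + (1 + \<bar>Re \<tau>\<bar>) / Im \<tau>) powr k * (case p of (c, d) \<Rightarrow> (\<bar>real_of_int c\<bar> + \<bar>real_of_int d\<bar>) powr (-k))"
    using linear_form_powr_le[of "Im \<tau>" \<tau> "\<bar>Re \<tau>\<bar>" k c d] assms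
    by (cases "(c, d) = (0, 0)") (auto simp: p)
qed auto

section \<open>Partial fractions of the cotangent\<close>

text \<open>Logarithmic derivative of the reflection formula for \<open>Gamma\<close>.\<close>

lemma Digamma_reflection:
  fixes z :: complex
  assumes "z \<notin> \<int>"
  shows "Digamma (1 - z) - Digamma z = of_real pi * cot (of_real pi * z)"
proof -
  have z: "z \<notin> \<int>\<^sub>\<le>\<^sub>0" "1 - z \<notin> \<int>\<^sub>\<le>\<^sub>0"
    using assms nonpos_Ints_subset_Ints Ints_diff[of 1 "1 - z"] by auto
  have sn: "sin (of_real pi * z) \<noteq> 0"
    using assms by (auto simp: sin_eq_0)
  have "((\<lambda>z. Gamma z * Gamma (1 - z)) has_field_derivative
       Gamma z * Gamma (1 - z) * (Digamma z - Digamma (1 - z))) (at z)"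
    using z by (auto intro!: derivative_eq_intros simp: algebra_simps)
  moreover have "((\<lambda>z. of_real pi / sin (of_real pi * z)) has_field_derivative
       of_real pi / sin (of_real pi * z) * (- of_real pi * cot (of_real pi * z))) (at z)"
    using sn by (auto intro!: derivative_eq_intros simp: cot_def field_simps power2_eq_square)
  moreover have "(\<lambda>z. Gamma z * Gamma (1 - z)) = (\<lambda>z::complex. of_real pi / sin (of_real pi * z))"
    by (simp add: Gamma_reflection_complex)
  ultimately have *: "Gamma z * Gamma (1 - z) * (Digamma z - Digamma (1 - z))
      = Gamma z * Gamma (1 - z) * (- of_real pi * cot (of_real pi * z))"
    by (metis (no_types, lifting) DERIV_unique Gamma_reflection_complex)
  have "Gamma z * Gamma (1 - z) \<noteq> 0"
    using sn by (simp add: Gamma_reflection_complex)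
  with * have "Digamma z - Digamma (1 - z) = - of_real pi * cot (of_real pi * z)"
    using mult_left_cancel by blast
  then show ?thesis by (metis minus_diff_eq minus_minus mult_minus_left)
qed

text \<open>In the difference of the two limit formulas for \<open>Digamma\<close> the terms
  \<open>ln N\<close> cancel and the reciprocals pair up as z + m and z - m; reflection evaluates
  the limit.\<close>

lemma cot_partial_fractions:
  fixes z :: complex
  assumes "z \<notin> \<int>"
  shows "(\<lambda>N. \<Sum>m=1..N. 1 / (z + of_nat m) + 1 / (z - of_nat m)) \<longlonglongrightarrow>
           of_real pi * cot (of_real pi * z) - 1 / z"
proof -
  have z: "z \<noteq> 0" "1 - z \<noteq> 0" using assms by auto
  have nz: "z + of_nat m \<noteq> 0" "z - of_nat m \<noteq> 0" for m
    using assms by (metis Ints_0 Ints_of_nat add_diff_cancel_right' Ints_diff, metis Ints_of_nat eq_iff_diff_eq_0)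
  have "(\<lambda>N. (of_real (ln (real N)) - (\<Sum>n<N. inverse (1 - z + of_nat n)))
         - (of_real (ln (real N)) - (\<Sum>n<N. inverse (z + of_nat n)))) \<longlonglongrightarrow> Digamma (1 - z) - Digamma z"
    by (intro tendsto_diff Digamma_LIMSEQ z)
  then have "(\<lambda>N. (\<Sum>n<N. inverse (z + of_nat n)) - (\<Sum>n<N. inverse (1 - z + of_nat n))) \<longlonglongrightarrow>
     of_real pi * cot (of_real pi * z)"
    by (simp add: Digamma_reflection assms)
  \<comment> \<open>Both sums run over n < N, so compared with the symmetric form 1/z is surplus and
    1/(z + N) is missing; the latter tends to 0.\<close>
  moreover have "(\<lambda>N. inverse (z + of_nat N)) \<longlonglongrightarrow> 0"
    by (intro tendsto_inverse_0_at_top filterlim_compose[OF tendsto_inverse_0] tendsto_add_filterlim_at_infinity[OF tendsto_const] tendsto_of_nat)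
  ultimately have "(\<lambda>N. (\<Sum>n<N. inverse (z + of_nat n)) - (\<Sum>n<N. inverse (1 - z + of_nat n)) + inverse (z + of_nat N) - 1 / z) \<longlonglongrightarrow>
     of_real pi * cot (of_real pi * z) + 0 - 1 / z"
    by (intro tendsto_intros)
  moreover have "(\<Sum>n<N. inverse (z + of_nat n)) - (\<Sum>n<N. inverse (1 - z + of_nat n)) + inverse (z + of_nat N) - 1 / z
     = (\<Sum>m=1..N. 1 / (z + of_nat m) + 1 / (z - of_nat m))" for N
  proof (induction N)
    case 0
    then show ?case by (simp add: field_simps)
  next
    case (Suc N)
    have e: "inverse (1 - z + of_nat N) = - (1 / (z - of_nat (Suc N)))"
      using nz(2)[of "Suc N"]
      by (metis (no_types, lifting) add_diff_eq diff_add_eq inverse_eq_divide minus_diff_eq minus_divide_right of_nat_Suc)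
    show ?case using Suc.IH unfolding sum.lessThan_Suc e by (simp add: inverse_eq_divide algebra_simps)
  qed
  ultimately show ?thesis by simp
qed

text \<open>Differentiating the reflection formula for \<open>Digamma\<close> gives two trigamma
  values. Their series are the halves n \<ge> 0 and n < 0 of the sum over the integers.\<close>

lemma sin_squared_partial_fractions:
  fixes z :: complex
  assumes "z \<notin> \<int>"
  shows "((\<lambda>n::int. 1 / (z + of_int n)^2) has_sum (of_real pi ^ 2 / sin (of_real pi * z) ^ 2)) UNIV"
proof -
  have sn: "sin (of_real pi * w) \<noteq> 0" if "w \<notin> \<int>" for w :: complex
    using that by (auto simp: sin_eq_0)
  have z: "z \<notin> \<int>\<^sub>\<le>\<^sub>0" "1 - z \<notin> \<int>\<^sub>\<le>\<^sub>0"
    using assms nonpos_Ints_subset_Ints Ints_diff[of 1 "1 - z"] by auto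
  have z0: "z \<noteq> 0" "1 - z \<noteq> 0" using assms by auto
  have d1: "((\<lambda>z. Digamma (1 - z) - Digamma z) has_field_derivative - Polygamma 1 (1 - z) - Polygamma 1 z) (at z)"
    using z by (auto intro!: derivative_eq_intros)
  have d2: "((\<lambda>z. of_real pi * cot (of_real pi * z)) has_field_derivative - (of_real pi ^ 2 / sin (of_real pi * z) ^ 2)) (at z)"
  proof -
    have "((\<lambda>z. of_real pi * (cos (of_real pi * z) / sin (of_real pi * z))) has_field_derivative
        of_real pi * (of_real pi * (- sin (of_real pi * z) * sin (of_real pi * z) - cos (of_real pi * z) * cos (of_real pi * z)) / (sin (of_real pi * z))\<^sup>2)) (at z)"
      using sn[OF assms] by (auto intro!: derivative_eq_intros simp: power2_eq_square algebra_simps)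
    moreover have "- sin (of_real pi * z) * sin (of_real pi * z) - cos (of_real pi * z) * cos (of_real pi * z) = -1"
      using sin_cos_squared_add[of "of_real pi * z"] by (simp add: power2_eq_square algebra_simps)
    ultimately show ?thesis by (simp add: cot_def power2_eq_square)
  qed
  have op: "open (- \<int> :: complex set)" using closed_Ints by blast
  have "((\<lambda>z. of_real pi * cot (of_real pi * z)) has_field_derivative - Polygamma 1 (1 - z) - Polygamma 1 z) (at z)"
    using d1 op
    by (rule has_field_derivative_transform_within_open) (use assms Digamma_reflection in auto)
  then have "- (of_real pi ^ 2 / sin (of_real pi * z) ^ 2) = - Polygamma 1 (1 - z) - Polygamma 1 z"
    using d2 DERIV_unique by blast
  then have eq: "of_real pi ^ 2 / sin (of_real pi * z) ^ 2 = Polygamma 1 z + Polygamma 1 (1 - z)"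
    by (simp add: algebra_simps)
  have pg: "((\<lambda>n. 1 / (w + of_nat n)^2) has_sum Polygamma 1 w) UNIV" if w: "w \<noteq> 0" for w :: complex
  proof (rule norm_summable_imp_has_sum)
    show "(\<lambda>n. 1 / (w + of_nat n)^2) sums Polygamma 1 w"
      using Polygamma_LIMSEQ[OF w, of 1] by (simp add: inverse_eq_divide power2_eq_square)
    show "summable (\<lambda>n. norm (1 / (w + of_nat n)^2))"
    proof (rule summable_comparison_test_ev)
      show "summable (\<lambda>n. 4 * real n powr (-2))"
        by (intro summable_mult) (simp add: summable_real_powr_iff)
      show "\<forall>\<^sub>F n in sequentially. norm (norm (1 / (w + of_nat n)^2)) \<le> 4 * real n powr (-2)"
        using eventually_ge_at_top[of "nat \<lceil>2 * norm w\<rceil> + 1"]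
      proof eventually_elim
        case (elim n)
        then have n: "real n \<ge> 2 * norm w" "n > 0" by linarith+
        have "real n \<le> norm (w + of_nat n) + norm w"
          by (metis add_diff_cancel_left' norm_of_nat norm_triangle_ineq4)
        then have "real n / 2 \<le> norm (w + of_nat n)" using n by simp
        then have "(real n / 2)^2 \<le> norm (w + of_nat n)^2" by (intro power_mono) auto
        then have "1 / norm (w + of_nat n)^2 \<le> 1 / (real n / 2)^2"
          using n by (intro divide_left_mono mult_pos_pos) auto
        then show ?case using n
          by (simp add: norm_divide norm_power powr_minus powr_numeral field_simps)
      qed
    qed
  qed
  show ?thesis unfolding eq
  proof (rule has_sum_int_halves)
    show "((\<lambda>n. 1 / (z + of_int (int n))\<^sup>2) has_sum Polygamma 1 z) UNIV"
      using pg[OF z0(1)] by simp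
    have "(z + of_int (- 1 - int n))\<^sup>2 = (1 - z + of_nat n)\<^sup>2" for n
      by (simp add: power2_eq_square algebra_simps)
    then show "((\<lambda>n. 1 / (z + of_int (- 1 - int n))\<^sup>2) has_sum Polygamma 1 (1 - z)) UNIV"
      using pg[OF z0(2)] by simp
  qed
qed

section \<open>The logarithm of the eta function\<close>

abbreviation upper :: "complex set" where "upper \<equiv> {z. Im z > 0}"

lemma open_upper: "open upper" and convex_upper: "convex upper"
  by (simp_all add: open_halfspace_Im_gt convex_halfspace_Im_gt)

lemma norm_ee: "norm (ee \<tau>) = exp (- 2 * pi * Im \<tau>)"
  by (simp add: ee_def norm_exp_eq_Re)

lemma norm_ee_less_1: "Im \<tau> > 0 \<Longrightarrow> norm (ee \<tau>) < 1"
  by (simp add: norm_ee)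

lemma ee_nonzero [simp]: "ee \<tau> \<noteq> 0"
  by (simp add: ee_def)

lemma ee_of_nat_mult: "ee (of_nat n * \<tau>) = ee \<tau> ^ n"
  unfolding ee_def exp_of_nat_mult[symmetric] by (simp only: mult_ac)

lemma ee_add_int: "ee (\<tau> + of_int n) = ee \<tau>"
proof -
  have "exp (2 * of_real pi * \<i> * of_int n) = 1"
    using exp_2pi_1_int[of n] by (simp add: mult_ac)
  then show ?thesis by (simp add: ee_def ring_distribs exp_add)
qed

text \<open>Dropping the factors 1/n turns the logarithmic series into a geometric majorant.\<close>

lemma norm_Ln_one_minus_le:
  fixes w :: complex
  assumes "norm w < 1"
  shows "norm (Ln (1 - w)) \<le> norm w / (1 - norm w)"
proof -
  have s: "(\<lambda>n. - (w ^ n) / of_nat n) sums Ln (1 - w)"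
    using Ln_series'[of "-w"] assms by simp
  have "(\<lambda>n. norm w * norm w ^ n) sums (norm w * (1 / (1 - norm w)))"
    using assms by (intro sums_mult geometric_sums) auto
  then have "(\<lambda>n. (\<lambda>n. if n = 0 then 0 else norm w ^ n) (Suc n)) sums (norm w / (1 - norm w))"
    by simp
  then have g: "(\<lambda>n. if n = 0 then 0 else norm w ^ n) sums (norm w / (1 - norm w))"
    by (subst (asm) sums_Suc_iff) simp
  show ?thesis
  proof (rule norm_sums_le[OF s g])
    fix n show "norm (- (w ^ n) / of_nat n) \<le> (if n = 0 then 0 else norm w ^ n)"
    proof (cases n)
      case (Suc m)
      have "norm w ^ n / real n \<le> norm w ^ n / 1"
        using Suc by (intro divide_left_mono) auto
      then show ?thesis using Suc by (simp add: norm_divide norm_power del: power_Suc of_nat_Suc)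
    qed auto
  qed
qed

definition eta_log_series :: "complex \<Rightarrow> complex" where
  "eta_log_series \<tau> = (\<Sum>n. Ln (1 - ee \<tau> ^ Suc n))"

text \<open>The branch of log \<eta> that adds principal logarithms of the factors. Each factor 1 -
  q^n avoids the cut since |q| < 1, so every term is holomorphic; unlike the contour integral in
  \<open>logeta\<close>, this form can be estimated and differentiated termwise.\<close>

definition Leta :: "complex \<Rightarrow> complex" where
  "Leta \<tau> = of_real pi * \<i> * \<tau> / 12 + eta_log_series \<tau>"

lemma norm_eta_log_term_le:
  assumes "Im \<tau> \<ge> y" "y > 0"
  shows "norm (Ln (1 - ee \<tau> ^ Suc n)) \<le> exp (-2 * pi * y) / (1 - exp (-2 * pi * y)) * exp (-2 * pi * y) ^ n"
proof -
  define \<rho> where "\<rho> = exp (-2 * pi * y)"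
  have \<rho>: "0 < \<rho>" "\<rho> < 1" using assms by (auto simp: \<rho>_def)
  have q: "norm (ee \<tau>) \<le> \<rho>" using assms by (simp add: norm_ee \<rho>_def)
  then have le: "norm (ee \<tau> ^ Suc n) \<le> \<rho> ^ Suc n"
    by (subst norm_power) (intro power_mono, auto)
  have "\<rho> ^ Suc n \<le> \<rho>" using \<rho> by (simp add: mult_le_cancel_left1 power_le_one)
  then have 1: "norm (ee \<tau> ^ Suc n) \<le> \<rho>" using le by linarith
  then have "norm (Ln (1 - ee \<tau> ^ Suc n)) \<le> norm (ee \<tau> ^ Suc n) / (1 - norm (ee \<tau> ^ Suc n))"
    using \<rho> by (intro norm_Ln_one_minus_le) linarith
  also have "\<dots> \<le> \<rho> ^ Suc n / (1 - \<rho>)"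
    using le 1 \<rho> by (intro frac_le) auto
  finally show ?thesis by (simp add: \<rho>_def)
qed

lemma summable_eta_log_bound:
  "y > 0 \<Longrightarrow> summable (\<lambda>n. exp (-2 * pi * y) / (1 - exp (-2 * pi * y)) * exp (-2 * pi * y) ^ n)"
  by (intro summable_mult summable_geometric) auto

lemma sums_eta_log_series:
  assumes "Im \<tau> > 0"
  shows "(\<lambda>n. Ln (1 - ee \<tau> ^ Suc n)) sums eta_log_series \<tau>"
  unfolding eta_log_series_def
  using norm_eta_log_term_le[of "Im \<tau>" \<tau>] assms
  by (intro summable_sums summable_comparison_test'[OF summable_eta_log_bound[OF assms], of 0]) auto

lemma norm_eta_log_series_le:
  assumes "Im \<tau> \<ge> y" "y > 0"
  shows "norm (eta_log_series \<tau>) \<le> exp (-2 * pi * y) / (1 - exp (-2 * pi * y))\<^sup>2"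
proof -
  define \<rho> where "\<rho> = exp (-2 * pi * y)"
  have \<rho>: "0 < \<rho>" "\<rho> < 1" using assms by (auto simp: \<rho>_def)
  have a: "(\<lambda>n. \<rho> / (1 - \<rho>) * \<rho> ^ n) sums (\<rho> / (1 - \<rho>) * (1 / (1 - \<rho>)))"
    using \<rho> by (intro sums_mult geometric_sums) auto
  have b: "(\<lambda>n. Ln (1 - ee \<tau> ^ Suc n)) sums eta_log_series \<tau>"
    using assms by (intro sums_eta_log_series) auto
  have c: "norm (Ln (1 - ee \<tau> ^ Suc n)) \<le> \<rho> / (1 - \<rho>) * \<rho> ^ n" for n
    unfolding \<rho>_def by (rule norm_eta_log_term_le[OF assms])
  have "norm (eta_log_series \<tau>) \<le> \<rho> / (1 - \<rho>) * (1 / (1 - \<rho>))"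
    by (rule norm_sums_le[OF b a c])
  then show ?thesis by (simp add: \<rho>_def power2_eq_square)
qed

lemma one_minus_ee_power_not_nonpos:
  assumes "Im \<tau> > 0"
  shows "1 - ee \<tau> ^ Suc n \<notin> \<real>\<^sub>\<le>\<^sub>0"
proof
  assume "1 - ee \<tau> ^ Suc n \<in> \<real>\<^sub>\<le>\<^sub>0"
  then have "Re (ee \<tau> ^ Suc n) \<ge> 1" by (simp add: complex_nonpos_Reals_iff)
  moreover have "norm (ee \<tau> ^ Suc n) < 1"
    unfolding norm_power using norm_ee_less_1[OF assms] by (intro power_Suc_less_one) auto
  ultimately show False using complex_Re_le_cmod[of "ee \<tau> ^ Suc n"] by linarith
qed

lemma has_field_derivative_ee [derivative_intros]:
  assumes "(f has_field_derivative f') (at x within A)"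
  shows "((\<lambda>x. ee (f x)) has_field_derivative (2 * of_real pi * \<i> * f' * ee (f x))) (at x within A)"
  unfolding ee_def using assms by (auto intro!: derivative_eq_intros)

text \<open>Termwise differentiation, justified by the majorant at half the height of the point. The
  value of the Lambert series stays anonymous here; \<open>Leta_deriv\<close> computes it in another
  form.\<close>

lemma deriv_eta_log_series:
  assumes "Im \<tau> > 0"
  shows "\<exists>D. (\<lambda>n. - (2 * of_real pi * \<i> * (of_nat (Suc n) * ee \<tau> ^ Suc n / (1 - ee \<tau> ^ Suc n)))) sums D
          \<and> (eta_log_series has_field_derivative D) (at \<tau>)"
proof -
  define f where "f = (\<lambda>n \<tau>. Ln (1 - ee \<tau> ^ Suc n))"
  define f' where "f' = (\<lambda>n \<tau>. - (2 * of_real pi * \<i> * (of_nat (Suc n) * ee \<tau> ^ Suc n / (1 - ee \<tau> ^ Suc n))))"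
  have "\<exists>g g'. \<forall>x\<in>upper. (\<lambda>n. f n x) sums g x \<and> (\<lambda>n. f' n x) sums g' x \<and> (g has_field_derivative g' x) (at x)"
  proof (rule series_and_derivative_comparison_local[OF open_upper])
    fix n x assume "x \<in> upper"
    then have np: "1 - ee x ^ Suc n \<notin> \<real>\<^sub>\<le>\<^sub>0" by (intro one_minus_ee_power_not_nonpos) auto
    show "(f n has_field_derivative f' n x) (at x)"
      unfolding f_def f'_def using np
      by (auto intro!: derivative_eq_intros simp: divide_simps simp del: power_Suc)
         (auto simp: algebra_simps)
  next
    fix x assume "x \<in> upper"
    then have x: "Im x > 0" by simp
    define h where "h = (\<lambda>n. exp (-2 * pi * (Im x/2)) / (1 - exp (-2 * pi * (Im x/2))) * exp (-2 * pi * (Im x/2)) ^ n)"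
    have "norm (f n y) \<le> h n" if "y \<in> ball x (Im x / 2)" for n y
    proof -
      have "\<bar>Im (x - y)\<bar> < Im x / 2"
        using that abs_Im_le_cmod[of "x - y"] by (simp add: dist_norm)
      then have "Im y \<ge> Im x / 2" unfolding minus_complex.sel by linarith
      then show ?thesis unfolding f_def h_def by (intro norm_eta_log_term_le) (use x in auto)
    qed
    moreover have "summable h" unfolding h_def using x by (intro summable_eta_log_bound) auto
    ultimately show "\<exists>d h. 0 < d \<and> summable h \<and> (\<forall>\<^sub>F n in sequentially. \<forall>y\<in>ball x d \<inter> upper. norm (f n y) \<le> h n)"
      using x by (intro exI[of _ "Im x / 2"] exI[of _ h]) auto
  qed
  then obtain g g' where g: "\<And>x. Im x > 0 \<Longrightarrow> (\<lambda>n. f n x) sums g x"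
      "\<And>x. Im x > 0 \<Longrightarrow> (\<lambda>n. f' n x) sums g' x" "\<And>x. Im x > 0 \<Longrightarrow> (g has_field_derivative g' x) (at x)"
    by auto
  have eq: "g x = eta_log_series x" if "x \<in> upper" for x
    using g(1)[of x] sums_eta_log_series[of x] that sums_unique2 unfolding f_def by auto
  have "(eta_log_series has_field_derivative g' \<tau>) (at \<tau>)"
    by (rule has_field_derivative_transform_within_open[OF g(3)[OF assms] open_upper]) (use assms eq in auto)
  then show ?thesis using g(2)[OF assms] unfolding f'_def by blast
qed

lemma exp_Leta:
  assumes "Im \<tau> > 0"
  shows "exp (Leta \<tau>) = eta \<tau>"
proof -
  have "raw_has_prod (\<lambda>n. exp (Ln (1 - ee \<tau> ^ Suc n))) 0 (exp (eta_log_series \<tau>))"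
    by (intro sums_imp_has_prod_exp sums_eta_log_series assms)
  moreover have "exp (Ln (1 - ee \<tau> ^ Suc n)) = 1 - ee \<tau> ^ Suc n" for n
  proof (rule exp_Ln)
    show "1 - ee \<tau> ^ Suc n \<noteq> 0" using one_minus_ee_power_not_nonpos[OF assms, of n] by force
  qed
  ultimately have "(\<lambda>n. 1 - ee \<tau> ^ Suc n) has_prod exp (eta_log_series \<tau>)"
    unfolding has_prod_def by simp
  then have "(\<Prod>n. 1 - ee \<tau> ^ Suc n) = exp (eta_log_series \<tau>)"
    by (metis has_prod_unique)
  then show ?thesis
    by (simp add: eta_def Leta_def exp_add ee_def mult_ac)
qed

lemma eta_log_series_field_differentiable:
  "Im \<tau> > 0 \<Longrightarrow> eta_log_series field_differentiable (at \<tau>)"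
  unfolding field_differentiable_def using deriv_eta_log_series[of \<tau>] by auto

lemma Leta_field_differentiable: "Im \<tau> > 0 \<Longrightarrow> Leta field_differentiable (at \<tau>)"
  unfolding Leta_def
  by (intro field_differentiable_add field_differentiable_divide field_differentiable_mult field_differentiable_const
      field_differentiable_ident eta_log_series_field_differentiable) auto

text \<open>\<open>Leta\<close> is a primitive of the logarithmic derivative of \<open>eta\<close>
  on the convex upper half plane, so the integral is \<open>Leta \<tau> - Leta \<i>\<close>. At \<i>
  the nome exp(-2 pi) is real, hence \<open>Leta \<i>\<close> is real and equals the principal
  logarithm of \<open>eta \<i>\<close>.\<close>

lemma logeta_eq_Leta:
  assumes "Im \<tau> > 0"
  shows "logeta \<tau> = Leta \<tau>"
proof -
  have d: "(Leta has_field_derivative deriv eta z / eta z) (at z within upper)" if "z \<in> upper" for z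
  proof -
    have L: "(Leta has_field_derivative deriv Leta z) (at z)"
      using Leta_field_differentiable that by (simp add: field_differentiable_derivI)
    have "((\<lambda>z. exp (Leta z)) has_field_derivative deriv Leta z * eta z) (at z)"
      using L that by (auto intro!: derivative_eq_intros simp flip: exp_Leta)
    then have "(eta has_field_derivative deriv Leta z * eta z) (at z)"
      by (rule has_field_derivative_transform_within_open[OF _ open_upper]) (use that exp_Leta in auto)
    then have "deriv eta z = deriv Leta z * eta z" by (rule DERIV_imp_deriv)
    moreover have "eta z \<noteq> 0" using that by (auto simp flip: exp_Leta)
    ultimately have "deriv eta z / eta z = deriv Leta z" by simp
    then show ?thesis using L by (simp add: has_field_derivative_at_within)
  qed
  have "path_image (linepath \<i> \<tau>) \<subseteq> upper"
    using convex_upper assms by (simp add: closed_segment_subset)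
  then have "((\<lambda>z. deriv eta z / eta z) has_contour_integral Leta \<tau> - Leta \<i>) (linepath \<i> \<tau>)"
    using contour_integral_primitive[OF d, of "linepath \<i> \<tau>"] by simp
  then have 1: "contour_integral (linepath \<i> \<tau>) (\<lambda>z. deriv eta z / eta z) = Leta \<tau> - Leta \<i>"
    by (rule contour_integral_unique)
  have "ee \<i> = of_real (exp (- 2 * pi))"
    by (simp add: ee_def exp_of_real[symmetric] mult_ac)
  then have t: "Ln (1 - ee \<i> ^ Suc n) = of_real (ln (1 - exp (- 2 * pi) ^ Suc n))" for n
  proof -
    assume e: "ee \<i> = of_real (exp (- 2 * pi))"
    have "exp (- 2 * pi) ^ Suc n < 1" by (intro power_Suc_less_one) auto
    then have "0 < 1 - exp (- 2 * pi) ^ Suc n" by linarith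
    then show ?thesis using Ln_of_real[of "1 - exp (- 2 * pi) ^ Suc n"] unfolding e
      by (simp only: of_real_1 of_real_diff of_real_power)
  qed
  have "Im (Leta \<i>) = 0"
  proof -
    have "(\<lambda>n. Im (Ln (1 - ee \<i> ^ Suc n))) sums Im (eta_log_series \<i>)"
      using sums_eta_log_series[of \<i>] by (simp add: sums_Im del: power_Suc)
    then have "Im (eta_log_series \<i>) = 0" unfolding t by (simp add: sums_unique2)
    then show ?thesis by (simp add: Leta_def)
  qed
  then have "Ln (eta \<i>) = Leta \<i>"
    by (simp add: pi_gt_zero flip: exp_Leta)
  with 1 show ?thesis by (simp add: logeta_def)
qed

text \<open>Expanding the geometric series and summing in the other order turns the Lambert series into one
  over inverse squared sines.\<close>
lemma Leta_deriv:
  assumes "Im \<tau> > 0"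
  shows "\<exists>A. (\<lambda>m. of_real pi ^ 2 / sin (of_real pi * (of_nat (Suc m) * \<tau>)) ^ 2) sums A \<and>
     (Leta has_field_derivative (\<i> / (2 * of_real pi) * (of_real pi ^ 2 / 6 + A))) (at \<tau>)"
proof -
  define q where "q = ee \<tau>"
  define \<rho> where "\<rho> = norm q"
  have \<rho>: "0 < \<rho>" "\<rho> < 1" using norm_ee_less_1[OF assms] by (auto simp: \<rho>_def q_def)
  define t where "t = (\<lambda>(n, m). of_nat (Suc n) * q ^ (Suc n * Suc m))"
  have sn: "summable (\<lambda>n. real (Suc n) * \<rho> ^ n)"
    using geometric_deriv_sums[of \<rho>] \<rho> by (auto simp: sums_iff)
  have a: "(\<lambda>n. real (Suc n) * \<rho> ^ n) summable_on UNIV"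
    using sn \<rho> by (subst summable_on_UNIV_nonneg_real_iff) auto
  have b: "(\<lambda>n. \<rho> ^ n) summable_on UNIV"
    using \<rho> by (subst summable_on_UNIV_nonneg_real_iff) auto
  \<comment> \<open>The majorant splits as a product; it dominates because (n + 1)(m + 1) \<ge> n +
    m and \<rho> < 1.\<close>
  have "(\<lambda>p. norm ((\<lambda>(n, m). (real (Suc n) * \<rho> ^ n) * \<rho> ^ m) p)) summable_on (UNIV \<times> UNIV)"
    unfolding Infinite_Sum.abs_summable_on_Sigma_iff
    using a b \<rho> by (auto simp: abs_mult infsum_cmult_right' infsum_nonneg simp del: of_nat_Suc intro!: summable_on_cmult_right summable_on_cmult_left)
  then have "(\<lambda>p. norm (t p)) summable_on (UNIV \<times> UNIV)"
  proof (rule summable_on_comparison_test)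
    fix p :: "nat \<times> nat"
    obtain n m where p: "p = (n, m)" by force
    have "\<rho> ^ (Suc n * Suc m) \<le> \<rho> ^ (n + m)"
      using \<rho> by (intro power_decreasing) auto
    then show "norm (t p) \<le> norm ((\<lambda>(n, m). (real (Suc n) * \<rho> ^ n) * \<rho> ^ m) p)"
      using \<rho> unfolding p t_def by (simp add: norm_mult norm_power power_add \<rho>_def[symmetric] mult.assoc del: of_nat_Suc mult_Suc mult_Suc_right)
  qed auto
  then have ts: "t summable_on (UNIV \<times> UNIV)" by (rule abs_summable_summable)
  have q1: "norm (q ^ Suc n) < 1" for n
    unfolding norm_power using \<rho> by (intro power_Suc_less_one) (auto simp: \<rho>_def)
  have r: "((\<lambda>m. t (n, m)) has_sum (of_nat (Suc n) * q ^ Suc n / (1 - q ^ Suc n))) UNIV" for n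
  proof -
    have "(\<lambda>m. (q ^ Suc n) ^ m) sums (1 / (1 - q ^ Suc n))"
      using q1 by (intro geometric_sums)
    then have "((\<lambda>m. (q ^ Suc n) ^ m) has_sum (1 / (1 - q ^ Suc n))) UNIV"
      by (rule norm_summable_imp_has_sum[rotated]) (use q1[of n] in \<open>auto simp: norm_power simp del: power_Suc intro!: summable_geometric\<close>)
    then have "((\<lambda>m. (of_nat (Suc n) * q ^ Suc n) * (q ^ Suc n) ^ m) has_sum (of_nat (Suc n) * q ^ Suc n) * (1 / (1 - q ^ Suc n))) UNIV"
      by (rule has_sum_cmult_right)
    moreover have "(of_nat (Suc n) * q ^ Suc n) * (q ^ Suc n) ^ m = t (n, m)" for m
      unfolding t_def by (simp add: power_mult[symmetric] power_add[symmetric] algebra_simps flip: power_Suc)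
    ultimately show ?thesis by simp
  qed
  have s: "((\<lambda>n. t (n, m)) has_sum (q ^ Suc m / (1 - q ^ Suc m)\<^sup>2)) UNIV" for m
  proof -
    have 1: "(\<lambda>n. of_nat (Suc n) * (q ^ Suc m) ^ n) sums (1 / (1 - q ^ Suc m)\<^sup>2)"
      using q1 by (intro geometric_deriv_sums)
    have 2: "summable (\<lambda>n. norm (of_nat (Suc n) * (q ^ Suc m) ^ n))"
      using geometric_deriv_sums[of "norm (q ^ Suc m)"] q1[of m]
      by (auto simp: sums_iff norm_mult norm_power simp del: of_nat_Suc power_Suc)
    have "((\<lambda>n. of_nat (Suc n) * (q ^ Suc m) ^ n) has_sum (1 / (1 - q ^ Suc m)\<^sup>2)) UNIV"
      using norm_summable_imp_has_sum[OF 2 1] .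
    then have "((\<lambda>n. q ^ Suc m * (of_nat (Suc n) * (q ^ Suc m) ^ n)) has_sum (q ^ Suc m * (1 / (1 - q ^ Suc m)\<^sup>2))) UNIV"
      by (rule has_sum_cmult_right)
    moreover have "q ^ Suc m * (of_nat (Suc n) * (q ^ Suc m) ^ n) = t (n, m)" for n
      unfolding t_def by (simp add: power_mult[symmetric] power_add[symmetric] algebra_simps flip: power_Suc)
    ultimately show ?thesis by simp
  qed
  obtain B where B: "(t has_sum B) (UNIV \<times> UNIV)" using ts by (auto simp: summable_on_def)
  have B1: "((\<lambda>n. of_nat (Suc n) * q ^ Suc n / (1 - q ^ Suc n)) has_sum B) UNIV"
    by (rule has_sum_SigmaD[OF B]) (use r in auto)
  have "((\<lambda>(m, n). t (n, m)) has_sum B) (UNIV \<times> UNIV)"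
    using B by (subst (asm) has_sum_reindex_bij_witness[of _ prod.swap prod.swap "UNIV \<times> UNIV" "\<lambda>(m, n). t (n, m)" _ B B]) auto
  then have B2: "((\<lambda>m. q ^ Suc m / (1 - q ^ Suc m)\<^sup>2) has_sum B) UNIV"
    by (rule has_sum_SigmaD) (use s in auto)
  obtain D where D: "(\<lambda>n. - (2 * of_real pi * \<i> * (of_nat (Suc n) * q ^ Suc n / (1 - q ^ Suc n)))) sums D"
    "(eta_log_series has_field_derivative D) (at \<tau>)"
    using deriv_eta_log_series[OF assms] unfolding q_def by blast
  have "(\<lambda>n. - (2 * of_real pi * \<i> * (of_nat (Suc n) * q ^ Suc n / (1 - q ^ Suc n)))) sums (- (2 * of_real pi * \<i> * B))"
    using has_sum_imp_sums[OF B1] by (intro sums_minus sums_mult)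
  with D(1) have DB: "D = - (2 * of_real pi * \<i> * B)" by (rule sums_unique2)
  \<comment> \<open>With w = exp(pi i (m + 1) \<tau>) one has q^(m+1) = w^2 and the sine is (w -
    1/w) / (2 i), so its square is a multiple of (1 - w^2)^2 / w^2.\<close>
  have sinq: "of_real pi ^ 2 / sin (of_real pi * (of_nat (Suc m) * \<tau>)) ^ 2 = - 4 * of_real pi ^ 2 * (q ^ Suc m / (1 - q ^ Suc m)\<^sup>2)" for m
  proof -
    define w where "w = exp (\<i> * (of_real pi * (of_nat (Suc m) * \<tau>)))"
    have w: "w \<noteq> 0" by (simp add: w_def)
    have qw: "q ^ Suc m = w\<^sup>2"
      unfolding q_def w_def ee_of_nat_mult[symmetric] by (simp add: ee_def mult_ac flip: exp_double)
    have "sin (of_real pi * (of_nat (Suc m) * \<tau>)) = (w - 1 / w) / (2 * \<i>)"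
      unfolding sin_exp_eq w_def exp_minus by (simp only: inverse_eq_divide)
    also have "\<dots> = - \<i> * (w\<^sup>2 - 1) / (2 * w)" using w by (simp add: field_simps power2_eq_square)
    finally have "sin (of_real pi * (of_nat (Suc m) * \<tau>)) ^ 2 = - (1 - w\<^sup>2)\<^sup>2 / (4 * w\<^sup>2)"
      by (simp add: power_divide power_mult_distrib power2_commute[of "w\<^sup>2" 1])
    then show ?thesis unfolding qw by simp
  qed
  have "(\<lambda>m. of_real pi ^ 2 / sin (of_real pi * (of_nat (Suc m) * \<tau>)) ^ 2) sums (- 4 * of_real pi ^ 2 * B)"
    unfolding sinq using has_sum_imp_sums[OF B2] by (intro sums_mult)
  moreover have "(Leta has_field_derivative (of_real pi * \<i> / 12 + D)) (at \<tau>)"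
    unfolding Leta_def using D(2) by (auto intro!: derivative_eq_intros)
  \<comment> \<open>The factor i / (2 pi) turns pi i / 12 into pi^2 / 6, which is half of the sum of
    1/n^2 over nonzero integers n: the row m = 0 of the lattice sum.\<close>
  moreover have e: "of_real pi * \<i> / 12 + D = \<i> / (2 * of_real pi) * (of_real pi ^ 2 / 6 + (- 4 * of_real pi ^ 2 * B))"
    unfolding DB by (simp add: field_simps power2_eq_square)
  ultimately show ?thesis unfolding e by blast
qed

section \<open>Inversion\<close>

lemma nonreal_not_Ints: "Im z \<noteq> 0 \<Longrightarrow> z \<notin> \<int>"
  by (auto simp: complex_is_Int_iff)

text \<open>The sets 0 < |n| \<le> N are cofinal among the finite subsets of the nonzero integers.
  Symmetric partial sums are the form in which the telescoping sums and the cotangent series can be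
  evaluated.\<close>

lemma has_sum_int_symmetric_limit:
  fixes f :: "int \<Rightarrow> 'a::banach"
  assumes "(f has_sum S) (-{0})"
  shows "(\<lambda>N. \<Sum>n=1..N. f (int n) + f (- int n)) \<longlonglongrightarrow> S"
proof -
  define X where "X = (\<lambda>N. int ` {1..N} \<union> (\<lambda>n. - int n) ` {1..N})"
  have "filterlim X (finite_subsets_at_top (-{0})) sequentially"
    unfolding filterlim_finite_subsets_at_top
  proof (intro allI impI)
    fix Y :: "int set" assume Y: "finite Y \<and> Y \<subseteq> -{0}"
    then have "finite ((\<lambda>y. nat \<bar>y\<bar>) ` Y)" by simp
    then obtain M where M: "\<And>y. y \<in> Y \<Longrightarrow> nat \<bar>y\<bar> \<le> M"
      by (metis finite_nat_set_iff_bounded_le imageI)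
    have "finite (X N) \<and> Y \<subseteq> X N \<and> X N \<subseteq> -{0}" if "N \<ge> M" for N
    proof (intro conjI subsetI)
      show "finite (X N)" by (simp add: X_def)
      fix y assume y: "y \<in> Y"
      have "y \<noteq> 0" "nat \<bar>y\<bar> \<le> N" using y Y M[OF y] that by auto
      moreover have "y = int (nat \<bar>y\<bar>) \<or> y = - int (nat \<bar>y\<bar>)" by auto
      moreover have "nat \<bar>y\<bar> \<in> {1..N}" using calculation by auto
      ultimately show "y \<in> X N" unfolding X_def by blast
    qed (auto simp: X_def)
    then show "\<forall>\<^sub>F N in sequentially. finite (X N) \<and> Y \<subseteq> X N \<and> X N \<subseteq> -{0}"
      using eventually_sequentially by blast
  qed
  then have "(\<lambda>N. sum f (X N)) \<longlonglongrightarrow> S"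
    using assms unfolding has_sum_def by (rule filterlim_compose[rotated])
  moreover have "sum f (X N) = (\<Sum>n=1..N. f (int n) + f (- int n))" for N
  proof -
    have "sum f (X N) = sum f (int ` {1..N}) + sum f ((\<lambda>n. - int n) ` {1..N})"
      unfolding X_def by (intro sum.union_disjoint) auto
    also have "\<dots> = (\<Sum>n=1..N. f (int n)) + (\<Sum>n=1..N. f (- int n))"
      by (simp add: sum.reindex inj_on_def)
    finally show ?thesis by (simp add: sum.distrib)
  qed
  ultimately show ?thesis by simp
qed

lemma has_sum_int_symmetric_limit_UNIV:
  fixes f :: "int \<Rightarrow> 'a::banach"
  assumes "(f has_sum S) UNIV"
  shows "(\<lambda>N. f 0 + (\<Sum>n=1..N. f (int n) + f (- int n))) \<longlonglongrightarrow> S"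
proof -
  have "(f has_sum (S - f 0)) (UNIV - {0})"
    by (rule has_sum_Diff[OF assms]) (auto intro: has_sum_finiteI)
  then have "(\<lambda>N. f 0 + (\<Sum>n=1..N. f (int n) + f (- int n))) \<longlonglongrightarrow> f 0 + (S - f 0)"
    by (intro tendsto_add tendsto_const has_sum_int_symmetric_limit) (simp add: Compl_eq_Diff_UNIV)
  then show ?thesis by simp
qed

text \<open>Expressed through \<open>ee (- z)\<close>, which decays along z = N / \<tau> because -1
  / \<tau> lies in the upper half plane.\<close>

lemma cot_pi_eq_ee: "cot (of_real pi * z) = \<i> * (1 + ee (- z)) / (1 - ee (- z))"
proof -
  define e where "e = exp (\<i> * (of_real pi * z))"
  have e: "e \<noteq> 0" by (simp add: e_def)
  have ee: "ee (- z) = 1 / e\<^sup>2"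
    by (simp add: ee_def e_def exp_minus mult_ac inverse_eq_divide flip: exp_double)
  have c: "cos (of_real pi * z) = e / 2 * (1 + 1 / e\<^sup>2)"
    unfolding cos_exp_eq exp_minus e_def[symmetric] using e by (simp add: field_simps power2_eq_square)
  have s: "sin (of_real pi * z) = e / 2 * ((1 - 1 / e\<^sup>2) / \<i>)"
    unfolding sin_exp_eq exp_minus e_def[symmetric] using e by (simp add: field_simps power2_eq_square)
  have "cot (of_real pi * z) = (1 + 1 / e\<^sup>2) / ((1 - 1 / e\<^sup>2) / \<i>)"
    unfolding cot_def c s using e by (subst mult_divide_mult_cancel_left) auto
  then show ?thesis unfolding ee by (simp only: divide_divide_eq_right mult.commute)
qed

lemma Im_minus_inverse: "Im (- 1 / \<tau>) = Im \<tau> / (cmod \<tau>)\<^sup>2"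
  by (simp add: Im_divide cmod_def power2_eq_square)

lemma Im_minus_inverse_pos: "Im \<tau> > 0 \<Longrightarrow> Im (- 1 / \<tau>) > 0"
  unfolding Im_minus_inverse by (metis divide_pos_pos zero_less_norm_iff zero_less_power complex.sel(2) less_irrefl zero_complex.sel(2))

lemma cot_limit:
  assumes "Im \<tau> > 0"
  shows "(\<lambda>N. cot (of_real pi * (of_nat N / \<tau>))) \<longlonglongrightarrow> \<i>"
proof -
  define p where "p = ee (- 1 / \<tau>)"
  have "norm p < 1" unfolding p_def by (intro norm_ee_less_1 Im_minus_inverse_pos assms)
  then have "(\<lambda>N. p ^ N) \<longlonglongrightarrow> 0" by (rule LIMSEQ_power_zero)
  then have "(\<lambda>N. \<i> * (1 + p ^ N) / (1 - p ^ N)) \<longlonglongrightarrow> \<i> * (1 + 0) / (1 - 0)"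
    by (intro tendsto_mult tendsto_divide tendsto_add tendsto_diff tendsto_const) auto
  moreover have "ee (- (of_nat N / \<tau>)) = p ^ N" for N
    unfolding p_def by (simp flip: ee_of_nat_mult)
  ultimately show ?thesis unfolding cot_pi_eq_ee by simp
qed

text \<open>The double series of \<open>(m \<tau> + n) ^ (-2)\<close> converges only conditionally; subtracting a telescoping
  family makes it absolutely convergent, and the boundary terms of the telescoping sums produce
  the anomaly \<open>2 \<pi> \<i> / \<tau>\<close>.\<close>
lemma inverse_sin_squared_sum_transform:
  assumes \<tau>: "Im \<tau> > 0"
    and A: "(\<lambda>m. of_real pi ^ 2 / sin (of_real pi * (of_nat (Suc m) * \<tau>)) ^ 2) sums A"
    and B: "(\<lambda>m. of_real pi ^ 2 / sin (of_real pi * (of_nat (Suc m) * (- 1 / \<tau>))) ^ 2) sums B"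
  shows "2 * A = of_real pi ^ 2 / (3 * \<tau>\<^sup>2) + 2 * B / \<tau>\<^sup>2 - of_real pi ^ 2 / 3 + 2 * of_real pi * \<i> / \<tau>"
proof -
  define a where "a = (\<lambda>m n::int. 1 / (of_int m * \<tau> + of_int n)\<^sup>2)"
  \<comment> \<open>\<open>b\<close> telescopes in n, and \<open>a - b\<close> equals 1 / (z^2 (z +
    1)) with z = m \<tau> + n, which decays like |z|^(-3).\<close>
  define b where "b = (\<lambda>m n::int. 1 / (of_int m * \<tau> + of_int n) - 1 / (of_int m * \<tau> + of_int n + 1))"
  define u where "u = (\<lambda>m n. a m n - b m n)"
  define s where "s = (\<lambda>z. of_real pi ^ 2 / sin (of_real pi * z) ^ 2 :: complex)"
  have \<tau>0: "\<tau> \<noteq> 0" using \<tau> by auto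
  have nz: "of_int m * \<tau> + of_int n \<noteq> 0" if "m \<noteq> 0" for m n :: int
  proof
    assume "of_int m * \<tau> + of_int n = 0"
    then have "Im (of_int m * \<tau> + of_int n) = 0" by simp
    then show False using that \<tau> by simp
  qed
  have nz1: "of_int m * \<tau> + of_int n + 1 \<noteq> 0" if "m \<noteq> 0" for m n :: int
    using nz[OF that, of "n + 1"] by (simp add: add.assoc)
  have u_eq: "u m n = 1 / ((of_int m * \<tau> + of_int n)\<^sup>2 * (of_int m * \<tau> + of_int n + 1))" if "m \<noteq> 0" for m n
    using nz[OF that, of n] nz1[OF that, of n] unfolding u_def a_def b_def
    by (simp add: divide_simps power2_eq_square)
  have us: "(\<lambda>(m, n). u m n) summable_on (-{0}) \<times> UNIV"
  proof (rule abs_summable_summable, rule summable_on_comparison_test)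
    \<comment> \<open>For m \<noteq> 0 the imaginary part gives |z + 1| \<ge> Im \<tau>, hence |z|
      \<le> |z + 1| + 1 \<le> (1 + 1 / Im \<tau>) |z + 1|.\<close>
    show "(\<lambda>p. (1 + 1 / Im \<tau>) * (case p of (c, d) \<Rightarrow> cmod (of_int c * \<tau> + of_int d) powr (-3))) summable_on ((-{0}) \<times> UNIV)"
      by (intro summable_on_cmult_right summable_on_subset_banach[OF summable_on_linear_form_powr]) (use \<tau> in auto)
    fix p :: "int \<times> int" assume "p \<in> (-{0}) \<times> UNIV"
    then obtain m n where p: "p = (m, n)" "m \<noteq> 0" by auto
    define z where "z = of_int m * \<tau> + of_int n"
    have z: "z \<noteq> 0" "z + 1 \<noteq> 0" using nz nz1 p by (auto simp: z_def)
    have "1 * Im \<tau> \<le> \<bar>real_of_int m\<bar> * Im \<tau>" using p(2) \<tau> by (intro mult_right_mono) auto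
    also have "\<dots> = \<bar>Im (z + 1)\<bar>" using \<tau> by (simp add: z_def abs_mult)
    also have "\<dots> \<le> cmod (z + 1)" by (rule abs_Im_le_cmod)
    finally have "1 \<le> cmod (z + 1) / Im \<tau>" using \<tau> by (simp add: field_simps)
    moreover have "cmod z \<le> cmod (z + 1) + 1" using norm_triangle_ineq4[of "z + 1" 1] by simp
    ultimately have "cmod z \<le> (1 + 1 / Im \<tau>) * cmod (z + 1)" by (simp add: algebra_simps)
    then have "1 / cmod (z + 1) \<le> (1 + 1 / Im \<tau>) / cmod z"
      using z by (simp add: field_simps)
    then have "1 / cmod (z + 1) / (cmod z)\<^sup>2 \<le> (1 + 1 / Im \<tau>) / cmod z / (cmod z)\<^sup>2"
      by (intro divide_right_mono) auto
    then have "norm (u m n) \<le> (1 + 1 / Im \<tau>) * cmod z powr (-3)"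
      using z unfolding u_eq[OF p(2)] z_def[symmetric]
      by (simp add: norm_divide norm_mult norm_power powr_minus powr_numeral power2_eq_square power3_eq_cube divide_simps)
    then show "norm (case p of (m, n) \<Rightarrow> u m n) \<le> (1 + 1 / Im \<tau>) * (case p of (c, d) \<Rightarrow> cmod (of_int c * \<tau> + of_int d) powr (-3))"
      by (simp add: p z_def)
  qed auto
  then obtain S where S: "((\<lambda>(m, n). u m n) has_sum S) ((-{0}) \<times> UNIV)" by (auto simp: summable_on_def)
  have S': "((\<lambda>(n, m). u m n) has_sum S) (UNIV \<times> (-{0}))"
    using S by (subst (asm) has_sum_reindex_bij_witness[of _ prod.swap prod.swap "UNIV \<times> (-{0})" "\<lambda>(n, m). u m n" _ S S]) auto
  \<comment> \<open>Along n the telescoping part vanishes in the limit, so a row of \<open>u\<close>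
    has the same sum as the row of \<open>a\<close>.\<close>
  have row: "((\<lambda>n. u m n) has_sum s (of_int m * \<tau>)) UNIV" if m: "m \<noteq> 0" for m
  proof -
    have a: "((\<lambda>n. a m n) has_sum s (of_int m * \<tau>)) UNIV"
      unfolding a_def s_def using m \<tau> by (intro sin_squared_partial_fractions nonreal_not_Ints) auto
    have "(\<lambda>n. u m n) summable_on UNIV"
      by (rule summable_on_SigmaD1[OF us]) (use m in auto)
    then obtain U where U: "((\<lambda>n. u m n) has_sum U) UNIV" by (auto simp: summable_on_def)
    have "((\<lambda>n. a m n - u m n) has_sum (s (of_int m * \<tau>) - U)) UNIV"
      using has_sum_add[OF a, of "\<lambda>n. - u m n" "- U"] U by (simp add: has_sum_uminus)
    then have bs: "((\<lambda>n. b m n) has_sum (s (of_int m * \<tau>) - U)) UNIV" by (simp add: u_def)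
    define z where "z = of_int m * \<tau>"
    have l1: "(\<lambda>N. b m 0 + (\<Sum>n=1..N. b m (int n) + b m (- int n))) \<longlonglongrightarrow> s (of_int m * \<tau>) - U"
      by (rule has_sum_int_symmetric_limit_UNIV[OF bs])
    have e1: "b m 0 + (\<Sum>n=1..N. b m (int n) + b m (- int n)) = 1 / (z - of_nat N) - 1 / (z + of_nat (Suc N))" for N
    proof (induction N)
      case 0
      then show ?case by (simp add: b_def z_def)
    next
      case (Suc N)
      have b1: "b m (int (Suc N)) = 1 / (z + of_nat (Suc N)) - 1 / (z + of_nat (Suc (Suc N)))"
        by (simp add: b_def z_def add_ac)
      have b2: "b m (- int (Suc N)) = 1 / (z - of_nat (Suc N)) - 1 / (z - of_nat N)"
        by (simp add: b_def z_def algebra_simps)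
      have "b m 0 + (\<Sum>n=1..Suc N. b m (int n) + b m (- int n))
          = (b m 0 + (\<Sum>n=1..N. b m (int n) + b m (- int n))) + (b m (int (Suc N)) + b m (- int (Suc N)))"
        by (simp del: of_nat_Suc)
      then show ?case unfolding Suc.IH b1 b2 by simp
    qed
    have l2: "(\<lambda>N. 1 / (z - of_nat N) - 1 / (z + of_nat (Suc N))) \<longlonglongrightarrow> 0 - 0"
    proof (intro tendsto_diff)
      have l: "(\<lambda>N. 1 / (w + of_nat N)) \<longlonglongrightarrow> 0" for w :: complex
        by (intro tendsto_divide_0[OF tendsto_const] tendsto_add_filterlim_at_infinity[OF tendsto_const] tendsto_of_nat)
      have "(\<lambda>N. - (1 / (- z + of_nat N))) \<longlonglongrightarrow> - 0" by (intro tendsto_minus l)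
      moreover have "- (1 / (- z + of_nat N)) = 1 / (z - of_nat N)" for N
        by (metis add_uminus_conv_diff minus_add_distrib minus_divide_right minus_minus)
      ultimately show "(\<lambda>N. 1 / (z - of_nat N)) \<longlonglongrightarrow> 0" by simp
      show "(\<lambda>N. 1 / (z + of_nat (Suc N))) \<longlonglongrightarrow> 0"
        using l[of z] by (rule LIMSEQ_Suc)
    qed
    have "s (of_int m * \<tau>) - U = 0 - 0" by (rule LIMSEQ_unique[OF l1[unfolded e1] l2])
    then show ?thesis using U by simp
  qed
  have rows: "((\<lambda>m. s (of_int m * \<tau>)) has_sum S) (-{0})"
    by (rule has_sum_SigmaD[OF S]) (use row in auto)
  have s_minus: "s (- z) = s z" for z by (simp add: s_def)
  have S2A: "S = 2 * A"
  proof -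
    have l1: "(\<lambda>N. \<Sum>n=1..N. s (of_int (int n) * \<tau>) + s (of_int (- int n) * \<tau>)) \<longlonglongrightarrow> S"
      by (rule has_sum_int_symmetric_limit[OF rows])
    have e1: "(\<Sum>n=1..N. s (of_int (int n) * \<tau>) + s (of_int (- int n) * \<tau>)) = 2 * (\<Sum>n<N. s (of_nat (Suc n) * \<tau>))" for N
      by (simp add: s_minus sum_distrib_left sum.atLeast1_atMost_eq)
    have l2: "(\<lambda>N. 2 * (\<Sum>n<N. s (of_nat (Suc n) * \<tau>))) \<longlonglongrightarrow> 2 * A"
      using A unfolding sums_def s_def by (intro tendsto_mult tendsto_const)
    show ?thesis by (rule LIMSEQ_unique[OF l1[unfolded e1] l2])
  qed
  \<comment> \<open>In column n, \<open>\<alpha> n\<close> is the sum of \<open>a\<close> over m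
    \<noteq> 0 and \<open>C n\<close> is the symmetric sum of 1 / (m \<tau> + n) over m \<noteq> 0.
    Column 0 gives 2 zeta(2) / \<tau>^2 and, by oddness, 0.\<close>
  define \<alpha> where "\<alpha> = (\<lambda>n::int. if n = 0 then of_real pi ^ 2 / (3 * \<tau>\<^sup>2) else s (of_int n / \<tau>) / \<tau>\<^sup>2 - 1 / (of_int n)\<^sup>2)"
  define C where "C = (\<lambda>n::int. if n = 0 then 0 else of_real pi * cot (of_real pi * (of_int n / \<tau>)) / \<tau> - 1 / of_int n)"
  have ni: "of_int n / \<tau> \<notin> \<int>" if "n \<noteq> 0" for n :: int
    by (intro nonreal_not_Ints) (use that \<tau> in \<open>auto simp: Im_divide\<close>)
  have col_a: "((\<lambda>m. a m n) has_sum \<alpha> n) (-{0})" for n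
  proof (cases "n = 0")
    case False
    have "((\<lambda>m. 1 / \<tau>\<^sup>2 * (1 / (of_int n / \<tau> + of_int m)\<^sup>2)) has_sum (1 / \<tau>\<^sup>2 * s (of_int n / \<tau>))) UNIV"
      unfolding s_def by (intro has_sum_cmult_right sin_squared_partial_fractions ni False)
    moreover have "1 / \<tau>\<^sup>2 * (1 / (of_int n / \<tau> + of_int m)\<^sup>2) = a m n" for m :: int
    proof -
      have "\<tau> * (of_int n / \<tau> + of_int m) = of_int m * \<tau> + of_int n" using \<tau>0 by (simp add: algebra_simps)
      then show ?thesis unfolding a_def by (simp flip: power_mult_distrib)
    qed
    ultimately have "((\<lambda>m. a m n) has_sum (1 / \<tau>\<^sup>2 * s (of_int n / \<tau>))) UNIV" by simp
    then have "((\<lambda>m. a m n) has_sum (1 / \<tau>\<^sup>2 * s (of_int n / \<tau>) - a 0 n)) (UNIV - {0})"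
      by (rule has_sum_Diff) (auto intro: has_sum_finiteI)
    then show ?thesis using False by (simp add: \<alpha>_def a_def Compl_eq_Diff_UNIV)
  next
    case True
    have i: "((\<lambda>m::nat. 1 / (complex_of_nat (Suc m))\<^sup>2) has_sum (of_real pi ^ 2 / 6)) UNIV"
    proof (rule norm_summable_imp_has_sum)
      have "(\<lambda>n. complex_of_real (1 / (real n + 1)\<^sup>2)) sums of_real (pi\<^sup>2 / 6)"
        using inverse_squares_sums unfolding sums_of_real_iff by (simp add: add_ac)
      then show "(\<lambda>m::nat. 1 / (complex_of_nat (Suc m))\<^sup>2) sums (of_real pi ^ 2 / 6)" by (simp add: add_ac)
      have "norm (1 / (complex_of_nat (Suc m))\<^sup>2) = 1 / (real m + 1)\<^sup>2" for m
        unfolding norm_divide norm_power norm_of_nat by (simp add: add.commute)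
      then show "summable (\<lambda>m::nat. norm (1 / (complex_of_nat (Suc m))\<^sup>2))"
        using inverse_squares_sums by (simp add: sums_iff add_ac)
    qed
    have "((\<lambda>m. if m = 0 then 0 else 1 / (complex_of_int m)\<^sup>2) has_sum (of_real pi ^ 2 / 6 + of_real pi ^ 2 / 6)) UNIV"
    proof (rule has_sum_int_halves)
      have "((\<lambda>n. if int n = 0 then 0 else 1 / (complex_of_int (int n))\<^sup>2) has_sum (of_real pi ^ 2 / 6)) UNIV
            \<longleftrightarrow> ((\<lambda>n. 1 / (complex_of_nat n)\<^sup>2) has_sum (of_real pi ^ 2 / 6)) {1..}"
        by (intro has_sum_cong_neutral) auto
      also have "\<dots> \<longleftrightarrow> ((\<lambda>m. 1 / (complex_of_nat (Suc m))\<^sup>2) has_sum (of_real pi ^ 2 / 6)) UNIV"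
        by (rule has_sum_reindex_bij_witness[of _ Suc "\<lambda>n. n - 1"]) auto
      finally show "((\<lambda>n. if int n = 0 then 0 else 1 / (complex_of_int (int n))\<^sup>2) has_sum (of_real pi ^ 2 / 6)) UNIV"
        using i by blast
      have "(if - 1 - int n = 0 then 0 else 1 / (complex_of_int (- 1 - int n))\<^sup>2) = 1 / (complex_of_nat (Suc n))\<^sup>2" for n
        by (simp add: power2_eq_square algebra_simps)
      then show "((\<lambda>n. if - 1 - int n = 0 then 0 else 1 / (complex_of_int (- 1 - int n))\<^sup>2) has_sum (of_real pi ^ 2 / 6)) UNIV"
        using i by simp
    qed
    then have "((\<lambda>m. 1 / \<tau>\<^sup>2 * (if m = 0 then 0 else 1 / (complex_of_int m)\<^sup>2)) has_sum 1 / \<tau>\<^sup>2 * (of_real pi ^ 2 / 6 + of_real pi ^ 2 / 6)) UNIV"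
      by (rule has_sum_cmult_right)
    then have "((\<lambda>m. a m n) has_sum 1 / \<tau>\<^sup>2 * (of_real pi ^ 2 / 6 + of_real pi ^ 2 / 6)) (-{0})"
      by (subst (asm) has_sum_cong_neutral[of "-{0}" UNIV "\<lambda>m. a m n"])
         (auto simp: a_def True power_mult_distrib)
    moreover have "1 / \<tau>\<^sup>2 * (of_real pi ^ 2 / 6 + of_real pi ^ 2 / 6) = \<alpha> n"
      using True by (simp add: \<alpha>_def)
    ultimately show ?thesis by simp
  qed
  have C_lim: "(\<lambda>N. \<Sum>m=1..N. 1 / (of_nat m * \<tau> + of_int n) + 1 / (- of_nat m * \<tau> + of_int n)) \<longlonglongrightarrow> C n" for n
  proof (cases "n = 0")
    case False
    have "(\<lambda>N. (\<Sum>m=1..N. 1 / (of_int n / \<tau> + of_nat m) + 1 / (of_int n / \<tau> - of_nat m)) / \<tau>) \<longlonglongrightarrow>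
       (of_real pi * cot (of_real pi * (of_int n / \<tau>)) - 1 / (of_int n / \<tau>)) / \<tau>"
      by (intro tendsto_divide tendsto_const cot_partial_fractions ni False \<tau>0)
    moreover have "(of_real pi * cot (of_real pi * (of_int n / \<tau>)) - 1 / (of_int n / \<tau>)) / \<tau> = C n"
      using False \<tau>0 by (simp add: C_def field_simps)
    moreover have "(\<Sum>m=1..N. 1 / (of_int n / \<tau> + of_nat m) + 1 / (of_int n / \<tau> - of_nat m)) / \<tau>
        = (\<Sum>m=1..N. 1 / (of_nat m * \<tau> + of_int n) + 1 / (- of_nat m * \<tau> + of_int n))" for N
    proof -
      have "1 / (of_int n / \<tau> + w) / \<tau> = 1 / (w * \<tau> + of_int n)" for w
        using \<tau>0 by (simp add: distrib_right add.commute)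
      from this[of "of_nat m" for m] this[of "- of_nat m" for m] show ?thesis
        unfolding sum_divide_distrib by (simp add: add_divide_distrib)
    qed
    ultimately show ?thesis by simp
  qed (simp add: C_def)
  \<comment> \<open>In a column the two shifted sums of \<open>b\<close> need not cancel: they leave
    \<open>C n - C (n + 1)\<close>. This is where the order of summation shows.\<close>
  have col: "((\<lambda>m. u m n) has_sum (\<alpha> n - C n + C (n + 1))) (-{0})" for n
  proof -
    have "(\<lambda>m. u m n) summable_on (-{0})"
      by (rule summable_on_SigmaD1[OF has_sum_imp_summable[OF S']]) auto
    then obtain U where U: "((\<lambda>m. u m n) has_sum U) (-{0})" by (auto simp: summable_on_def)
    have "((\<lambda>m. a m n - u m n) has_sum (\<alpha> n - U)) (-{0})"
      using has_sum_add[OF col_a, of "\<lambda>m. - u m n" "- U"] U by (simp add: has_sum_uminus)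
    then have bs: "((\<lambda>m. b m n) has_sum (\<alpha> n - U)) (-{0})" by (simp add: u_def)
    have "(\<lambda>N. \<Sum>m=1..N. b (int m) n + b (- int m) n) \<longlonglongrightarrow> \<alpha> n - U"
      by (rule has_sum_int_symmetric_limit[OF bs])
    moreover have "(\<lambda>N. \<Sum>m=1..N. b (int m) n + b (- int m) n) \<longlonglongrightarrow> C n - C (n + 1)"
    proof -
      have "(\<Sum>m=1..N. b (int m) n + b (- int m) n) =
         (\<Sum>m=1..N. 1 / (of_nat m * \<tau> + of_int n) + 1 / (- of_nat m * \<tau> + of_int n)) -
         (\<Sum>m=1..N. 1 / (of_nat m * \<tau> + of_int (n + 1)) + 1 / (- of_nat m * \<tau> + of_int (n + 1)))" for N
        unfolding sum_subtractf[symmetric] b_def by (simp add: algebra_simps)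
      then show ?thesis using tendsto_diff[OF C_lim[of n] C_lim[of "n + 1"]] by simp
    qed
    ultimately have "\<alpha> n - U = C n - C (n + 1)" using LIMSEQ_unique by blast
    then have "U = \<alpha> n - C n + C (n + 1)" by (simp add: algebra_simps)
    then show ?thesis using U by simp
  qed
  have cols: "((\<lambda>n. \<alpha> n - C n + C (n + 1)) has_sum S) UNIV"
    by (rule has_sum_SigmaD[OF S']) (use col in auto)
  define g where "g = (\<lambda>n. \<alpha> n - C n + C (n + 1))"
  have C_minus: "C (- n) = - C n" for n by (simp add: C_def)
  have \<alpha>_minus: "\<alpha> (- n) = \<alpha> n" for n by (simp add: \<alpha>_def s_minus)
  have l1: "(\<lambda>N. g 0 + (\<Sum>n=1..N. g (int n) + g (- int n))) \<longlonglongrightarrow> S"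
    using cols unfolding g_def[symmetric] by (rule has_sum_int_symmetric_limit_UNIV)
  \<comment> \<open>Adding the columns symmetrically telescopes the \<open>C\<close> terms down to
    \<open>C N + C (N + 1)\<close>. Each of the two tends to pi i / \<tau>, and together they are
    the anomaly.\<close>
  have e1: "g 0 + (\<Sum>n=1..N. g (int n) + g (- int n)) = \<alpha> 0 + 2 * (\<Sum>n<N. \<alpha> (int (Suc n))) + C (int N) + C (int (Suc N))" for N
  proof (induction N)
    case 0
    have "C 0 = 0" by (simp add: C_def)
    then show ?case by (simp add: g_def)
  next
    case (Suc N)
    have g1: "g (- int (Suc N)) = \<alpha> (int (Suc N)) + C (int (Suc N)) - C (int N)"
      using C_minus[of "int N"] C_minus[of "int (Suc N)"] \<alpha>_minus[of "int (Suc N)"] unfolding g_def by simp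
    have g2: "g (int (Suc N)) = \<alpha> (int (Suc N)) - C (int (Suc N)) + C (int (Suc (Suc N)))"
      by (simp add: g_def add_ac)
    have "g 0 + (\<Sum>n=1..Suc N. g (int n) + g (- int n))
        = (g 0 + (\<Sum>n=1..N. g (int n) + g (- int n))) + (g (int (Suc N)) + g (- int (Suc N)))"
      by (simp del: of_nat_Suc)
    then show ?case unfolding Suc.IH g1 g2 by (simp add: algebra_simps del: of_nat_Suc)
  qed
  have l2: "(\<lambda>N. \<alpha> 0 + 2 * (\<Sum>n<N. \<alpha> (int (Suc n))) + C (int N) + C (int (Suc N))) \<longlonglongrightarrow>
     of_real pi ^ 2 / (3 * \<tau>\<^sup>2) + 2 * (B / \<tau>\<^sup>2 - of_real pi ^ 2 / 6) + of_real pi * \<i> / \<tau> + of_real pi * \<i> / \<tau>"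
  proof -
    have "(\<lambda>N. of_real pi * cot (of_real pi * (of_nat N / \<tau>)) / \<tau> - 1 / of_nat N) \<longlonglongrightarrow> of_real pi * \<i> / \<tau> - 0"
      by (intro tendsto_intros cot_limit \<tau> \<tau>0 lim_1_over_n)
    then have "(\<lambda>N. C (int (Suc N))) \<longlonglongrightarrow> of_real pi * \<i> / \<tau>"
      by (drule_tac LIMSEQ_Suc) (simp add: C_def)
    moreover from this have "(\<lambda>N. C (int N)) \<longlonglongrightarrow> of_real pi * \<i> / \<tau>"
      by (rule LIMSEQ_imp_Suc)
    moreover have "(\<lambda>n. \<alpha> (int (Suc n))) sums (B / \<tau>\<^sup>2 - of_real pi ^ 2 / 6)"
    proof -
      have "(\<lambda>n. s (of_nat (Suc n) / \<tau>)) sums B"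
        using B s_minus unfolding s_def by simp
      then have "(\<lambda>n. s (of_nat (Suc n) / \<tau>) / \<tau>\<^sup>2) sums (B / \<tau>\<^sup>2)" by (rule sums_divide)
      moreover have "(\<lambda>n. complex_of_real (1 / (real n + 1)\<^sup>2)) sums of_real (pi\<^sup>2 / 6)"
        using inverse_squares_sums unfolding sums_of_real_iff by (simp add: add_ac)
      ultimately have "(\<lambda>n. s (of_nat (Suc n) / \<tau>) / \<tau>\<^sup>2 - complex_of_real (1 / (real n + 1)\<^sup>2)) sums (B / \<tau>\<^sup>2 - of_real (pi\<^sup>2 / 6))"
        by (rule sums_diff)
      then show ?thesis by (simp add: \<alpha>_def add_ac)
    qed
    ultimately show ?thesis unfolding sums_def
      by (intro tendsto_add tendsto_mult tendsto_const) (auto simp: \<alpha>_def)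
  qed
  have "S = of_real pi ^ 2 / (3 * \<tau>\<^sup>2) + 2 * (B / \<tau>\<^sup>2 - of_real pi ^ 2 / 6) + of_real pi * \<i> / \<tau> + of_real pi * \<i> / \<tau>"
    by (rule LIMSEQ_unique[OF l1[unfolded e1] l2])
  then show ?thesis unfolding S2A by (simp add: algebra_simps)
qed

text \<open>The anomaly accounts exactly for the derivative of
  \<open>Ln (- \<i> * \<tau>) / 2\<close>, so the two sides differ by a constant. It vanishes at the
  fixed point \<i>, where the logarithm is \<open>Ln 1\<close>.\<close>

theorem Leta_minus_inverse:
  assumes "Im \<tau> > 0"
  shows "Leta (- 1 / \<tau>) = Leta \<tau> + Ln (- \<i> * \<tau>) / 2"
proof -
  define h where "h = (\<lambda>\<tau>. Leta (- 1 / \<tau>) - Leta \<tau> - Ln (- \<i> * \<tau>) / 2)"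
  have "(h has_field_derivative 0) (at z within upper)" if "z \<in> upper" for z
  proof -
    have z: "Im z > 0" "z \<noteq> 0" using that by auto
    obtain A where A: "(\<lambda>m. of_real pi ^ 2 / sin (of_real pi * (of_nat (Suc m) * z)) ^ 2) sums A"
       "(Leta has_field_derivative (\<i> / (2 * of_real pi) * (of_real pi ^ 2 / 6 + A))) (at z)"
      using Leta_deriv[OF z(1)] by blast
    obtain B where B: "(\<lambda>m. of_real pi ^ 2 / sin (of_real pi * (of_nat (Suc m) * (- 1 / z))) ^ 2) sums B"
       "(Leta has_field_derivative (\<i> / (2 * of_real pi) * (of_real pi ^ 2 / 6 + B))) (at (- 1 / z))"
      using Leta_deriv[OF Im_minus_inverse_pos[OF z(1)]] by blast
    have "((\<lambda>z. - 1 / z) has_field_derivative 1 / z\<^sup>2) (at z)"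
      using z by (auto intro!: derivative_eq_intros simp: power2_eq_square)
    from DERIV_chain2[OF B(2) this]
    have d1: "((\<lambda>z. Leta (- 1 / z)) has_field_derivative (\<i> / (2 * of_real pi) * (of_real pi ^ 2 / 6 + B) * (1 / z\<^sup>2))) (at z)" .
    have "- \<i> * z \<notin> \<real>\<^sub>\<le>\<^sub>0" using z by (auto simp: complex_nonpos_Reals_iff)
    then have d2: "((\<lambda>z. Ln (- \<i> * z) / 2) has_field_derivative (1 / (2 * z))) (at z)"
      using z by (auto intro!: derivative_eq_intros simp: field_simps)
    have eq: "\<i> / (2 * of_real pi) * (of_real pi ^ 2 / 6 + B) * (1 / z\<^sup>2) - \<i> / (2 * of_real pi) * (of_real pi ^ 2 / 6 + A) - 1 / (2 * z) = 0"
    proof -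
      have A_eq: "A = of_real pi ^ 2 / (6 * z\<^sup>2) + B / z\<^sup>2 - of_real pi ^ 2 / 6 + of_real pi * \<i> / z"
        using inverse_sin_squared_sum_transform[OF z(1) A(1) B(1)] by (simp add: field_simps)
      show ?thesis unfolding A_eq using z by (simp add: field_simps power2_eq_square)
    qed
    have "(h has_field_derivative 0) (at z)"
      using DERIV_diff[OF DERIV_diff[OF d1 A(2)] d2] unfolding h_def eq .
    then show ?thesis by (rule has_field_derivative_at_within)
  qed
  then have "\<exists>c. \<forall>z\<in>upper. h z = c"
    by (intro has_field_derivative_zero_constant convex_upper)
  then obtain c where c: "\<And>z. Im z > 0 \<Longrightarrow> h z = c" by auto
  have "h \<i> = 0" by (simp add: h_def)
  then have "h \<tau> = 0" using c[of \<i>] c[OF assms] by simp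
  then show ?thesis by (simp only: h_def) (simp only: diff_diff_eq eq_iff_diff_eq_0[symmetric])
qed

section \<open>Dedekind sums\<close>

lemma sawtooth_add_int: "sawtooth (x + of_int n) = sawtooth x"
proof -
  have "x + of_int n \<in> \<int> \<longleftrightarrow> x \<in> \<int>"
    by (metis Ints_add Ints_diff Ints_of_int add_diff_cancel_right')
  then show ?thesis by (simp add: sawtooth_def)
qed

lemma sawtooth_minus: "sawtooth (- x) = - sawtooth x"
proof (cases "x \<in> \<int>")
  case True
  then show ?thesis by (simp add: sawtooth_def)
next
  case False
  then have "x \<noteq> of_int \<lfloor>x\<rfloor>" by (metis Ints_of_int)
  then have "\<lfloor>- x\<rfloor> = - \<lfloor>x\<rfloor> - 1"
    using ceiling_altdef[of x] by (simp add: ceiling_def)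
  then show ?thesis using False by (simp add: sawtooth_def)
qed

lemma dedekind_sum_minus: "dedekind_sum (- h) c = - dedekind_sum h c"
proof -
  have "sawtooth (of_int (- h * r) / of_int c) = - sawtooth (of_int (h * r) / of_int c)" for r
    by (simp flip: sawtooth_minus)
  then show ?thesis unfolding dedekind_sum_def sum_negf[symmetric] by simp
qed

lemma dedekind_sum_add_mult:
  assumes "c > 0"
  shows "dedekind_sum (h + n * c) c = dedekind_sum h c"
proof -
  have "real_of_int ((h + n * c) * r) / real_of_int c = real_of_int (h * r) / real_of_int c + real_of_int (n * r)" for r
    using assms by (simp add: field_simps)
  then show ?thesis unfolding dedekind_sum_def by (simp only: sawtooth_add_int)
qed

lemma sum_int_upto:
  assumes "k \<ge> 1"
  shows "(\<Sum>r\<in>{1..<k::int}. real_of_int r) = of_int k * (of_int k - 1) / 2"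
    and "(\<Sum>r\<in>{1..<k::int}. (real_of_int r)\<^sup>2) = (of_int k - 1) * of_int k * (2 * of_int k - 1) / 6"
proof -
  have ins: "{1..<i + 1} = insert i {1..<i}" if "1 \<le> i" for i :: int using that by auto
  show "(\<Sum>r\<in>{1..<k::int}. real_of_int r) = of_int k * (of_int k - 1) / 2"
    using assms by (induction k rule: int_ge_induct) (simp_all add: ins field_simps)
  show "(\<Sum>r\<in>{1..<k::int}. (real_of_int r)\<^sup>2) = (of_int k - 1) * of_int k * (2 * of_int k - 1) / 6"
    using assms by (induction k rule: int_ge_induct) (simp_all add: ins field_simps power2_eq_square)
qed

lemma mult_mod_bij:
  assumes "k > 0" "coprime h (k::int)"
  shows "bij_betw (\<lambda>r. (h * r) mod k) {1..<k} {1..<k}"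
proof -
  have inj: "inj_on (\<lambda>r. (h * r) mod k) {1..<k}"
  proof (rule inj_onI)
    fix r s assume r: "r \<in> {1..<k}" and s: "s \<in> {1..<k}" and e: "(h * r) mod k = (h * s) mod k"
    then have "k dvd h * r - h * s" by (simp add: mod_eq_dvd_iff)
    then have "k dvd h * (r - s)" by (simp add: algebra_simps)
    then have "k dvd (r - s)" using assms(2) by (simp add: coprime_dvd_mult_right_iff coprime_commute)
    then show "r = s" using r s dvd_imp_le_int[of "r - s" k] by force
  qed
  have "(h * r) mod k \<in> {1..<k}" if "r \<in> {1..<k}" for r
  proof -
    have "\<not> k dvd r" using that zdvd_not_zless by auto
    then have "\<not> k dvd h * r" using assms(2) by (simp add: coprime_dvd_mult_right_iff coprime_commute)
    then have "(h * r) mod k \<noteq> 0" by (simp add: dvd_eq_mod_eq_0)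
    moreover have "(h * r) mod k \<ge> 0" "(h * r) mod k < k" using assms(1) by auto
    ultimately show ?thesis by auto
  qed
  then have "(\<lambda>r. (h * r) mod k) ` {1..<k} \<subseteq> {1..<k}" by blast
  then show ?thesis using inj by (simp add: bij_betw_def endo_inj_surj)
qed

text \<open>After clearing denominators, multiplication by h permutes the nonzero residues, so the
  linear terms are independent of h and only the mixed sum remembers it.\<close>

lemma dedekind_sum_eq:
  assumes "k > 0" "coprime h k"
  shows "(of_int k)\<^sup>2 * dedekind_sum h k =
      (\<Sum>r\<in>{1..<k}. real_of_int r * of_int ((h * r) mod k)) - (of_int k)\<^sup>2 * (of_int k - 1) / 4"
proof -
  have saw: "sawtooth (of_int r / of_int k) = of_int (r mod k) / of_int k - 1 / 2" if "\<not> k dvd r" for r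
  proof -
    have "real_of_int r / of_int k \<notin> \<int>"
    proof
      assume "real_of_int r / of_int k \<in> \<int>"
      then obtain z where "real_of_int r / of_int k = of_int z" by (auto elim: Ints_cases)
      then have "real_of_int r = of_int (z * k)" using assms(1) by (simp add: field_simps)
      then have "r = z * k" by linarith
      then show False using that by simp
    qed
    moreover have "\<lfloor>real_of_int r / of_int k\<rfloor> = r div k" by (rule floor_divide_of_int_eq)
    moreover have "real_of_int r = of_int (r div k) * of_int k + of_int (r mod k)"
      by (metis div_mult_mod_eq of_int_add of_int_mult)
    ultimately show ?thesis using assms(1) by (simp add: sawtooth_def field_simps)
  qed
  let ?y = "\<lambda>r. real_of_int ((h * r) mod k)"
  have "dedekind_sum h k = (\<Sum>r\<in>{1..<k}. sawtooth (of_int r / of_int k) * sawtooth (of_int (h * r) / of_int k))"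
    unfolding dedekind_sum_def
  proof (rule sum.mono_neutral_right)
    have "{0..<k} - {1..<k} \<subseteq> {0}" by auto
    then show "\<forall>i\<in>{0..<k} - {1..<k}. sawtooth (of_int i / of_int k) * sawtooth (of_int (h * i) / of_int k) = 0"
      by (auto simp: sawtooth_def)
  qed auto
  also have "\<dots> = (\<Sum>r\<in>{1..<k}. (real_of_int r / of_int k - 1 / 2) * (?y r / of_int k - 1 / 2))"
  proof (rule sum.cong[OF refl])
    fix r assume r: "r \<in> {1..<k}"
    then have 1: "\<not> k dvd r" using zdvd_not_zless by auto
    then have 2: "\<not> k dvd h * r" using assms(2) by (simp add: coprime_dvd_mult_right_iff coprime_commute)
    show "sawtooth (of_int r / of_int k) * sawtooth (of_int (h * r) / of_int k) = (real_of_int r / of_int k - 1 / 2) * (?y r / of_int k - 1 / 2)"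
      unfolding saw[OF 1] saw[OF 2] using r by simp
  qed
  finally have "(of_int k)\<^sup>2 * dedekind_sum h k = (\<Sum>r\<in>{1..<k}. (of_int k)\<^sup>2 * ((real_of_int r / of_int k - 1 / 2) * (?y r / of_int k - 1 / 2)))"
    by (simp add: sum_distrib_left)
  also have "\<dots> = (\<Sum>r\<in>{1..<k}. real_of_int r * ?y r - of_int k / 2 * real_of_int r - of_int k / 2 * ?y r + (of_int k)\<^sup>2 / 4)"
    using assms(1) by (intro sum.cong) (auto simp: field_simps power2_eq_square)
  also have "\<dots> = (\<Sum>r\<in>{1..<k}. real_of_int r * ?y r) - of_int k / 2 * (\<Sum>r\<in>{1..<k}. real_of_int r)
       - of_int k / 2 * (\<Sum>r\<in>{1..<k}. ?y r) + (of_int k - 1) * ((of_int k)\<^sup>2 / 4)"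
    using assms(1) by (simp add: sum.distrib sum_subtractf sum_distrib_left)
  also have "(\<Sum>r\<in>{1..<k}. ?y r) = (\<Sum>r\<in>{1..<k}. real_of_int r)"
    using sum.reindex_bij_betw[OF mult_mod_bij[OF assms], of real_of_int] by simp
  finally show ?thesis using assms(1) by (simp add: sum_int_upto field_simps power2_eq_square)
qed

lemma int_le_div_iff:
  assumes "(k::int) > 0"
  shows "j \<le> n div k \<longleftrightarrow> j * k \<le> n"
proof
  have n: "n = (n div k) * k + n mod k" "0 \<le> n mod k" "n mod k < k" using assms by auto
  show "j * k \<le> n" if "j \<le> n div k"
    using mult_right_mono[OF that, of k] assms n by linarith
  show "j \<le> n div k" if "j * k \<le> n"
  proof (rule ccontr)
    assume "\<not> j \<le> n div k"
    then have "n div k + 1 \<le> j" by simp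
    from mult_right_mono[OF this, of k] show False using assms n that by (simp add: distrib_right)
  qed
qed

lemma int_div_less_iff: "(k::int) > 0 \<Longrightarrow> n div k < j \<longleftrightarrow> n < j * k"
  using int_le_div_iff[of k j n] by linarith

text \<open>Write F (F + 1) as twice the sum of all positive j \<le> F and exchange the summations:
  both sides count the lattice points below the line of slope h / k, weighted by their
  height.\<close>

lemma floor_sum_reciprocity:
  assumes "h > 0" "k > 0" "coprime h (k::int)"
  shows "(\<Sum>r\<in>{1..<k}. real_of_int ((h * r) div k) * (of_int ((h * r) div k) + 1))
       = 2 * (\<Sum>j\<in>{1..<h}. real_of_int j * (of_int k - 1 - of_int ((k * j) div h)))"
proof -
  have tri: "real_of_int n * (of_int n + 1) = 2 * (\<Sum>j\<in>{1..<h}. if j \<le> n then real_of_int j else 0)" if "0 \<le> n" "n < h" for n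
  proof -
    have "(\<Sum>j\<in>{1..<h}. if j \<le> n then real_of_int j else 0) = (\<Sum>j\<in>{1..<n+1}. real_of_int j)"
      using that by (intro sum.mono_neutral_cong_right) auto
    also have "\<dots> = real_of_int (n + 1) * (of_int (n + 1) - 1) / 2"
      using that by (intro sum_int_upto) auto
    finally show ?thesis by (simp add: mult.commute)
  qed
  have cnt: "(\<Sum>r\<in>{1..<k}. if j \<le> (h * r) div k then real_of_int j else 0) = real_of_int j * (of_int k - 1 - of_int ((k * j) div h))"
    if j: "j \<in> {1..<h}" for j
  proof -
    have G: "0 \<le> (k * j) div h" "(k * j) div h < k"
      using j assms by (simp_all add: pos_imp_zdiv_nonneg_iff int_div_less_iff)
    \<comment> \<open>Equality j k = h r would force k to divide r, so the inequality becomes strict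
      when it is read in the other variable.\<close>
    have iff: "j \<le> (h * r) div k \<longleftrightarrow> (k * j) div h < r" if "r \<in> {1..<k}" for r
    proof -
      have "\<not> k dvd r" using that zdvd_not_zless by auto
      then have "\<not> k dvd h * r" using assms(3) by (simp add: coprime_dvd_mult_right_iff coprime_commute)
      then have ne: "k * j \<noteq> h * r" by (metis dvd_triv_left)
      have "j \<le> (h * r) div k \<longleftrightarrow> j * k \<le> h * r" using assms by (simp add: int_le_div_iff)
      also have "\<dots> \<longleftrightarrow> k * j < r * h" using ne by (auto simp: mult.commute)
      also have "\<dots> \<longleftrightarrow> (k * j) div h < r" using assms by (simp add: int_div_less_iff)
      finally show ?thesis .
    qed
    have "(\<Sum>r\<in>{1..<k}. if j \<le> (h * r) div k then real_of_int j else 0) = (\<Sum>r\<in>{(k * j) div h + 1..<k}. real_of_int j)"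
      using G iff by (intro sum.mono_neutral_cong_right) auto
    also have "\<dots> = real_of_int j * (of_int k - 1 - of_int ((k * j) div h))"
      using G by simp
    finally show ?thesis .
  qed
  have "(\<Sum>r\<in>{1..<k}. real_of_int ((h * r) div k) * (of_int ((h * r) div k) + 1))
      = (\<Sum>r\<in>{1..<k}. 2 * (\<Sum>j\<in>{1..<h}. if j \<le> (h * r) div k then real_of_int j else 0))"
  proof (intro sum.cong refl tri)
    fix r assume r: "r \<in> {1..<k}"
    show "0 \<le> (h * r) div k" using r assms by (simp add: pos_imp_zdiv_nonneg_iff)
    have "h * r < h * k" using r assms by simp
    then show "(h * r) div k < h" using assms by (simp add: int_div_less_iff)
  qed
  also have "\<dots> = 2 * (\<Sum>j\<in>{1..<h}. \<Sum>r\<in>{1..<k}. if j \<le> (h * r) div k then real_of_int j else 0)"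
    unfolding sum_distrib_left[symmetric] by (subst sum.swap) simp
  also have "\<dots> = 2 * (\<Sum>j\<in>{1..<h}. real_of_int j * (of_int k - 1 - of_int ((k * j) div h)))"
    using cnt by simp
  finally show ?thesis .
qed

text \<open>\<open>dedekind_sum_eq\<close> reduces both sums to \<open>W\<close> and its mirror
  image \<open>W'\<close>. Comparing the squares of the residues r and h r mod k expresses
  \<open>W\<close> through \<open>V\<close> (\<open>e3\<close>), comparing the residues themselves
  gives \<open>U\<close> (\<open>e4\<close>), and the lattice point count ties \<open>V + U\<close>
  to \<open>W'\<close> (\<open>e5\<close>). Eliminating these four sums leaves the law.\<close>

theorem dedekind_sum_reciprocity:
  assumes h: "h > 0" and k: "k > 0" and co: "coprime h k"
  shows "dedekind_sum h k + dedekind_sum k h =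
     - 1 / 4 + (of_int h / of_int k + of_int k / of_int h + 1 / (of_int h * of_int k)) / 12"
proof -
  define H K where "H = real_of_int h" and "K = real_of_int k"
  have HK: "H > 0" "K > 0" using h k by (auto simp: H_def K_def)
  define F where "F = (\<lambda>r. real_of_int ((h * r) div k))"
  define G where "G = (\<lambda>j. real_of_int ((k * j) div h))"
  define W where "W = (\<Sum>r\<in>{1..<k}. real_of_int r * F r)"
  define W' where "W' = (\<Sum>j\<in>{1..<h}. real_of_int j * G j)"
  define V where "V = (\<Sum>r\<in>{1..<k}. F r * F r)"
  define U where "U = (\<Sum>r\<in>{1..<k}. F r)"
  have y: "real_of_int ((h * r) mod k) = H * of_int r - K * F r" for r
    unfolding H_def K_def F_def by (simp add: minus_div_mult_eq_mod[symmetric] mult.commute)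
  have y': "real_of_int ((k * r) mod h) = K * of_int r - H * G r" for r
    unfolding H_def K_def G_def by (simp add: minus_div_mult_eq_mod[symmetric] mult.commute)
  have s1: "(\<Sum>r\<in>{1..<k}. real_of_int r) = K * (K - 1) / 2" and s1': "(\<Sum>r\<in>{1..<h}. real_of_int r) = H * (H - 1) / 2"
    using sum_int_upto(1)[of k] sum_int_upto(1)[of h] h k by (simp_all add: H_def K_def)
  have s2: "(\<Sum>r\<in>{1..<k}. (real_of_int r)\<^sup>2) = (K - 1) * K * (2 * K - 1) / 6"
    and s2': "(\<Sum>r\<in>{1..<h}. (real_of_int r)\<^sup>2) = (H - 1) * H * (2 * H - 1) / 6"
    using sum_int_upto(2)[of k] sum_int_upto(2)[of h] h k by (simp_all add: H_def K_def)
  have co': "coprime k h" using co by (simp add: coprime_commute)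
  have e1: "K\<^sup>2 * dedekind_sum h k = H * ((K - 1) * K * (2 * K - 1) / 6) - K * W - K\<^sup>2 * (K - 1) / 4"
  proof -
    have "(\<Sum>r\<in>{1..<k}. real_of_int r * of_int ((h * r) mod k)) = H * (\<Sum>r\<in>{1..<k}. (real_of_int r)\<^sup>2) - K * W"
      unfolding y W_def sum_distrib_left sum_subtractf[symmetric]
      by (intro sum.cong) (auto simp: algebra_simps power2_eq_square)
    then show ?thesis using dedekind_sum_eq[OF k co] unfolding s2 by (simp add: K_def)
  qed
  have e2: "H\<^sup>2 * dedekind_sum k h = K * ((H - 1) * H * (2 * H - 1) / 6) - H * W' - H\<^sup>2 * (H - 1) / 4"
  proof -
    have "(\<Sum>r\<in>{1..<h}. real_of_int r * of_int ((k * r) mod h)) = K * (\<Sum>r\<in>{1..<h}. (real_of_int r)\<^sup>2) - H * W'"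
      unfolding y' W'_def sum_distrib_left sum_subtractf[symmetric]
      by (intro sum.cong) (auto simp: algebra_simps power2_eq_square)
    then show ?thesis using dedekind_sum_eq[OF h co'] unfolding s2' by (simp add: H_def)
  qed
  have e3: "(K - 1) * K * (2 * K - 1) / 6 = H\<^sup>2 * ((K - 1) * K * (2 * K - 1) / 6) - 2 * H * K * W + K\<^sup>2 * V"
  proof -
    have "(\<Sum>r\<in>{1..<k}. (real_of_int r)\<^sup>2) = (\<Sum>r\<in>{1..<k}. (real_of_int ((h * r) mod k))\<^sup>2)"
      using sum.reindex_bij_betw[OF mult_mod_bij[OF k co], of "\<lambda>r. (real_of_int r)\<^sup>2"] by simp
    also have "\<dots> = (\<Sum>r\<in>{1..<k}. H\<^sup>2 * (real_of_int r)\<^sup>2 - 2 * H * K * (real_of_int r * F r) + K\<^sup>2 * (F r * F r))"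
      unfolding y by (intro sum.cong) (auto simp: algebra_simps power2_eq_square)
    also have "\<dots> = H\<^sup>2 * (\<Sum>r\<in>{1..<k}. (real_of_int r)\<^sup>2) - 2 * H * K * W + K\<^sup>2 * V"
      by (simp add: sum.distrib sum_subtractf sum_distrib_left W_def V_def)
    finally show ?thesis unfolding s2 .
  qed
  have e4: "K * (K - 1) / 2 = H * (K * (K - 1) / 2) - K * U"
  proof -
    have "(\<Sum>r\<in>{1..<k}. real_of_int r) = (\<Sum>r\<in>{1..<k}. real_of_int ((h * r) mod k))"
      using sum.reindex_bij_betw[OF mult_mod_bij[OF k co], of "\<lambda>r. real_of_int r"] by simp
    also have "\<dots> = H * (\<Sum>r\<in>{1..<k}. real_of_int r) - K * U"
      unfolding y by (simp add: sum_subtractf sum_distrib_left U_def)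
    finally show ?thesis unfolding s1 .
  qed
  have e5: "V + U = 2 * ((K - 1) * (H * (H - 1) / 2) - W')"
  proof -
    have "V + U = (\<Sum>r\<in>{1..<k}. F r * (F r + 1))"
      by (simp add: V_def U_def algebra_simps sum.distrib)
    also have "\<dots> = 2 * (\<Sum>j\<in>{1..<h}. real_of_int j * (K - 1 - G j))"
      unfolding F_def K_def G_def by (rule floor_sum_reciprocity[OF h k co])
    also have "(\<Sum>j\<in>{1..<h}. real_of_int j * (K - 1 - G j)) = (K - 1) * (\<Sum>j\<in>{1..<h}. real_of_int j) - W'"
      unfolding W'_def sum_distrib_left sum_subtractf[symmetric] by (intro sum.cong) (auto simp: algebra_simps)
    finally show ?thesis unfolding s1' .
  qed
  have "K * (2 * U) = K * ((H - 1) * (K - 1))" using e4 by (simp add: field_simps)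
  then have U: "U = (H - 1) * (K - 1) / 2" using HK by simp
  define X Y where "X = dedekind_sum h k" and "Y = dedekind_sum k h"
  have "2 * H * (K\<^sup>2 * X) = 2 * H * (H * ((K - 1) * K * (2 * K - 1) / 6)) - 2 * H * K * W - 2 * H * (K\<^sup>2 * (K - 1) / 4)"
    unfolding e1[folded X_def] by (simp add: algebra_simps)
  also have "2 * H * K * W = H\<^sup>2 * ((K - 1) * K * (2 * K - 1) / 6) + K\<^sup>2 * V - (K - 1) * K * (2 * K - 1) / 6"
    using e3 by linarith
  also have "V = 2 * ((K - 1) * (H * (H - 1) / 2) - W') - (H - 1) * (K - 1) / 2"
    using e5 U by linarith
  finally have f1: "2 * H * (K\<^sup>2 * X) = 2 * H * (H * ((K - 1) * K * (2 * K - 1) / 6)) - (H\<^sup>2 * ((K - 1) * K * (2 * K - 1) / 6)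
     + K\<^sup>2 * (2 * ((K - 1) * (H * (H - 1) / 2) - W') - (H - 1) * (K - 1) / 2) - (K - 1) * K * (2 * K - 1) / 6) - 2 * H * (K\<^sup>2 * (K - 1) / 4)" .
  have W': "W' = K * ((H - 1) * (2 * H - 1) / 6) - H * Y - H * (H - 1) / 4"
  proof -
    have "H * W' = H * (K * ((H - 1) * (2 * H - 1) / 6) - H * Y - H * (H - 1) / 4)"
      using e2[folded Y_def] by (simp add: field_simps power2_eq_square)
    then show ?thesis using HK by simp
  qed
  have "12 * (H * K) * (X + Y) = - 3 * (H * K) + H\<^sup>2 + K\<^sup>2 + 1"
  proof -
    have "K * (12 * (H * K) * (X + Y)) = K * (- 3 * (H * K) + H\<^sup>2 + K\<^sup>2 + 1)"
      using f1 unfolding W' by (simp add: field_simps power2_eq_square)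
    then show ?thesis using HK by simp
  qed
  then have "X + Y = - 1 / 4 + (H / K + K / H + 1 / (H * K)) / 12"
    using HK by (simp add: field_simps power2_eq_square)
  then show ?thesis by (simp add: X_def Y_def H_def K_def)
qed

section \<open>The transformation law\<close>

lemma mob_Im:
  assumes "a * d - b * c = 1"
  shows "Im (mob (a, b, c, d) \<tau>) = Im \<tau> / (cmod (of_int c * \<tau> + of_int d))\<^sup>2"
proof -
  have "Im (mob (a, b, c, d) \<tau>) = (of_int a * of_int d - of_int b * of_int c) * Im \<tau> / (cmod (of_int c * \<tau> + of_int d))\<^sup>2"
    by (simp add: Im_divide' algebra_simps)
  also have "(real_of_int a * of_int d - of_int b * of_int c) = 1"
    using assms by (metis of_int_1 of_int_diff of_int_mult)
  finally show ?thesis by simp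
qed

lemma linear_form_nonzero:
  assumes "Im \<tau> > 0" "(c, d) \<noteq> (0, 0)"
  shows "of_int c * \<tau> + of_int d \<noteq> 0"
proof
  assume e: "of_int c * \<tau> + of_int d = 0"
  then have "Im (of_int c * \<tau> + of_int d) = 0" by simp
  then have "c = 0" using assms(1) by simp
  then show False using e assms(2) by simp
qed

lemma mob_Im_pos:
  assumes "a * d - b * c = 1" "Im \<tau> > 0"
  shows "Im (mob (a, b, c, d) \<tau>) > 0"
proof -
  have "of_int c * \<tau> + of_int d \<noteq> 0" using assms by (intro linear_form_nonzero) auto
  then show ?thesis using assms by (simp only: mob_Im) simp
qed

lemma mob_mmul:
  assumes "Im \<tau> > 0" "a' * d' - b' * c' = 1" "(c, d) \<noteq> (0, 0)"
  shows "mob (mmul (a, b, c, d) (a', b', c', d')) \<tau> = mob (a, b, c, d) (mob (a', b', c', d') \<tau>)"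
proof -
  define w where "w = of_int c' * \<tau> + of_int d'"
  define v where "v = of_int a' * \<tau> + of_int b'"
  have w: "w \<noteq> 0" unfolding w_def using assms by (intro linear_form_nonzero) auto
  have "mob (a, b, c, d) (mob (a', b', c', d') \<tau>) = (of_int a * (v / w) + of_int b) / (of_int c * (v / w) + of_int d)"
    by (simp add: v_def w_def)
  also have "of_int a * (v / w) + of_int b = (of_int a * v + of_int b * w) / w" using w by (simp add: field_simps)
  also have "of_int c * (v / w) + of_int d = (of_int c * v + of_int d * w) / w" using w by (simp add: field_simps)
  also have "(of_int a * v + of_int b * w) / w / ((of_int c * v + of_int d * w) / w) = (of_int a * v + of_int b * w) / (of_int c * v + of_int d * w)"
    using w by simp
  also have "\<dots> = mob (mmul (a, b, c, d) (a', b', c', d')) \<tau>"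
    by (simp add: v_def w_def algebra_simps)
  finally show ?thesis by simp
qed

lemma Leta_add_int: "Leta (\<tau> + of_int n) = Leta \<tau> + of_real pi * \<i> / 12 * of_int n"
  unfolding Leta_def eta_log_series_def ee_add_int by (simp add: algebra_simps add_divide_distrib)

lemma Ln_minus_ii_mult:
  assumes "Im \<tau> > 0"
  shows "Ln (- \<i> * \<tau>) = Ln \<tau> - \<i> * of_real pi / 2"
proof -
  have "0 < Im (Ln \<tau>)" "Im (Ln \<tau>) < pi" using Im_Ln_pos_lt_imp[OF assms] Im_Ln_pos_lt[of \<tau>] assms by auto
  then have "Ln (- \<i> * \<tau>) = Ln (- \<i>) + Ln \<tau>"
    using assms by (intro Ln_times_simple) auto
  then show ?thesis by simp
qed

text \<open>Quantified over all \<tau>, so that the law can be carried from one matrix to the next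
  by changing the argument.\<close>

definition eta_law :: "mat2 \<Rightarrow> bool" where
  "eta_law M \<longleftrightarrow> (case M of (a, b, c, d) \<Rightarrow> \<forall>\<tau>. Im \<tau> > 0 \<longrightarrow>
     Leta (mob (a, b, c, d) \<tau>) = Leta \<tau> + Ln (of_int c * \<tau> + of_int d) / 2 + of_real pi * \<i> / 12 * of_real (Psi (a, b, c, d)))"

lemma eta_lawD:
  "eta_law (a, b, c, d) \<Longrightarrow> Im \<tau> > 0 \<Longrightarrow>
   Leta (mob (a, b, c, d) \<tau>) = Leta \<tau> + Ln (of_int c * \<tau> + of_int d) / 2 + of_real pi * \<i> / 12 * of_real (Psi (a, b, c, d))"
  unfolding eta_law_def by (simp del: mob.simps Psi.simps)

text \<open>Right multiplication by T^n replaces \<tau> by \<tau> + n. The Dedekind sum is periodic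
  in d, so \<open>Psi\<close> grows by n, which matches the growth of \<open>Leta\<close>.\<close>

lemma eta_law_T:
  assumes law: "eta_law (a, b, c, d)" and c: "c > 0"
  shows "eta_law (a, b + n * a, c, d + n * c)"
proof -
  have "real_of_int (a + (d + n * c)) / of_int c = of_int (a + d) / of_int c + of_int n"
    using c by (simp add: field_simps)
  moreover have "dedekind_sum (- (d + n * c)) c = dedekind_sum (- d) c"
    using dedekind_sum_add_mult[OF c, of "- d" "- n"] by simp
  ultimately have Psi: "Psi (a, b + n * a, c, d + n * c) = Psi (a, b, c, d) + of_int n"
    using c by simp
  have "Leta (mob (a, b + n * a, c, d + n * c) \<tau>) = Leta \<tau> + Ln (of_int c * \<tau> + of_int (d + n * c)) / 2
     + of_real pi * \<i> / 12 * of_real (Psi (a, b + n * a, c, d + n * c))" if \<tau>: "Im \<tau> > 0" for \<tau>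
  proof -
    have "mob (a, b + n * a, c, d + n * c) \<tau> = mob (a, b, c, d) (\<tau> + of_int n)"
      by (simp add: algebra_simps)
    moreover have "of_int c * (\<tau> + of_int n) + of_int d = of_int c * \<tau> + of_int (d + n * c)"
      by (simp add: algebra_simps)
    ultimately show ?thesis
      using eta_lawD[OF law, of "\<tau> + of_int n"] \<tau> unfolding Psi Leta_add_int
      by (simp del: mob.simps Psi.simps add: algebra_simps)
  qed
  then show ?thesis unfolding eta_law_def by (simp del: mob.simps Psi.simps)
qed

text \<open>Right multiplication by the inversion. Reciprocity makes \<open>Psi\<close> drop by 3,
  and 3 * pi i / 12 is the term pi i / 4 contained in \<open>Ln (- \<i> * \<tau>) / 2\<close>.
  Positivity of c and d keeps the lower left entry positive before and after.\<close>

lemma eta_law_S: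
  assumes law: "eta_law (a, b, c, d)" and cd: "c > 0" "d > 0" and det: "a * d - b * c = 1"
  shows "eta_law (b, - a, d, - c)"
proof -
  have "coprime c d"
    by (rule coprimeI) (metis det dvd_diff dvd_mult dvd_mult2)
  then have rec: "dedekind_sum c d + dedekind_sum d c = - 1 / 4 + (of_int c / of_int d + of_int d / of_int c + 1 / (of_int c * of_int d)) / 12"
    using cd by (intro dedekind_sum_reciprocity) auto
  have Psi: "Psi (b, - a, d, - c) = Psi (a, b, c, d) - 3"
  proof -
    define A B C E where "A = real_of_int a" and "B = real_of_int b" and "C = real_of_int c" and "E = real_of_int d"
    have CE: "C > 0" "E > 0" using cd by (auto simp: C_def E_def)
    have "A * E - B * C = 1" unfolding A_def B_def C_def E_def using det by (metis of_int_1 of_int_diff of_int_mult)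
    then have "(B - C) / E - (A + E) / C = - 1 / (C * E) - C / E - E / C"
      using CE by (simp add: field_simps)
    moreover have "12 * (dedekind_sum c d + dedekind_sum d c) = - 3 + (C / E + E / C + 1 / (C * E))"
      unfolding rec by (simp add: C_def E_def mult.commute)
    moreover have "Psi (b, - a, d, - c) = (B - C) / E + 12 * dedekind_sum c d - 3"
      using cd by (simp add: B_def C_def E_def)
    moreover have "Psi (a, b, c, d) = (A + E) / C - 12 * dedekind_sum d c - 3"
      using cd by (simp add: dedekind_sum_minus A_def C_def E_def)
    ultimately show ?thesis by (simp del: Psi.simps)
  qed
  have "Leta (mob (b, - a, d, - c) \<tau>) = Leta \<tau> + Ln (of_int d * \<tau> + of_int (- c)) / 2
     + of_real pi * \<i> / 12 * of_real (Psi (b, - a, d, - c))" if \<tau>: "Im \<tau> > 0" for \<tau>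
  proof -
    define z where "z = - 1 / \<tau>"
    have z: "Im z > 0" unfolding z_def by (rule Im_minus_inverse_pos[OF \<tau>])
    have \<tau>0: "\<tau> \<noteq> 0" using \<tau> by auto
    have "mob (mmul (a, b, c, d) (0, - 1, 1, 0)) \<tau> = mob (a, b, c, d) (mob (0, - 1, 1, 0) \<tau>)"
      using \<tau> cd by (intro mob_mmul) auto
    then have m: "mob (b, - a, d, - c) \<tau> = mob (a, b, c, d) z" by (simp add: z_def)
    \<comment> \<open>All three arguments lie strictly between 0 and pi, so the logarithms add
      without a multiple of 2 pi i.\<close>
    have "Ln (\<tau> * (of_int c * z + of_int d)) = Ln \<tau> + Ln (of_int c * z + of_int d)"
    proof -
      have i1: "0 < Im (Ln \<tau>)" "Im (Ln \<tau>) < pi" using Im_Ln_pos_lt_imp[OF \<tau>] Im_Ln_pos_lt[of \<tau>] \<tau> by auto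
      have p: "Im (of_int c * z + of_int d) > 0" using z cd by simp
      then have i2: "0 < Im (Ln (of_int c * z + of_int d))" "Im (Ln (of_int c * z + of_int d)) < pi"
        using Im_Ln_pos_lt_imp[OF p] Im_Ln_pos_lt[of "of_int c * z + of_int d"] by auto
      have e: "\<tau> * (of_int c * z + of_int d) = of_int d * \<tau> - of_int c"
        using \<tau>0 by (simp add: z_def field_simps)
      have q: "Im (\<tau> * (of_int c * z + of_int d)) > 0" unfolding e using \<tau> cd by simp
      then have i3: "0 < Im (Ln (\<tau> * (of_int c * z + of_int d)))"
        using Im_Ln_pos_lt_imp[OF q] by auto
      have n0: "of_int c * z + of_int d \<noteq> 0" using p by (metis less_irrefl zero_complex.sel(2))
      show ?thesis using Ln_times[OF \<tau>0 n0] i1 i2 i3 by (auto split: if_splits)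
    qed
    moreover have "\<tau> * (of_int c * z + of_int d) = of_int d * \<tau> + of_int (- c)"
      using \<tau>0 by (simp add: z_def field_simps)
    ultimately have L: "Ln (of_int c * z + of_int d) = Ln (of_int d * \<tau> + of_int (- c)) - Ln \<tau>" by simp
    have Lz: "Leta z = Leta \<tau> + (Ln \<tau> - \<i> * of_real pi / 2) / 2"
      unfolding z_def Leta_minus_inverse[OF \<tau>] Ln_minus_ii_mult[OF \<tau>] ..
    show ?thesis
      unfolding m eta_lawD[OF law z] L Psi Lz by (simp add: field_simps del: Psi.simps)
  qed
  then show ?thesis unfolding eta_law_def by (simp del: mob.simps Psi.simps)
qed

text \<open>The Euclidean algorithm runs on the lower row: translations reduce d modulo c and the
  inversion swaps the entries. The base case c = 1 is a translate of the inversion formula.\<close>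

lemma eta_law_pos:
  assumes "a * d - b * c = 1" "c > 0"
  shows "eta_law (a, b, c, d)"
  using assms
proof (induction "nat c" arbitrary: a b c d rule: less_induct)
  case less
  show ?case
  proof (cases "c = 1")
    case True
    have "Leta (mob (a, b, c, d) \<tau>) = Leta \<tau> + Ln (of_int c * \<tau> + of_int d) / 2
       + of_real pi * \<i> / 12 * of_real (Psi (a, b, c, d))" if \<tau>: "Im \<tau> > 0" for \<tau>
    proof -
      define z where "z = \<tau> + of_int d"
      have z1: "Im z > 0" using \<tau> by (simp add: z_def)
      then have z2: "z \<noteq> 0" by auto
      have b: "b = a * d - 1" using less.prems True by simp
      have m: "mob (a, b, c, d) \<tau> = - 1 / z + of_int a"
        using z2 unfolding z_def True b by (simp add: field_simps)
      have L1: "Leta (- 1 / z + of_int a) = Leta z + (Ln z - \<i> * of_real pi / 2) / 2 + of_real pi * \<i> / 12 * of_int a"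
        unfolding Leta_add_int Leta_minus_inverse[OF z1] Ln_minus_ii_mult[OF z1] ..
      have L2: "Leta z = Leta \<tau> + of_real pi * \<i> / 12 * of_int d"
        unfolding z_def by (rule Leta_add_int)
      have P: "Psi (a, b, c, d) = of_int (a + d) - 3"
        using True by (simp add: dedekind_sum_def sawtooth_def)
      have zz: "of_int c * \<tau> + of_int d = z" by (simp add: True z_def)
      show ?thesis unfolding m L1 L2 P zz by (simp add: field_simps)
    qed
    then show ?thesis unfolding eta_law_def by (simp del: mob.simps Psi.simps)
  next
    case False
    then have c: "c > 1" using less.prems by simp
    \<comment> \<open>The quotient is rounded up so that \<open>d1\<close> lies strictly between -c
      and 0; then \<open>- d1\<close> is a smaller positive lower left entry, as the inversion step
      demands.\<close>
    define n where "n = d div c + 1"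
    define b1 where "b1 = b - n * a"
    define d1 where "d1 = d - n * c"
    have d1: "d1 = d mod c - c" unfolding d1_def n_def by (simp add: minus_div_mult_eq_mod[symmetric] algebra_simps)
    have "\<not> c dvd d"
    proof
      assume "c dvd d"
      then have "c dvd a * d - b * c" by simp
      then show False using less.prems c by simp
    qed
    then have "d mod c \<noteq> 0" by (simp add: dvd_eq_mod_eq_0)
    moreover have "d mod c \<ge> 0" "d mod c < c" using c by auto
    ultimately have d1b: "- d1 > 0" "- d1 < c" unfolding d1 by auto
    have det1: "a * d1 - b1 * c = 1" unfolding d1_def b1_def using less.prems by (simp add: algebra_simps)
    have "eta_law (- b1, a, - d1, c)"
      by (rule less.hyps) (use d1b c det1 in \<open>auto simp: algebra_simps\<close>)
    then have "eta_law (a, - (- b1), c, - (- d1))"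
      by (rule eta_law_S) (use d1b c det1 in \<open>auto simp: algebra_simps\<close>)
    then have "eta_law (a, b1 + n * a, c, d1 + n * c)"
      using c by (intro eta_law_T) auto
    then show ?thesis by (simp add: b1_def d1_def)
  qed
qed

text \<open>For c < 0 pass to the negated matrix, which acts identically. The logarithm gains pi i,
  half of which is 6 * pi i / 12: the gap between the constants -3 and 3 in \<open>Psi\<close>. For
  c = 0 and a = -1 the term -6 offsets \<open>Ln (- 1) / 2\<close> in the same way.\<close>

theorem Leta_mob:
  assumes det: "a * d - b * c = 1" and \<tau>: "Im \<tau> > 0"
  shows "Leta (mob (a, b, c, d) \<tau>) = Leta \<tau> + Ln (of_int c * \<tau> + of_int d) / 2
     + of_real pi * \<i> / 12 * of_real (Psi (a, b, c, d))"
proof (cases c "0::int" rule: linorder_cases)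
  case greater
  then show ?thesis using eta_lawD[OF eta_law_pos[OF det]] \<tau> by blast
next
  case less
  have "mob (- a, - b, - c, - d) \<tau> = - (of_int a * \<tau> + of_int b) / - (of_int c * \<tau> + of_int d)"
    by simp
  also have "\<dots> = mob (a, b, c, d) \<tau>" unfolding minus_divide_divide by simp
  finally have m: "mob (- a, - b, - c, - d) \<tau> = mob (a, b, c, d) \<tau>" .
  have "eta_law (- a, - b, - c, - d)" using det less by (intro eta_law_pos) auto
  moreover have n: "of_int (- c) * \<tau> + of_int (- d) = - (of_int c * \<tau> + of_int d)" by simp
  ultimately have "Leta (mob (a, b, c, d) \<tau>) = Leta \<tau> + Ln (- (of_int c * \<tau> + of_int d)) / 2 + of_real pi * \<i> / 12 * of_real (Psi (- a, - b, - c, - d))"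
    using eta_lawD[OF _ \<tau>, of "- a" "- b" "- c" "- d"] unfolding m n by blast
  moreover have "Ln (- (of_int c * \<tau> + of_int d)) = Ln (of_int c * \<tau> + of_int d) + \<i> * of_real pi"
  proof -
    have "of_int c * Im \<tau> < 0" using less \<tau> by (simp add: mult_neg_pos)
    moreover have "of_int c * \<tau> + of_int d \<noteq> 0" using less \<tau> by (intro linear_form_nonzero) auto
    ultimately show ?thesis by (subst Ln_minus) auto
  qed
  moreover have "Psi (- a, - b, - c, - d) = Psi (a, b, c, d) - 6"
  proof -
    have "real_of_int (- a + - d) / real_of_int (- c) = real_of_int (a + d) / real_of_int c"
      by (metis minus_add_distrib minus_divide_divide of_int_minus)
    then show ?thesis using less by (simp add: del: of_int_add)
  qed
  ultimately show ?thesis by (simp add: field_simps del: mob.simps Psi.simps)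
next
  case equal
  then have "a * d = 1" using det by simp
  then consider "a = 1" "d = 1" | "a = - 1" "d = - 1" by (auto simp: zmult_eq_1_iff)
  then show ?thesis
  proof cases
    case 1
    then show ?thesis using equal Leta_add_int[of \<tau> b] by simp
  next
    case 2
    have m: "mob (a, b, c, d) \<tau> = \<tau> + of_int (- b)" using 2 equal by simp
    have P: "Psi (a, b, c, d) = - of_int b - 6" using 2 equal by simp
    have L: "Ln (of_int c * \<tau> + of_int d) = \<i> * of_real pi" using 2 equal by simp
    show ?thesis unfolding m P L Leta_add_int by (simp add: field_simps)
  qed
qed

section \<open>Functions on the modular curve of level 4\<close>

text \<open>A function of period w descends to q = ee (z / w) on the punctured disc. The bound is
  asked for on |Re z| \<le> w only: the principal logarithm of q leads to a point z with |Re z|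
  \<le> w / 2.\<close>

lemma periodic_extends_to_disc:
  fixes H :: "complex \<Rightarrow> complex" and w x C :: real
  assumes hol: "H holomorphic_on upper" and w: "w > 0"
    and per: "\<And>z n. Im z > 0 \<Longrightarrow> H (z + of_real w * of_int n) = H z"
    and bound: "\<And>z. Im z \<ge> 1 \<Longrightarrow> \<bar>Re z\<bar> \<le> w \<Longrightarrow> norm (H z) \<le> C * exp (2 * pi * x * Im z / w)"
    and x: "x < 1"
  shows "\<exists>G. G holomorphic_on ball 0 1 \<and> (\<forall>z. Im z > 0 \<longrightarrow> H z = G (ee (z / of_real w)))"
proof -
  \<comment> \<open>Inverse of the local coordinate: \<open>u l\<close> is the point z with 2 pi i z
    / w = l.\<close>
  define u where "u = (\<lambda>l. of_real w * l / (2 * of_real pi * \<i>))"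
  have ImRe_u: "Im (u l) = - w * Re l / (2 * pi)" "Re (u l) = w * Im l / (2 * pi)" for l
    by (simp_all add: u_def Im_divide Re_divide power2_eq_square field_simps)
  define G0 where "G0 = (\<lambda>q. H (u (Ln q)))"
  have key: "H (u l) = H (u l')" if e: "exp l = exp l'" and re: "Re l < 0" for l l'
  proof -
    obtain n :: int where n: "l = l' + of_real (of_int (2 * n) * pi) * \<i>"
      using e unfolding exp_eq by blast
    have "Re l' = Re l" by (simp add: n)
    then have "Im (u l') > 0" using re w by (simp add: ImRe_u divide_neg_pos mult_pos_neg)
    moreover have "u l = u l' + of_real w * of_int n"
      unfolding u_def n by (simp add: field_simps)
    ultimately show ?thesis using per by simp
  qed
  have ReLn: "Re (Ln q) < 0" if "q \<in> ball 0 1 - {0}" for q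
    using that by simp
  have "G0 field_differentiable (at q0)" if q0: "q0 \<in> ball 0 1 - {0}" for q0
  proof -
    have q0n: "q0 \<noteq> 0" using q0 by simp
    \<comment> \<open>A branch of the logarithm that is holomorphic near \<open>q0\<close> even if
      \<open>q0\<close> lies on the cut of \<open>Ln\<close>; by \<open>key\<close> it yields the
      same values of \<open>H\<close>.\<close>
    define L where "L = (\<lambda>q. Ln (q / q0) + Ln q0)"
    have "L field_differentiable (at q0)"
    proof -
      have "(L has_field_derivative 1 / q0) (at q0)"
        unfolding L_def using q0n by (auto intro!: derivative_eq_intros)
      then show ?thesis by (auto simp: field_differentiable_def)
    qed
    then have 1: "(\<lambda>q. u (L q)) field_differentiable (at q0)"
      unfolding u_def by (intro field_differentiable_divide field_differentiable_mult field_differentiable_const) auto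
    have "Im (u (L q0)) > 0" using ReLn[OF q0] q0n w by (simp add: ImRe_u L_def divide_neg_pos mult_pos_neg)
    then have "H field_differentiable (at (u (L q0)))"
      using hol open_upper holomorphic_on_imp_differentiable_at by blast
    then have "(H \<circ> (\<lambda>q. u (L q))) field_differentiable (at q0)"
      using 1 by (intro field_differentiable_compose) auto
    then obtain D where D: "((H \<circ> (\<lambda>q. u (L q))) has_field_derivative D) (at q0)"
      by (auto simp: field_differentiable_def)
    have "(G0 has_field_derivative D) (at q0)"
    proof (rule has_field_derivative_transform_within_open[OF D])
      show "open (ball 0 1 - {0 :: complex})" by (intro open_Diff) auto
      fix q :: complex assume q: "q \<in> ball 0 1 - {0}"
      have "exp (Ln q) = exp (L q)" using q q0n by (simp add: L_def exp_add)
      from key[OF this ReLn[OF q]] show "(H \<circ> (\<lambda>q. u (L q))) q = G0 q"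
        by (simp add: G0_def)
    qed (use q0 in auto)
    then show ?thesis by (auto simp: field_differentiable_def)
  qed
  then have hol0: "G0 holomorphic_on (ball 0 1 - {0})"
    by (simp add: field_differentiable_at_within holomorphic_on_def)
  have "((\<lambda>q. (q - 0) * G0 q) \<longlongrightarrow> 0) (at 0)"
  proof (rule Lim_null_comparison)
    show "((\<lambda>q. C * norm q powr (1 - x)) \<longlongrightarrow> 0) (at (0::complex))"
    proof -
      have "((\<lambda>q. norm q powr (1 - x)) \<longlongrightarrow> norm (0::complex) powr (1 - x)) (at (0::complex))"
        using x by (intro tendsto_powr' tendsto_intros) auto
      then have "((\<lambda>q. C * norm q powr (1 - x)) \<longlongrightarrow> C * (norm (0::complex) powr (1 - x))) (at (0::complex))"
        by (intro tendsto_mult tendsto_const)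
      then show ?thesis by simp
    qed
    have "exp (- 2 * pi / w) > 0" by simp
    then have "eventually (\<lambda>q. q \<in> ball 0 (exp (- 2 * pi / w)) - {0}) (at (0::complex))"
      by (intro eventually_at_in_open) auto
    then show "\<forall>\<^sub>F q in at 0. norm ((q - 0) * G0 q) \<le> C * norm q powr (1 - x)"
    proof eventually_elim
      case (elim q)
      then have q: "q \<noteq> 0" "norm q < exp (- 2 * pi / w)" by auto
      then have "ln (norm q) < - 2 * pi / w" by (metis ln_less_cancel_iff exp_gt_zero ln_exp zero_less_norm_iff)
      then have "w * ln (norm q) < - 2 * pi" using w by (simp add: field_simps)
      then have I: "Im (u (Ln q)) \<ge> 1" using q by (simp add: ImRe_u field_simps)
      have "\<bar>Im (Ln q)\<bar> \<le> pi" using q(1) mpi_less_Im_Ln[of q] Im_Ln_le_pi[of q] by auto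
      then have "w * \<bar>Im (Ln q)\<bar> \<le> w * (2 * pi)" using w by (intro mult_left_mono) (auto intro: order_trans)
      then have R: "\<bar>Re (u (Ln q))\<bar> \<le> w" using w by (simp add: ImRe_u abs_mult field_simps)
      have "norm (G0 q) \<le> C * exp (2 * pi * x * Im (u (Ln q)) / w)"
        unfolding G0_def by (rule bound[OF I R])
      also have "2 * pi * x * Im (u (Ln q)) / w = - x * ln (norm q)"
        using w q by (simp add: ImRe_u field_simps)
      also have "exp (- x * ln (norm q)) = norm q powr (- x)" using q by (simp add: powr_def)
      finally have "norm q * norm (G0 q) \<le> norm q * (C * norm q powr (- x))"
        by (intro mult_left_mono) auto
      also have "\<dots> = C * norm q powr (1 - x)" using q by (simp add: powr_diff powr_minus field_simps)
      finally show ?case by (simp add: norm_mult)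
    qed
  qed
  then obtain G where G: "G holomorphic_on ball 0 1" "\<And>q. q \<in> ball 0 1 - {0} \<Longrightarrow> G q = G0 q"
    using holomorphic_on_extend_lim[OF hol0] by (auto simp: interior_open)
  have "H z = G (ee (z / of_real w))" if z: "Im z > 0" for z
  proof -
    have "norm (ee (z / of_real w)) < 1" using z w by (intro norm_ee_less_1) simp
    then have mem: "ee (z / of_real w) \<in> ball 0 1 - {0}" by simp
    have "exp (Ln (ee (z / of_real w))) = exp (2 * of_real pi * \<i> * (z / of_real w))"
      by (simp add: ee_def)
    from key[OF this ReLn[OF mem]]
    have "G0 (ee (z / of_real w)) = H (u (2 * of_real pi * \<i> * (z / of_real w)))" by (simp add: G0_def)
    also have "u (2 * of_real pi * \<i> * (z / of_real w)) = z" using w by (simp add: u_def)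
    finally show ?thesis using G(2)[OF mem] by simp
  qed
  then show ?thesis using G(1) by blast
qed

text \<open>A weak reduction theory from Dirichlet approximation. With y = Im \<tau> and N between 1
  / sqrt y and 2 / sqrt y, some k \<le> N satisfies |k \<tau> - h|^2 \<le> y + (2 sqrt y)^2 = 5 y,
  whence 1/5. Any fixed positive height serves the compactness argument.\<close>

lemma exists_mob_Im_ge:
  assumes "Im \<tau> > 0"
  shows "\<exists>a b c d. a * d - b * c = 1 \<and> Im (mob (a, b, c, d) \<tau>) \<ge> 1 / 5"
proof (cases "Im \<tau> \<ge> 1")
  case True
  then show ?thesis by (intro exI[of _ 1] exI[of _ 0]) simp
next
  case False
  define y where "y = Im \<tau>"
  have y: "0 < y" "y < 1" using assms False by (auto simp: y_def)
  define N where "N = nat \<lceil>1 / sqrt y\<rceil>"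
  have s: "0 < sqrt y" "sqrt y < 1" using y by auto
  have N1: "real N \<ge> 1 / sqrt y" unfolding N_def by linarith
  have "1 / sqrt y > 0" using s by simp
  then have N0: "N > 0" using N1 by (cases N) auto
  have "real N \<le> 1 / sqrt y + 1" unfolding N_def using s by (simp add: le_of_int_ceiling of_nat_nat)
  also have "\<dots> \<le> 2 / sqrt y"
  proof -
    have "1 \<le> 1 / sqrt y" using s by (subst le_divide_eq_1_pos) auto
    moreover have "2 / sqrt y = 1 / sqrt y + 1 / sqrt y" by simp
    ultimately show ?thesis by linarith
  qed
  finally have N2: "real N \<le> 2 / sqrt y" .
  obtain h k where hk: "coprime h k" "0 < k" "k \<le> int N" "\<bar>of_int k * Re \<tau> - of_int h\<bar> < 1 / N"
    using Dirichlet_approx_coprime[OF N0, of "Re \<tau>"] by blast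
  have "coprime k h" using hk(1) by (simp add: coprime_commute)
  then obtain a b where ab: "a * k + b * h = 1"
    using bezout_int[of k h] by (auto simp: coprime_iff_gcd_eq_1)
  have det': "(- b) * (- h) - (- a) * k = 1" using ab by (simp add: algebra_simps)
  have n: "(cmod (of_int k * \<tau> + of_int (- h)))\<^sup>2 = (of_int k * Re \<tau> - of_int h)\<^sup>2 + (of_int k * y)\<^sup>2"
    unfolding cmod_power2 y_def by simp
  have "(of_int k * Re \<tau> - of_int h)\<^sup>2 \<le> (1 / real N)\<^sup>2"
    using hk(4) by (simp add: abs_le_square_iff[symmetric])
  also have "\<dots> \<le> (sqrt y)\<^sup>2"
    using N1 s N0 by (intro power_mono) (auto simp: field_simps)
  finally have 1: "(of_int k * Re \<tau> - of_int h)\<^sup>2 \<le> y" using y by simp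
  have "of_int k * y \<le> (2 / sqrt y) * y" using hk N2 y by (intro mult_right_mono) auto
  also have "\<dots> = 2 * sqrt y" using y s by (simp add: field_simps)
  finally have "(of_int k * y)\<^sup>2 \<le> (2 * sqrt y)\<^sup>2" using hk y by (intro power_mono) auto
  then have 2: "(of_int k * y)\<^sup>2 \<le> 4 * y" using y by (simp add: power_mult_distrib)
  have pos: "(cmod (of_int k * \<tau> + of_int (- h)))\<^sup>2 > 0"
    using linear_form_nonzero[OF assms, of k "- h"] hk by auto
  have "Im (mob (- b, - a, k, - h) \<tau>) = y / (cmod (of_int k * \<tau> + of_int (- h)))\<^sup>2"
    unfolding mob_Im[OF det'] y_def ..
  also have "\<dots> \<ge> y / (5 * y)"
    using 1 2 y pos unfolding n by (intro divide_left_mono) auto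
  finally show ?thesis using det' y by (intro exI[of _ "- b"] exI[of _ "- a"] exI[of _ k] exI[of _ "- h"]) simp
qed

text \<open>The cases c divisible by 4, c odd, and c congruent to 2 modulo 4 belong to the cusps
  infinity, 0 and 1/2. In the last case d is odd, so c and 2 d agree modulo 4.\<close>

lemma SL2_coset_decomposition:
  assumes "a * d - b * c = 1"
  shows "\<exists>M\<in>Gamma0_4. \<exists>j::int. \<exists>\<gamma>\<in>{(1, 0, 0, 1), (0, - 1, 1, 0), (1, 0, 2, 1)}.
     (a, b, c, d) = mmul M (mmul \<gamma> (1, j, 0, 1))"
proof -
  consider "4 dvd c" | "odd c" | "even c" "\<not> 4 dvd c" by blast
  then show ?thesis
  proof cases
    case 1
    then have "(a, b, c, d) \<in> Gamma0_4" using assms by (simp add: Gamma0_4_def)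
    moreover have "(a, b, c, d) = mmul (a, b, c, d) (mmul (1, 0, 0, 1) (1, 0, 0, 1))" by simp
    ultimately show ?thesis by blast
  next
    case 2
    \<comment> \<open>An odd square is 1 modulo 4, so this j solves j c = d modulo 4.\<close>
    define j where "j = c * d"
    have "c * c mod 4 = 1"
    proof -
      have "c mod 4 = 1 \<or> c mod 4 = 3" using 2 by presburger
      then show ?thesis by (auto simp: mod_mult_eq[symmetric, of c c])
    qed
    then have "4 dvd c * c - 1" by (simp add: mod_eq_dvd_iff[symmetric])
    then have "4 dvd (c * c - 1) * d" by simp
    then have dv: "4 dvd - (d - j * c)" by (simp add: j_def algebra_simps)
    have "(- (b - j * a), a, - (d - j * c), c) \<in> Gamma0_4"
      using dv assms by (auto simp: Gamma0_4_def algebra_simps)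
    moreover have "(a, b, c, d) = mmul (- (b - j * a), a, - (d - j * c), c) (mmul (0, - 1, 1, 0) (1, j, 0, 1))"
      by (simp add: algebra_simps)
    ultimately show ?thesis by blast
  next
    case 3
    then have "odd d" using assms by (metis dvd_diff dvd_mult dvd_mult2 odd_one)
    then have dv: "4 dvd c - 2 * d" using 3 by presburger
    have "(a - 2 * b, b, c - 2 * d, d) \<in> Gamma0_4"
      using dv assms by (auto simp: Gamma0_4_def algebra_simps)
    moreover have "(a, b, c, d) = mmul (a - 2 * b, b, c - 2 * d, d) (mmul (1, 0, 2, 1) (1, 0, 0, 1))"
      by simp
    ultimately show ?thesis by blast
  qed
qed

text \<open>The right-hand side is \<open>C\<close> times |q|^(-x) in the coordinate q = ee (z / w).
  Only bounded real parts are considered, which is where the lattice estimates are uniform and still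
  covers a full period.\<close>

definition cusp_bounded :: "(complex \<Rightarrow> complex) \<Rightarrow> mat2 \<Rightarrow> real \<Rightarrow> bool" where
  "cusp_bounded F \<gamma> w \<longleftrightarrow> (\<exists>C x. x < 1 \<and> (\<forall>z. Im z \<ge> 1 \<longrightarrow> \<bar>Re z\<bar> \<le> w \<longrightarrow> norm (F (mob \<gamma> z)) \<le> C * exp (2 * pi * x * Im z / w)))"

text \<open>The three matrices represent the cusps \<open>\<infinity>\<close>, \<open>0\<close> and \<open>1/2\<close>, of widths 1, 4 and 1.  In the local
  coordinates of the cusps the maximum of the absolute value is attained on a compact disc.\<close>
lemma Gamma0_4_invariant_constant:
  assumes hol: "F holomorphic_on upper"
    and inv: "\<And>M \<tau>. M \<in> Gamma0_4 \<Longrightarrow> Im \<tau> > 0 \<Longrightarrow> F (mob M \<tau>) = F \<tau>"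
    and cusps: "cusp_bounded F (1, 0, 0, 1) 1" "cusp_bounded F (0, - 1, 1, 0) 4" "cusp_bounded F (1, 0, 2, 1) 1"
  shows "\<exists>c. \<forall>\<tau>. Im \<tau> > 0 \<longrightarrow> F \<tau> = c"
proof -
  define w where "w = (\<lambda>\<gamma>::mat2. if \<gamma> = (0, - 1, 1, 0) then 4 else 1 :: real)"
  define \<Gamma> where "\<Gamma> = {(1, 0, 0, 1), (0, - 1, 1, 0), (1, 0, 2, 1) :: mat2}"
  have w: "w \<gamma> > 0" "w \<gamma> \<le> 4" for \<gamma> by (auto simp: w_def)
  have mob\<Gamma>: "Im (mob \<gamma> z) > 0" if "\<gamma> \<in> \<Gamma>" "Im z > 0" for \<gamma> z
    using that unfolding \<Gamma>_def by (elim insertE) (auto intro!: mob_Im_pos simp del: mob.simps)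
  have per: "F (mob \<gamma> (z + of_real (w \<gamma>) * of_int n)) = F (mob \<gamma> z)" if \<gamma>: "\<gamma> \<in> \<Gamma>" and z: "Im z > 0" for \<gamma> z n
  proof -
    define W where "W = (if \<gamma> = (0, - 1, 1, 0) then 4 else 1 :: int) * n"
    \<comment> \<open>\<open>M\<close> is the conjugate of T^W by \<open>\<gamma>\<close>; the
      widths in \<open>w\<close> are such that it lies in \<open>Gamma0_4\<close>.\<close>
    define M where "M = (if \<gamma> = (0, - 1, 1, 0) then (1, 0, - W, 1) else if \<gamma> = (1, 0, 0, 1) then (1, W, 0, 1) else (1 - 2 * W, W, - 4 * W, 1 + 2 * W))"
    have M: "M \<in> Gamma0_4" by (auto simp: M_def W_def Gamma0_4_def algebra_simps)
    have e: "mmul \<gamma> (1, W, 0, 1) = mmul M \<gamma>"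
      using \<gamma> by (auto simp: \<Gamma>_def M_def)
    obtain a b c d where g: "\<gamma> = (a, b, c, d)" by (cases \<gamma>)
    have det: "a * d - b * c = 1" using \<gamma> unfolding g \<Gamma>_def by auto
    obtain a' b' c' d' where m: "M = (a', b', c', d')" by (cases M)
    have det': "a' * d' - b' * c' = 1" using M unfolding m Gamma0_4_def by auto
    have "z + of_real (w \<gamma>) * of_int n = mob (1, W, 0, 1) z" by (simp add: W_def w_def)
    then have "F (mob \<gamma> (z + of_real (w \<gamma>) * of_int n)) = F (mob (mmul \<gamma> (1, W, 0, 1)) z)"
      using z det unfolding g by (subst mob_mmul) auto
    also have "\<dots> = F (mob M (mob \<gamma> z))"
      using z det det' unfolding e unfolding g m by (subst mob_mmul) auto
    also have "\<dots> = F (mob \<gamma> z)" by (rule inv[OF M mob\<Gamma>[OF \<gamma> z]])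
    finally show ?thesis .
  qed
  have "\<exists>G. G holomorphic_on ball 0 1 \<and> (\<forall>z. Im z > 0 \<longrightarrow> F (mob \<gamma> z) = G (ee (z / of_real (w \<gamma>))))" if \<gamma>: "\<gamma> \<in> \<Gamma>" for \<gamma>
  proof -
    have "cusp_bounded F \<gamma> (w \<gamma>)" using cusps \<gamma> by (auto simp: \<Gamma>_def w_def)
    then obtain C x where Cx: "x < 1" "\<And>z. Im z \<ge> 1 \<Longrightarrow> \<bar>Re z\<bar> \<le> w \<gamma> \<Longrightarrow> norm (F (mob \<gamma> z)) \<le> C * exp (2 * pi * x * Im z / w \<gamma>)"
      unfolding cusp_bounded_def by blast
    have "mob \<gamma> holomorphic_on upper"
    proof -
      obtain a b c d where g: "\<gamma> = (a, b, c, d)" by (cases \<gamma>)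
      have "(c, d) \<noteq> (0, 0)" using \<gamma> unfolding g \<Gamma>_def by auto
      then have "(\<lambda>z. (of_int a * z + of_int b) / (of_int c * z + of_int d)) holomorphic_on upper"
        by (intro holomorphic_intros) (use linear_form_nonzero in auto)
      moreover have "mob \<gamma> = (\<lambda>z. (of_int a * z + of_int b) / (of_int c * z + of_int d))" by (auto simp: g)
      ultimately show ?thesis by simp
    qed
    then have "(F \<circ> mob \<gamma>) holomorphic_on upper"
      by (rule holomorphic_on_compose_gen[OF _ hol]) (use mob\<Gamma>[OF \<gamma>] in auto)
    then have "(\<lambda>z. F (mob \<gamma> z)) holomorphic_on upper" by (simp add: o_def)
    then show ?thesis
      using periodic_extends_to_disc[of "\<lambda>z. F (mob \<gamma> z)" "w \<gamma>" C x] w per[OF \<gamma>] Cx by blast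
  qed
  then obtain G where G: "\<And>\<gamma>. \<gamma> \<in> \<Gamma> \<Longrightarrow> G \<gamma> holomorphic_on ball 0 1"
      "\<And>\<gamma> z. \<gamma> \<in> \<Gamma> \<Longrightarrow> Im z > 0 \<Longrightarrow> F (mob \<gamma> z) = G \<gamma> (ee (z / of_real (w \<gamma>)))"
    by metis
  \<comment> \<open>Height at least 1/5 and width at most 4 give |q| \<le> exp(-2 pi / 20).\<close>
  define \<rho> where "\<rho> = exp (- pi / 10)"
  have \<rho>: "0 < \<rho>" "\<rho> < 1" by (auto simp: \<rho>_def)
  have cover: "\<exists>\<gamma>\<in>\<Gamma>. \<exists>q\<in>cball 0 \<rho>. F \<tau> = G \<gamma> q" if \<tau>: "Im \<tau> > 0" for \<tau>
  proof -
    obtain a b c d where abcd: "a * d - b * c = 1" "Im (mob (a, b, c, d) \<tau>) \<ge> 1 / 5"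
      using exists_mob_Im_ge[OF \<tau>] by blast
    define z where "z = mob (a, b, c, d) \<tau>"
    have z: "Im z \<ge> 1 / 5" "Im z > 0" using abcd(2) unfolding z_def by linarith+
    \<comment> \<open>The inverse of the reducing matrix is decomposed, so that \<tau> becomes a
      \<open>Gamma0_4\<close> image of \<open>mob \<gamma> (z + j)\<close>. The shift by j does not
      affect the absolute value of q.\<close>
    have "d * a - (- b) * (- c) = 1" using abcd(1) by (simp add: algebra_simps)
    then obtain M j \<gamma> where Mj: "M \<in> Gamma0_4" "\<gamma> \<in> \<Gamma>" "(d, - b, - c, a) = mmul M (mmul \<gamma> (1, j, 0, 1))"
      using SL2_coset_decomposition[of d a "- b" "- c"] unfolding \<Gamma>_def by blast
    obtain a1 b1 c1 d1 where g: "\<gamma> = (a1, b1, c1, d1)" by (cases \<gamma>)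
    have det1: "a1 * d1 - b1 * c1 = 1" using Mj(2) unfolding g \<Gamma>_def by auto
    obtain a' b' c' d' where m: "M = (a', b', c', d')" by (cases M)
    have det': "a' * d' - b' * c' = 1" using Mj(1) unfolding m Gamma0_4_def by auto
    have mm: "mob (mmul (d, - b, - c, a) (a, b, c, d)) \<tau> = mob (d, - b, - c, a) z"
      unfolding z_def using \<tau> abcd(1) by (intro mob_mmul) auto
    have m1: "mmul (d, - b, - c, a) (a, b, c, d) = (1, 0, 0, 1)" using abcd(1) by (simp add: algebra_simps)
    have "\<tau> = mob (1, 0, 0, 1) \<tau>" by simp
    also have "\<dots> = mob (d, - b, - c, a) z" using mm unfolding m1 .
    also have "\<dots> = mob (mmul M (mmul \<gamma> (1, j, 0, 1))) z" unfolding Mj(3) ..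
    also have "\<dots> = mob M (mob (mmul \<gamma> (1, j, 0, 1)) z)"
    proof -
      have e: "mmul \<gamma> (1, j, 0, 1) = (a1, a1 * j + b1, c1, c1 * j + d1)" by (simp add: g)
      have "a1 * (c1 * j + d1) - (a1 * j + b1) * c1 = 1" using det1 by (simp add: algebra_simps)
      then show ?thesis unfolding m e using z det' by (intro mob_mmul) auto
    qed
    also have "mob (mmul \<gamma> (1, j, 0, 1)) z = mob \<gamma> (mob (1, j, 0, 1) z)"
      unfolding g using z det1 by (intro mob_mmul) auto
    also have "mob (1, j, 0, 1) z = z + of_int j" by simp
    finally have "\<tau> = mob M (mob \<gamma> (z + of_int j))" .
    moreover have zj: "Im (z + of_int j) > 0" using z by simp
    ultimately have "F \<tau> = F (mob \<gamma> (z + of_int j))"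
      using inv[OF Mj(1) mob\<Gamma>[OF Mj(2) zj]] by simp
    also have "\<dots> = G \<gamma> (ee ((z + of_int j) / of_real (w \<gamma>)))" using G(2)[OF Mj(2) zj] .
    finally have F: "F \<tau> = G \<gamma> (ee ((z + of_int j) / of_real (w \<gamma>)))" .
    have "1 / 20 \<le> Im z / w \<gamma>"
    proof -
      have "1 / 20 \<le> Im z / 4" using z by simp
      also have "\<dots> \<le> Im z / w \<gamma>" using w[of \<gamma>] z by (intro divide_left_mono) auto
      finally show ?thesis .
    qed
    then have "norm (ee ((z + of_int j) / of_real (w \<gamma>))) \<le> \<rho>"
      unfolding norm_ee \<rho>_def using w[of \<gamma>] by (simp add: field_simps)
    then show ?thesis using F Mj(2) by (intro bexI[of _ \<gamma>] bexI[of _ "ee ((z + of_int j) / of_real (w \<gamma>))"]) auto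
  qed
  have "\<exists>q\<in>cball 0 \<rho>. \<forall>p\<in>cball 0 \<rho>. norm (G \<gamma> p) \<le> norm (G \<gamma> q)" if \<gamma>: "\<gamma> \<in> \<Gamma>" for \<gamma>
  proof -
    have "continuous_on (cball 0 \<rho>) (G \<gamma>)"
      by (rule holomorphic_on_imp_continuous_on, rule holomorphic_on_subset[OF G(1)[OF \<gamma>]]) (use \<rho> in auto)
    then have "continuous_on (cball 0 \<rho>) (\<lambda>q. norm (G \<gamma> q))" by (intro continuous_intros)
    then show ?thesis using \<rho> by (intro continuous_attains_sup) auto
  qed
  then obtain Q where Q: "\<And>\<gamma>. \<gamma> \<in> \<Gamma> \<Longrightarrow> Q \<gamma> \<in> cball 0 \<rho>" "\<And>\<gamma> p. \<gamma> \<in> \<Gamma> \<Longrightarrow> p \<in> cball 0 \<rho> \<Longrightarrow> norm (G \<gamma> p) \<le> norm (G \<gamma> (Q \<gamma>))"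
    by metis
  have fin: "finite \<Gamma>" "\<Gamma> \<noteq> {}" by (auto simp: \<Gamma>_def)
  \<comment> \<open>The largest of the three disc maxima bounds \<open>F\<close> everywhere, because
    the discs cover the upper half plane up to \<open>Gamma0_4\<close>.\<close>
  define mx where "mx = Max ((\<lambda>\<gamma>. norm (G \<gamma> (Q \<gamma>))) ` \<Gamma>)"
  have "mx \<in> (\<lambda>\<gamma>. norm (G \<gamma> (Q \<gamma>))) ` \<Gamma>" unfolding mx_def using fin by (intro Max_in) auto
  then obtain \<gamma> where \<gamma>: "\<gamma> \<in> \<Gamma>" "mx = norm (G \<gamma> (Q \<gamma>))" by auto
  have mx_ge: "norm (G \<gamma>' (Q \<gamma>')) \<le> mx" if "\<gamma>' \<in> \<Gamma>" for \<gamma>'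
    unfolding mx_def using fin that by (intro Max_ge) auto
  have F_le: "norm (F \<tau>) \<le> mx" if "Im \<tau> > 0" for \<tau>
    using cover[OF that] Q(2) mx_ge by (metis order_trans)
  \<comment> \<open>Every q \<noteq> 0 of the unit disc is the coordinate of a point of the upper
    half plane, so the bound on \<open>F\<close> bounds \<open>G \<gamma>\<close> on the whole open
    disc, where \<open>Q \<gamma>\<close> is an interior point.\<close>
  have G_le: "norm (G \<gamma> q) \<le> norm (G \<gamma> (Q \<gamma>))" if q: "q \<in> ball 0 1" for q
  proof (cases "q = 0")
    case True
    then show ?thesis using Q(2)[OF \<gamma>(1)] \<rho> by auto
  next
    case False
    define z where "z = of_real (w \<gamma>) * (Ln q / (2 * of_real pi * \<i>))"
    have "Im z = - w \<gamma> * ln (norm q) / (2 * pi)"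
      using False by (simp add: z_def Im_divide power2_eq_square field_simps)
    moreover have "ln (norm q) < 0" using q False by simp
    ultimately have z: "Im z > 0" using w(1)[of \<gamma>] by (simp add: divide_neg_pos mult_pos_neg)
    have "z / of_real (w \<gamma>) = Ln q / (2 * of_real pi * \<i>)" using w(1)[of \<gamma>] by (simp add: z_def)
    then have "ee (z / of_real (w \<gamma>)) = q"
      using False by (simp add: ee_def)
    then have "G \<gamma> q = F (mob \<gamma> z)" using G(2)[OF \<gamma>(1) z] by simp
    then show ?thesis using F_le[OF mob\<Gamma>[OF \<gamma>(1) z]] \<gamma>(2) by simp
  qed
  have "Q \<gamma> \<in> ball 0 1" using Q(1)[OF \<gamma>(1)] \<rho> by auto
  then have "G \<gamma> constant_on ball 0 1"
    using G_le G(1)[OF \<gamma>(1)] by (intro maximum_modulus_principle[of _ _ "ball 0 1" "Q \<gamma>"]) auto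
  then obtain c where c: "\<And>q. q \<in> ball 0 1 \<Longrightarrow> G \<gamma> q = c" by (auto simp: constant_on_def)
  obtain a1 b1 c1 d1 where g: "\<gamma> = (a1, b1, c1, d1)" by (cases \<gamma>)
  have det1: "a1 * d1 - b1 * c1 = 1" using \<gamma>(1) unfolding g \<Gamma>_def by auto
  \<comment> \<open>Constancy at one cusp is enough: \<open>mob \<gamma>\<close> maps the upper half
    plane onto itself.\<close>
  have "F \<tau> = c" if \<tau>: "Im \<tau> > 0" for \<tau>
  proof -
    define z where "z = mob (d1, - b1, - c1, a1) \<tau>"
    have z: "Im z > 0" unfolding z_def using det1 \<tau> by (intro mob_Im_pos) (auto simp: algebra_simps)
    have mm: "mob (mmul (a1, b1, c1, d1) (d1, - b1, - c1, a1)) \<tau> = mob \<gamma> z"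
      unfolding g z_def using \<tau> det1 by (intro mob_mmul) (auto simp: algebra_simps)
    have m1: "mmul (a1, b1, c1, d1) (d1, - b1, - c1, a1) = (1, 0, 0, 1)" using det1 by (simp add: algebra_simps)
    have "\<tau> = mob (1, 0, 0, 1) \<tau>" by simp
    also have "\<dots> = mob \<gamma> z" using mm unfolding m1 .
    finally have "\<tau> = mob \<gamma> z" .
    then have "F \<tau> = G \<gamma> (ee (z / of_real (w \<gamma>)))" using G(2)[OF \<gamma>(1) z] by simp
    also have "\<dots> = c" using z w(1)[of \<gamma>] by (intro c) (simp add: norm_ee_less_1)
    finally show ?thesis .
  qed
  then show ?thesis by blast
qed

section \<open>The sum over cosets\<close>

declare mob.simps [simp del] Psi.simps [simp del]

text \<open>Multiplying the image of \<tau> by n is applying the matrix with entries a, b n, c / n,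
  d to n \<tau>, and its linear form at n \<tau> is again c \<tau> + d. This is the origin of the
  matrices in \<open>eta_char\<close>.\<close>

lemma Leta_of_nat_mult_mob:
  assumes det: "a * d - b * c = 1" and \<tau>: "Im \<tau> > 0" and n: "n > 0" "int n dvd c"
  shows "Leta (of_nat n * mob (a, b, c, d) \<tau>) = Leta (of_nat n * \<tau>) + Ln (of_int c * \<tau> + of_int d) / 2
     + of_real pi * \<i> / 12 * of_real (Psi (a, b * int n, c div int n, d))"
proof -
  obtain e where e: "c = int n * e" using n by (auto elim: dvdE)
  have ce: "c div int n = e" using n(1) by (simp add: e)
  have m: "of_nat n * mob (a, b, c, d) \<tau> = mob (a, b * int n, e, d) (of_nat n * \<tau>)"
    by (simp add: e algebra_simps mob.simps)
  have det': "a * d - (b * int n) * e = 1" using det by (simp add: e algebra_simps)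
  have n\<tau>: "Im (of_nat n * \<tau>) > 0" using \<tau> n by simp
  have l: "of_int e * (of_nat n * \<tau>) + of_int d = of_int c * \<tau> + of_int d" by (simp add: e)
  show ?thesis unfolding m ce l[symmetric] by (rule Leta_mob[OF det' n\<tau>])
qed

lemma Re_Leta_mob:
  assumes "a * d - b * c = 1" "Im \<tau> > 0"
  shows "Re (Leta (mob (a, b, c, d) \<tau>)) = Re (Leta \<tau>) + ln (cmod (of_int c * \<tau> + of_int d)) / 2"
proof -
  have "of_int c * \<tau> + of_int d \<noteq> 0" using assms by (intro linear_form_nonzero) auto
  then show ?thesis unfolding Leta_mob[OF assms] by simp
qed

text \<open>Bounds \<open>eta_log_series\<close> at height at least 1/4: the lowest argument that
  occurs is z / 4 with Im z \<ge> 1, at the cusp 0.\<close>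

definition Leta_bound :: real where
  "Leta_bound = exp (-2 * pi * (1 / 4)) / (1 - exp (-2 * pi * (1 / 4)))\<^sup>2"

text \<open>The exponents may have either sign, so the error term carries |r|.\<close>

lemma mult_Re_Leta_ge:
  assumes "Im \<tau> \<ge> 1 / 4"
  shows "r * Re (Leta \<tau>) \<ge> - r * pi * Im \<tau> / 12 - \<bar>r\<bar> * Leta_bound"
proof -
  have "\<bar>Re (eta_log_series \<tau>)\<bar> \<le> Leta_bound"
    using norm_eta_log_series_le[OF assms] abs_Re_le_cmod[of "eta_log_series \<tau>"] unfolding Leta_bound_def by simp
  then have "\<bar>r * Re (eta_log_series \<tau>)\<bar> \<le> \<bar>r\<bar> * Leta_bound"
    unfolding abs_mult by (intro mult_left_mono) auto
  moreover have "r * Re (Leta \<tau>) = - r * pi * Im \<tau> / 12 + r * Re (eta_log_series \<tau>)"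
    by (simp add: Leta_def algebra_simps)
  ultimately show ?thesis by linarith
qed

section \<open>Lower rows of Gamma0(4) and matrices over them\<close>

definition row_set :: "(int \<times> int) set" where
  "row_set = {(c, d). coprime c d \<and> 4 dvd c}"

lemma Gamma0_4_row: "(a, b, c, d) \<in> Gamma0_4 \<Longrightarrow> (c, d) \<in> row_set"
proof -
  assume M: "(a, b, c, d) \<in> Gamma0_4"
  have "is_unit x" if "x dvd c" "x dvd d" for x
  proof -
    have "x dvd a * d - b * c" using that by simp
    also have "a * d - b * c = 1" using M by (simp add: Gamma0_4_def)
    finally show ?thesis .
  qed
  then show ?thesis using M by (auto simp: Gamma0_4_def row_set_def intro: coprimeI)
qed

lemma row_set_matrix:
  assumes "p \<in> row_set"
  shows "\<exists>M\<in>Gamma0_4. snd (snd M) = p"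
proof -
  obtain c d where p: "p = (c, d)" "coprime c d" "4 dvd c" using assms by (auto simp: row_set_def)
  obtain u v where "u * c + v * d = 1"
    using bezout_int[of c d] p(2) by (auto simp: coprime_iff_gcd_eq_1)
  then have "(v, - u, c, d) \<in> Gamma0_4" using p by (auto simp: Gamma0_4_def algebra_simps)
  then show ?thesis using p by force
qed

definition row_matrix :: "int \<times> int \<Rightarrow> mat2" where
  "row_matrix p = (SOME M. M \<in> Gamma0_4 \<and> snd (snd M) = p)"

lemma row_matrix: "p \<in> row_set \<Longrightarrow> row_matrix p \<in> Gamma0_4 \<and> snd (snd (row_matrix p)) = p"
  unfolding row_matrix_def by (rule someI_ex) (use row_set_matrix[of p] in blast)

lemma row_matrixE:
  assumes "(c, d) \<in> row_set"
  obtains a b where "row_matrix (c, d) = (a, b, c, d)" "a * d - b * c = 1" "4 dvd c"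
  using row_matrix[OF assms] by (cases "row_matrix (c, d)") (auto simp: Gamma0_4_def)

lemma same_row_translate:
  assumes "a * d - b * c = 1" "a' * d - b' * c = (1::int)"
  shows "\<exists>n. a' = a + n * c \<and> b' = b + n * d"
proof (intro exI conjI)
  \<comment> \<open>Upper right entry of the second matrix times the inverse of the first, a power
    of T because the lower rows agree.\<close>
  let ?n = "a * b' - b * a'"
  have "a + ?n * c = a * (1 + b' * c) - a' * (b * c)" by (simp add: algebra_simps)
  also have "1 + b' * c = a' * d" using assms by simp
  also have "b * c = a * d - 1" using assms by simp
  finally show "a' = a + ?n * c" by (simp add: algebra_simps)
  have "b + ?n * d = b * (1 - a' * d) + b' * (a * d)" by (simp add: algebra_simps)
  also have "1 - a' * d = - (b' * c)" using assms by simp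
  also have "a * d = 1 + b * c" using assms by simp
  finally show "b' = b + ?n * d" by (simp add: algebra_simps)
qed

section \<open>The eta quotient and the series of its reciprocals\<close>

locale eta_quotient =
  fixes r2 r4 :: real
  assumes order_at_0: "- 2 * r2 - 5 * r4 < 8" and order_at_half: "- r4 < 8"
    and weight: "(- 2 * r2 - 5 * r4) + (- r4) > 8"
begin

definition "r1 = - 2 * r2 - 4 * r4"
definition "k = (- r2 - 3 * r4) / 2"
definition "f \<tau> = exp (of_real r1 * Leta \<tau> + of_real r2 * Leta (2 * \<tau>) + of_real r4 * Leta (4 * \<tau>))"

lemma k_gt_2: "k > 2" using weight by (simp add: k_def)

lemma f_nonzero [simp]: "f \<tau> \<noteq> 0" by (simp add: f_def)

lemma norm_f: "norm (f \<tau>) = exp (r1 * Re (Leta \<tau>) + r2 * Re (Leta (2 * \<tau>)) + r4 * Re (Leta (4 * \<tau>)))"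
  by (simp add: f_def norm_exp_eq_Re)

text \<open>All three factors contribute the same logarithm, so it appears with half the sum of the
  exponents, which is \<open>k\<close>. Everything stays inside one exponential, and no power is
  split across branches.\<close>

lemma f_mob:
  assumes M: "(a, b, c, d) \<in> Gamma0_4" and \<tau>: "Im \<tau> > 0"
  shows "f (mob (a, b, c, d) \<tau>) =
     ee (of_real ((r1 * Psi (a, b, c, d) + r2 * Psi (a, b * 2, c div 2, d) + r4 * Psi (a, b * 4, c div 4, d)) / 24))
     * exp (of_real k * Ln (of_int c * \<tau> + of_int d)) * f \<tau>"
proof -
  have det: "a * d - b * c = 1" and c: "4 dvd c" using M by (auto simp: Gamma0_4_def)
  have c2: "2 dvd c" using c by presburger
  define l where "l = Ln (of_int c * \<tau> + of_int d)"
  define P1 P2 P4 where "P1 = Psi (a, b, c, d)" and "P2 = Psi (a, b * 2, c div 2, d)" and "P4 = Psi (a, b * 4, c div 4, d)"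
  have 1: "Leta (mob (a, b, c, d) \<tau>) = Leta \<tau> + l / 2 + of_real pi * \<i> / 12 * of_real P1"
    unfolding l_def P1_def by (rule Leta_mob[OF det \<tau>])
  have 2: "Leta (2 * mob (a, b, c, d) \<tau>) = Leta (2 * \<tau>) + l / 2 + of_real pi * \<i> / 12 * of_real P2"
    using Leta_of_nat_mult_mob[OF det \<tau>, of 2] c2 unfolding l_def P2_def by simp
  have 4: "Leta (4 * mob (a, b, c, d) \<tau>) = Leta (4 * \<tau>) + l / 2 + of_real pi * \<i> / 12 * of_real P4"
    using Leta_of_nat_mult_mob[OF det \<tau>, of 4] c unfolding l_def P4_def by simp
  have k: "of_real k = (of_real r1 + of_real r2 + of_real r4) / (2 :: complex)"
    by (simp add: k_def r1_def)
  show ?thesis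
    unfolding f_def 1 2 4 ee_def exp_add[symmetric] l_def[symmetric] P1_def[symmetric] P2_def[symmetric] P4_def[symmetric] k
    by (rule arg_cong[of _ _ exp]) (simp add: field_simps)
qed

lemma norm_f_mob:
  assumes M: "(a, b, c, d) \<in> Gamma0_4" and \<tau>: "Im \<tau> > 0"
  shows "norm (f (mob (a, b, c, d) \<tau>)) = cmod (of_int c * \<tau> + of_int d) powr k * norm (f \<tau>)"
proof -
  have "of_int c * \<tau> + of_int d \<noteq> 0" using M \<tau> by (intro linear_form_nonzero) (auto simp: Gamma0_4_def)
  then have e1: "norm (exp (of_real k * Ln (of_int c * \<tau> + of_int d))) = cmod (of_int c * \<tau> + of_int d) powr k"
    by (simp add: norm_exp_eq_Re powr_def)
  have e2: "norm (ee (of_real x)) = 1" for x by (simp add: norm_ee)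
  show ?thesis unfolding f_mob[OF assms] norm_mult e1 e2 by simp
qed

text \<open>The linear parts of the three logarithms cancel because r1 + 2 r2 + 4 r4 = 0. This exact
  periodicity makes 1 / f depend on the row alone.\<close>

lemma f_add_int: "f (\<tau> + of_int n) = f \<tau>"
proof -
  have 2: "Leta (2 * (\<tau> + of_int n)) = Leta (2 * \<tau>) + of_real pi * \<i> / 12 * of_int (2 * n)"
    using Leta_add_int[of "2 * \<tau>" "2 * n"] by (simp add: distrib_left)
  have 4: "Leta (4 * (\<tau> + of_int n)) = Leta (4 * \<tau>) + of_real pi * \<i> / 12 * of_int (4 * n)"
    using Leta_add_int[of "4 * \<tau>" "4 * n"] by (simp add: distrib_left)
  show ?thesis unfolding f_def Leta_add_int 2 4
    by (rule arg_cong[of _ _ exp]) (simp add: r1_def field_simps)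
qed

lemma f_holomorphic: "f holomorphic_on upper"
proof -
  have L: "Leta holomorphic_on upper"
    using Leta_field_differentiable by (auto simp: holomorphic_on_def intro: field_differentiable_at_within)
  have Ln: "(\<lambda>\<tau>. Leta (of_nat n * \<tau>)) holomorphic_on upper" if "n > 0" for n
  proof -
    have "(Leta \<circ> (\<lambda>\<tau>. of_nat n * \<tau>)) holomorphic_on upper"
      by (rule holomorphic_on_compose_gen[OF _ L]) (use that in \<open>auto intro!: holomorphic_intros\<close>)
    then show ?thesis by (simp add: o_def)
  qed
  show ?thesis unfolding f_def
    using L Ln[of 2] Ln[of 4] by (intro holomorphic_intros) auto
qed

text \<open>The summand of a coset after division by \<open>f \<tau>\<close>; the arbitrary upper
  row in \<open>row_matrix\<close> is immaterial by \<open>g_eq\<close>.\<close>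

definition "g p \<tau> = 1 / f (mob (row_matrix p) \<tau>)"

lemma g_eq:
  assumes M: "(a, b, c, d) \<in> Gamma0_4" and \<tau>: "Im \<tau> > 0"
  shows "g (c, d) \<tau> = 1 / f (mob (a, b, c, d) \<tau>)"
proof -
  have det: "a * d - b * c = 1" using M by (simp add: Gamma0_4_def)
  obtain a' b' where R: "row_matrix (c, d) = (a', b', c, d)" "a' * d - b' * c = 1"
    using row_matrixE[OF Gamma0_4_row[OF M]] by metis
  obtain n where n: "a' = a + n * c" "b' = b + n * d" using same_row_translate[OF det R(2)] by blast
  have nz: "of_int c * \<tau> + of_int d \<noteq> 0" using det \<tau> by (intro linear_form_nonzero) auto
  have "mob (a', b', c, d) \<tau> = (of_int a * \<tau> + of_int b + of_int n * (of_int c * \<tau> + of_int d)) / (of_int c * \<tau> + of_int d)"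
    by (simp add: n algebra_simps mob.simps)
  also have "\<dots> = mob (a, b, c, d) \<tau> + of_int n"
    using nz by (simp add: add_divide_distrib mob.simps)
  finally show ?thesis unfolding g_def R(1) by (simp add: f_add_int)
qed

lemma norm_g:
  assumes p: "(c, d) \<in> row_set" and \<tau>: "Im \<tau> > 0"
  shows "norm (g (c, d) \<tau>) = cmod (of_int c * \<tau> + of_int d) powr (- k) / norm (f \<tau>)"
proof -
  obtain a b where R: "row_matrix (c, d) = (a, b, c, d)" by (rule row_matrixE[OF p])
  then have M: "(a, b, c, d) \<in> Gamma0_4" using row_matrix[OF p] by simp
  show ?thesis unfolding g_eq[OF M \<tau>] norm_divide norm_f_mob[OF M \<tau>] by (simp add: powr_minus divide_inverse)
qed

lemma g_holomorphic:
  assumes p: "p \<in> row_set"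
  shows "g p holomorphic_on upper"
proof -
  obtain c d where cd: "p = (c, d)" by (cases p)
  obtain a b where R: "row_matrix (c, d) = (a, b, c, d)" "a * d - b * c = 1"
    using p unfolding cd by (rule row_matrixE)
  have "(c, d) \<noteq> (0, 0)" using R(2) by auto
  then have "(\<lambda>z. (of_int a * z + of_int b) / (of_int c * z + of_int d)) holomorphic_on upper"
    by (intro holomorphic_intros) (use linear_form_nonzero in auto)
  moreover have "mob (a, b, c, d) = (\<lambda>z. (of_int a * z + of_int b) / (of_int c * z + of_int d))" by (auto simp: mob.simps)
  ultimately have "mob (a, b, c, d) holomorphic_on upper" by simp
  then have fm: "(f \<circ> mob (a, b, c, d)) holomorphic_on upper"
    by (rule holomorphic_on_compose_gen[OF _ f_holomorphic]) (use mob_Im_pos[OF R(2)] in auto)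
  have "(\<lambda>\<tau>. 1 / (f \<circ> mob (a, b, c, d)) \<tau>) holomorphic_on upper"
    by (rule holomorphic_on_divide[OF holomorphic_on_const fm]) auto
  then show ?thesis unfolding cd g_def R(1) by (simp add: o_def)
qed

lemma summable_norm_fg:
  assumes \<tau>: "Im \<tau> > 0"
  shows "(\<lambda>p. norm (f \<tau> * g p \<tau>)) summable_on row_set"
proof -
  have "(\<lambda>(c, d). cmod (of_int c * \<tau> + of_int d) powr (- k)) summable_on row_set"
    by (rule summable_on_subset_banach[OF summable_on_linear_form_powr[OF k_gt_2 \<tau>]]) auto
  then show ?thesis
    by (rule summable_on_cong[THEN iffD1, rotated]) (auto simp: norm_mult norm_g \<tau>)
qed

lemma summable_fg: "Im \<tau> > 0 \<Longrightarrow> (\<lambda>p. f \<tau> * g p \<tau>) summable_on row_set"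
  by (rule abs_summable_summable) (rule summable_norm_fg)

lemma summable_g:
  assumes "Im \<tau> > 0"
  shows "(\<lambda>p. g p \<tau>) summable_on row_set"
  using summable_on_cmult_right[OF summable_fg[OF assms], of "1 / f \<tau>"] by simp

definition "F \<tau> = (\<Sum>\<^sub>\<infinity>p\<in>row_set. g p \<tau>)"

lemma f_times_F: "f \<tau> * F \<tau> = (\<Sum>\<^sub>\<infinity>p\<in>row_set. f \<tau> * g p \<tau>)"
  unfolding F_def by (simp add: infsum_cmult_right')

text \<open>Uniform convergence is shown for the product f F: its terms have modulus |c \<tau> +
  d|^(-k), in which f no longer appears. Dividing by the nonvanishing f gives F.\<close>

lemma F_holomorphic: "F holomorphic_on upper"
proof -
  define E where "E = (\<lambda>\<tau>. \<Sum>\<^sub>\<infinity>p\<in>row_set. f \<tau> * g p \<tau>)"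
  have "E field_differentiable (at z)" if z: "Im z > 0" for z
  proof -
    define r where "r = Im z / 2"
    define R where "R = \<bar>Re z\<bar> + r"
    have r: "r > 0" using z by (simp add: r_def)
    have sub: "Im y \<ge> r \<and> \<bar>Re y\<bar> \<le> R" if "y \<in> cball z r" for y
    proof -
      have "norm (y - z) \<le> r" using that by (simp add: dist_norm norm_minus_commute)
      then have "\<bar>Im y - Im z\<bar> \<le> r" "\<bar>Re y - Re z\<bar> \<le> r"
        using abs_Im_le_cmod[of "y - z"] abs_Re_le_cmod[of "y - z"] by simp_all
      then show ?thesis unfolding R_def r_def by linarith
    qed
    define B where "B = (\<lambda>(c::int, d::int). (1 + (1 + R) / r) powr k * (\<bar>real_of_int c\<bar> + \<bar>real_of_int d\<bar>) powr (- k))"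
    have "B summable_on UNIV"
      using summable_on_cmult_right[OF summable_on_lattice_powr[OF k_gt_2], of "(1 + (1 + R) / r) powr k"]
      by (simp add: B_def case_prod_unfold)
    then have Bs: "B summable_on row_set" by (rule summable_on_subset_banach) auto
    have "uniform_limit (cball z r) (\<lambda>X y. \<Sum>p\<in>X. f y * g p y) (\<lambda>y. \<Sum>\<^sub>\<infinity>p\<in>row_set. f y * g p y) (finite_subsets_at_top row_set)"
    proof (rule Weierstrass_m_test_general[OF _ Bs])
      fix p y assume p: "p \<in> row_set" and y: "y \<in> cball z r"
      obtain c d where cd: "p = (c, d)" by (cases p)
      have y': "Im y > 0" using sub[OF y] r by linarith
      have nz: "(c, d) \<noteq> (0, 0)" using p unfolding cd row_set_def by auto
      have "norm (f y * g p y) = cmod (of_int c * y + of_int d) powr (- k)"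
        using p y' unfolding cd by (simp add: norm_mult norm_g)
      also have "\<dots> \<le> B p"
        unfolding B_def cd using linear_form_powr_le[OF r, of y R k c d] sub[OF y] k_gt_2 nz by simp
      finally show "norm (f y * g p y) \<le> B p" .
    qed
    moreover have "\<forall>\<^sub>F X in finite_subsets_at_top row_set.
        continuous_on (cball z r) (\<lambda>y. \<Sum>p\<in>X. f y * g p y) \<and> (\<lambda>y. \<Sum>p\<in>X. f y * g p y) holomorphic_on ball z r"
    proof (rule eventually_finite_subsets_at_top_weakI)
      fix X assume X: "finite X" "X \<subseteq> row_set"
      have "(\<lambda>y. \<Sum>p\<in>X. f y * g p y) holomorphic_on upper"
        using X by (intro holomorphic_intros f_holomorphic g_holomorphic) auto
      moreover have "cball z r \<subseteq> upper" using sub r by fastforce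
      ultimately show "continuous_on (cball z r) (\<lambda>y. \<Sum>p\<in>X. f y * g p y) \<and> (\<lambda>y. \<Sum>p\<in>X. f y * g p y) holomorphic_on ball z r"
        by (meson ball_subset_cball holomorphic_on_imp_continuous_on holomorphic_on_subset)
    qed
    ultimately have "E holomorphic_on ball z r"
      using holomorphic_uniform_limit[of z r "\<lambda>X y. \<Sum>p\<in>X. f y * g p y" "finite_subsets_at_top row_set" E] finite_subsets_at_top_neq_bot
      unfolding E_def by blast
    then show ?thesis using r holomorphic_on_imp_differentiable_at[of E "ball z r" z] by simp
  qed
  then have "E holomorphic_on upper" by (auto simp: holomorphic_on_def intro: field_differentiable_at_within)
  then have "(\<lambda>\<tau>. E \<tau> / f \<tau>) holomorphic_on upper" using f_holomorphic by (intro holomorphic_intros) auto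
  moreover have "E \<tau> / f \<tau> = F \<tau>" for \<tau> unfolding E_def f_times_F[symmetric] by simp
  ultimately show ?thesis by simp
qed

text \<open>Right multiplication by \<open>N\<close> permutes the rows, and moving the argument by
  \<open>N\<close> amounts to moving the row.\<close>

lemma F_invariant:
  assumes N: "N \<in> Gamma0_4" and \<tau>: "Im \<tau> > 0"
  shows "F (mob N \<tau>) = F \<tau>"
proof -
  obtain a b c d where Nd: "N = (a, b, c, d)" by (cases N)
  have det: "a * d - b * c = 1" and c4: "4 dvd c" using N by (auto simp: Nd Gamma0_4_def)
  define h where "h = (\<lambda>(u, v). (u * a + v * c, u * b + v * d))"
  define h' where "h' = (\<lambda>(u, v). (u * d - v * c, v * a - u * b))"
  have inv: "h' (h p) = p" "h (h' p) = p" for p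
  proof -
    obtain u v where p: "p = (u, v)" by (cases p)
    have "h' (h p) = (u * (a * d - b * c), v * (a * d - b * c))"
      by (simp add: p h_def h'_def algebra_simps)
    then show "h' (h p) = p" by (simp add: det p)
    have "h (h' p) = (u * (a * d - b * c), v * (a * d - b * c))"
      by (simp add: p h_def h'_def algebra_simps)
    then show "h (h' p) = p" by (simp add: det p)
  qed
  have mem: "h p \<in> row_set \<and> g p (mob N \<tau>) = g (h p) \<tau>" if p: "p \<in> row_set" for p
  proof -
    obtain u v where uv: "p = (u, v)" by (cases p)
    obtain s t where R: "row_matrix (u, v) = (s, t, u, v)" "s * v - t * u = 1" "4 dvd u"
      using p unfolding uv by (rule row_matrixE)
    define K where "K = mmul (s, t, u, v) N"
    have "(s * a + t * c) * (u * b + v * d) - (s * b + t * d) * (u * a + v * c) = (s * v - t * u) * (a * d - b * c)"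
      by (simp add: algebra_simps)
    then have K: "K \<in> Gamma0_4" using R(2,3) det c4 by (simp add: K_def Nd Gamma0_4_def)
    have Kd: "K = (s * a + t * c, s * b + t * d, u * a + v * c, u * b + v * d)" by (simp add: K_def Nd)
    have "mob K \<tau> = mob (s, t, u, v) (mob N \<tau>)"
      unfolding K_def Nd using \<tau> det R(2) by (intro mob_mmul) auto
    then have "g p (mob N \<tau>) = 1 / f (mob K \<tau>)" unfolding g_def uv R(1) by simp
    also have "\<dots> = g (h p) \<tau>" using g_eq[of _ _ _ _ \<tau>] K \<tau> unfolding Kd h_def uv by simp
    finally show ?thesis using Gamma0_4_row K unfolding Kd h_def uv by simp
  qed
  have mem': "h' p \<in> row_set" if p: "p \<in> row_set" for p
  proof -
    obtain u v where uv: "p = (u, v)" by (cases p)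
    obtain s t where R: "row_matrix (u, v) = (s, t, u, v)" "s * v - t * u = 1" "4 dvd u"
      using p unfolding uv by (rule row_matrixE)
    have "(s * d - t * c) * (v * a - u * b) - (t * a - s * b) * (u * d - v * c) = (s * v - t * u) * (a * d - b * c)"
      by (simp add: algebra_simps)
    then have "(s * d - t * c, t * a - s * b, u * d - v * c, v * a - u * b) \<in> Gamma0_4"
      using R(2,3) det c4 by (simp add: Gamma0_4_def)
    then show ?thesis using Gamma0_4_row unfolding h'_def uv by simp
  qed
  show ?thesis unfolding F_def
    by (rule infsum_reindex_bij_witness[of _ h' h]) (use inv mem mem' in auto)
qed

section \<open>Growth at the cusps\<close>

lemma norm_F_mob_le:
  assumes det: "a * d - b * c = 1" and R: "R \<ge> 0"
  shows "\<exists>C\<ge>0. \<forall>z. Im z \<ge> 1 \<longrightarrow> \<bar>Re z\<bar> \<le> R \<longrightarrow>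
     norm (F (mob (a, b, c, d) z)) \<le> C * cmod (of_int c * z + of_int d) powr k / norm (f (mob (a, b, c, d) z))"
proof -
  define \<psi> where "\<psi> = (\<lambda>(u::int, v::int). (\<bar>real_of_int u\<bar> + \<bar>real_of_int v\<bar>) powr (- k))"
  define A where "A = (1 + (1 + R) / 1) powr k"
  define h where "h = (\<lambda>(u, v). (u * a + v * c, u * b + v * d))"
  have \<psi>: "\<psi> summable_on UNIV" unfolding \<psi>_def by (rule summable_on_lattice_powr[OF k_gt_2])
  \<comment> \<open>Multiplied by the cusp matrix, the rows remain distinct lattice points, so the
    sum over them is at most the full lattice sum.\<close>
  have inj: "inj h"
  proof (rule inj_on_inverseI)
    fix p :: "int \<times> int"
    obtain u v where p: "p = (u, v)" by (cases p)
    have "(\<lambda>(u, v). (u * d - v * c, v * a - u * b)) (h p) = (u * (a * d - b * c), v * (a * d - b * c))"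
      by (simp add: p h_def algebra_simps)
    then show "(\<lambda>(u, v). (u * d - v * c, v * a - u * b)) (h p) = p" by (simp add: det p)
  qed
  then have injr: "inj_on h row_set" by (rule inj_on_subset) auto
  have hs: "(\<psi> \<circ> h) summable_on row_set"
    using summable_on_reindex[OF injr, of \<psi>] summable_on_subset_banach[OF \<psi>, of "h ` row_set"] by simp
  have "infsum (\<psi> \<circ> h) row_set = infsum \<psi> (h ` row_set)"
    using infsum_reindex[OF injr, of \<psi>] by simp
  also have "\<dots> \<le> infsum \<psi> UNIV"
    by (rule infsum_mono_neutral) (use \<psi> summable_on_subset_banach[OF \<psi>] in \<open>auto simp: \<psi>_def\<close>)
  finally have le: "infsum (\<psi> \<circ> h) row_set \<le> infsum \<psi> UNIV" .
  have "norm (F (mob (a, b, c, d) z)) \<le> A * infsum \<psi> UNIV * cmod (of_int c * z + of_int d) powr k / norm (f (mob (a, b, c, d) z))"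
    if z: "Im z \<ge> 1" "\<bar>Re z\<bar> \<le> R" for z
  proof -
    define w where "w = mob (a, b, c, d) z"
    define j where "j = of_int c * z + of_int d"
    have w: "Im w > 0" unfolding w_def using det z by (intro mob_Im_pos) auto
    have j: "j \<noteq> 0" unfolding j_def using det z by (intro linear_form_nonzero) auto
    define Q where "Q = cmod j powr k / norm (f w) * A"
    have "norm (g p w) \<le> Q * (\<psi> \<circ> h) p" if p: "p \<in> row_set" for p
    proof -
      obtain u v where uv: "p = (u, v)" by (cases p)
      define z' where "z' = of_int (u * a + v * c) * z + of_int (u * b + v * d)"
      have nz: "(u * a + v * c, u * b + v * d) \<noteq> (0, 0)"
      proof
        assume "(u * a + v * c, u * b + v * d) = (0, 0)"
        then have "h (u, v) = h (0, 0)" by (simp add: h_def)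
        then have "(u, v) = (0, 0)" using inj by (auto dest: injD)
        then show False using p unfolding uv row_set_def by simp
      qed
      \<comment> \<open>c z + d is a common denominator; what remains is the linear form of the
        moved row at z, which is bounded below uniformly in z.\<close>
      have "of_int u * w + of_int v = z' / j"
        unfolding w_def z'_def j_def using j by (simp add: j_def field_simps mob.simps)
      then have "norm (g p w) = cmod (z' / j) powr (- k) / norm (f w)"
        using norm_g p w unfolding uv by simp
      also have "cmod (z' / j) powr (- k) = cmod z' powr (- k) * cmod j powr k"
        using j by (simp add: norm_divide powr_divide powr_minus field_simps)
      also have "\<dots> / norm (f w) \<le> (A * \<psi> (h p)) * cmod j powr k / norm (f w)"
        unfolding z'_def A_def \<psi>_def h_def uv
        using linear_form_powr_le[of 1 z R k "u * a + v * c" "u * b + v * d"] z k_gt_2 nz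
        by (intro divide_right_mono mult_right_mono) auto
      finally show ?thesis by (simp add: Q_def mult_ac)
    qed
    moreover have "((\<lambda>p. g p w) has_sum F w) row_set"
      unfolding F_def using summable_g[OF w] by simp
    moreover have "((\<lambda>p. Q * (\<psi> \<circ> h) p) has_sum (Q * infsum (\<psi> \<circ> h) row_set)) row_set"
      by (rule has_sum_cmult_right[OF has_sum_infsum[OF hs]])
    ultimately have "norm (F w) \<le> Q * infsum (\<psi> \<circ> h) row_set"
      by (rule norm_infsum_le[rotated 2])
    also have "\<dots> \<le> Q * infsum \<psi> UNIV"
      using le by (intro mult_left_mono) (auto simp: Q_def A_def)
    finally show ?thesis unfolding Q_def w_def j_def by (simp add: mult_ac)
  qed
  moreover have "A * infsum \<psi> UNIV \<ge> 0"
    by (intro mult_nonneg_nonneg infsum_nonneg) (auto simp: A_def \<psi>_def)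
  ultimately show ?thesis by blast
qed

text \<open>The factor |c z + d|^k in the estimate of \<open>F\<close> cancels against the one in
  \<open>f\<close>, so only the decay of \<open>f\<close> in the local coordinate matters.\<close>

lemma cusp_boundedI:
  assumes det: "a * d - b * c = 1" and R: "w > 0" and x: "x < 1"
    and low: "\<And>z. Im z \<ge> 1 \<Longrightarrow> norm (f (mob (a, b, c, d) z)) \<ge> exp (- B) * cmod (of_int c * z + of_int d) powr k * exp (- 2 * pi * x * Im z / w)"
  shows "cusp_bounded F (a, b, c, d) w"
proof -
  obtain C where C: "C \<ge> 0" "\<And>z. Im z \<ge> 1 \<Longrightarrow> \<bar>Re z\<bar> \<le> w \<Longrightarrow>
     norm (F (mob (a, b, c, d) z)) \<le> C * cmod (of_int c * z + of_int d) powr k / norm (f (mob (a, b, c, d) z))"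
    using norm_F_mob_le[OF det, of w] R by auto
  have "norm (F (mob (a, b, c, d) z)) \<le> (C * exp B) * exp (2 * pi * x * Im z / w)" if z: "Im z \<ge> 1" "\<bar>Re z\<bar> \<le> w" for z
  proof -
    define j where "j = cmod (of_int c * z + of_int d) powr k"
    have "of_int c * z + of_int d \<noteq> 0" using det z by (intro linear_form_nonzero) auto
    then have j: "j > 0" by (simp add: j_def)
    have "norm (F (mob (a, b, c, d) z)) \<le> C * j / norm (f (mob (a, b, c, d) z))" unfolding j_def by (rule C(2)[OF z])
    also have "\<dots> \<le> C * j / (exp (- B) * j * exp (- 2 * pi * x * Im z / w))"
      using low[OF z(1)] C(1) j unfolding j_def[symmetric] by (intro divide_left_mono mult_pos_pos mult_nonneg_nonneg) auto
    also have "\<dots> = (C * exp B) * exp (2 * pi * x * Im z / w)"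
      using j by (simp add: exp_minus field_simps)
    finally show ?thesis .
  qed
  then show ?thesis unfolding cusp_bounded_def using x by blast
qed

lemma cusp_bounded_infinity: "cusp_bounded F (1, 0, 0, 1) 1"
proof (rule cusp_boundedI[where x = 0 and B = "(\<bar>r1\<bar> + \<bar>r2\<bar> + \<bar>r4\<bar>) * Leta_bound"])
  fix z assume z: "Im z \<ge> 1"
  have "r1 * Re (Leta z) + r2 * Re (Leta (2 * z)) + r4 * Re (Leta (4 * z)) \<ge>
     (- r1 * pi * Im z / 12 - \<bar>r1\<bar> * Leta_bound) + (- r2 * pi * Im (2 * z) / 12 - \<bar>r2\<bar> * Leta_bound) + (- r4 * pi * Im (4 * z) / 12 - \<bar>r4\<bar> * Leta_bound)"
    using z by (intro add_mono mult_Re_Leta_ge) auto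
  also have "(- r1 * pi * Im z / 12 - \<bar>r1\<bar> * Leta_bound) + (- r2 * pi * Im (2 * z) / 12 - \<bar>r2\<bar> * Leta_bound) + (- r4 * pi * Im (4 * z) / 12 - \<bar>r4\<bar> * Leta_bound)
     = - ((\<bar>r1\<bar> + \<bar>r2\<bar> + \<bar>r4\<bar>) * Leta_bound)" by (simp add: r1_def field_simps)
  finally show "norm (f (mob (1, 0, 0, 1) z)) \<ge> exp (- ((\<bar>r1\<bar> + \<bar>r2\<bar> + \<bar>r4\<bar>) * Leta_bound)) * cmod (of_int 0 * z + of_int 1) powr k * exp (- 2 * pi * 0 * Im z / 1)"
    by (simp add: norm_f mob.simps)
qed auto

text \<open>Inversion sends n (-1/z) to z / n. The exponents combine as r1 + r2/2 + r4/4 = (3/4)(-2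
  r2 - 5 r4), which for width 4 is the order (-2 r2 - 5 r4)/8. The constants with
  \<open>ln 2\<close> and \<open>ln 4\<close> come from |z / n|.\<close>

lemma cusp_bounded_0: "cusp_bounded F (0, - 1, 1, 0) 4"
proof (rule cusp_boundedI[where x = "(- 2 * r2 - 5 * r4) / 8" and B = "(\<bar>r1\<bar> + \<bar>r2\<bar> + \<bar>r4\<bar>) * Leta_bound + r2 * ln 2 / 2 + r4 * ln 4 / 2"])
  fix z assume z: "Im z \<ge> 1"
  have z0: "z \<noteq> 0" using z by auto
  have S: "Re (Leta (of_nat n * (- 1 / z))) = Re (Leta (z / of_nat n)) + (ln (cmod z) - ln n) / 2" if n: "n > 0" for n
  proof -
    have e: "of_nat n * (- 1 / z) = - 1 / (z / of_nat n)" using n by simp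
    have "Im (z / of_nat n) > 0" using z n by simp
    then have "Re (Leta (of_nat n * (- 1 / z))) = Re (Leta (z / of_nat n)) + ln (cmod (- \<i> * (z / of_nat n))) / 2"
      unfolding e using Leta_minus_inverse[of "z / of_nat n"] z0 n by simp
    also have "ln (cmod (- \<i> * (z / of_nat n))) = ln (cmod z) - ln n"
      using z0 n by (simp add: norm_divide norm_mult ln_div)
    finally show ?thesis .
  qed
  have f: "norm (f (- 1 / z)) = exp (r1 * Re (Leta (z / 1)) + r2 * Re (Leta (z / 2)) + r4 * Re (Leta (z / 4)) + k * ln (cmod z) - r2 * ln 2 / 2 - r4 * ln 4 / 2)"
  proof -
    have S1: "Re (Leta (- 1 / z)) = Re (Leta (z / 1)) + ln (cmod z) / 2" using S[of 1] by simp
    have S2: "Re (Leta (2 * (- 1 / z))) = Re (Leta (z / 2)) + (ln (cmod z) - ln 2) / 2" using S[of 2] by simp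
    have S4: "Re (Leta (4 * (- 1 / z))) = Re (Leta (z / 4)) + (ln (cmod z) - ln 4) / 2" using S[of 4] by simp
    show ?thesis unfolding norm_f S1 S2 S4 by (simp add: k_def r1_def field_simps)
  qed
  have "r1 * Re (Leta (z / 1)) + r2 * Re (Leta (z / 2)) + r4 * Re (Leta (z / 4)) \<ge>
     (- r1 * pi * Im (z / 1) / 12 - \<bar>r1\<bar> * Leta_bound) + (- r2 * pi * Im (z / 2) / 12 - \<bar>r2\<bar> * Leta_bound) + (- r4 * pi * Im (z / 4) / 12 - \<bar>r4\<bar> * Leta_bound)"
    using z by (intro add_mono mult_Re_Leta_ge) auto
  also have "(- r1 * pi * Im (z / 1) / 12 - \<bar>r1\<bar> * Leta_bound) + (- r2 * pi * Im (z / 2) / 12 - \<bar>r2\<bar> * Leta_bound) + (- r4 * pi * Im (z / 4) / 12 - \<bar>r4\<bar> * Leta_bound)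
     = - ((\<bar>r1\<bar> + \<bar>r2\<bar> + \<bar>r4\<bar>) * Leta_bound) - 2 * pi * ((- 2 * r2 - 5 * r4) / 8) * Im z / 4" by (simp add: r1_def field_simps)
  finally have "norm (f (- 1 / z)) \<ge> exp (- ((\<bar>r1\<bar> + \<bar>r2\<bar> + \<bar>r4\<bar>) * Leta_bound) - 2 * pi * ((- 2 * r2 - 5 * r4) / 8) * Im z / 4 + k * ln (cmod z) - r2 * ln 2 / 2 - r4 * ln 4 / 2)"
    unfolding f by simp
  also have "exp (- ((\<bar>r1\<bar> + \<bar>r2\<bar> + \<bar>r4\<bar>) * Leta_bound) - 2 * pi * ((- 2 * r2 - 5 * r4) / 8) * Im z / 4 + k * ln (cmod z) - r2 * ln 2 / 2 - r4 * ln 4 / 2)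
     = exp (- ((\<bar>r1\<bar> + \<bar>r2\<bar> + \<bar>r4\<bar>) * Leta_bound + r2 * ln 2 / 2 + r4 * ln 4 / 2)) * cmod z powr k * exp (- 2 * pi * ((- 2 * r2 - 5 * r4) / 8) * Im z / 4)"
    using z0 unfolding powr_def by (simp add: mult.commute[of k] flip: exp_add)
  finally show "norm (f (mob (0, - 1, 1, 0) z)) \<ge> exp (- ((\<bar>r1\<bar> + \<bar>r2\<bar> + \<bar>r4\<bar>) * Leta_bound + r2 * ln 2 / 2 + r4 * ln 4 / 2))
       * cmod (of_int 1 * z + of_int 0) powr k * exp (- 2 * pi * ((- 2 * r2 - 5 * r4) / 8) * Im z / 4)"
    by (simp add: mob.simps)
qed (use order_at_0 in auto)

text \<open>Here the exponents combine as r1 + 2 r2 + r4 = -3 r4, which is 24 times the order -r4 /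
  8.\<close>

lemma cusp_bounded_half: "cusp_bounded F (1, 0, 2, 1) 1"
proof (rule cusp_boundedI[where x = "- r4 / 8" and B = "(\<bar>r1\<bar> + \<bar>r2\<bar> + \<bar>r4\<bar>) * Leta_bound + r4 * ln 2 / 2"])
  fix z assume z: "Im z \<ge> 1"
  define m where "m = mob (1, 0, 2, 1) z"
  define l where "l = ln (cmod (2 * z + 1))"
  have nz: "2 * z + 1 \<noteq> 0" using linear_form_nonzero[of z 2 1] z by simp
  have L1: "Re (Leta m) = Re (Leta z) + l / 2"
    unfolding m_def l_def using Re_Leta_mob[of 1 1 0 2 z] z by simp
  have L2: "Re (Leta (2 * m)) = Re (Leta (2 * z)) + l / 2"
  proof -
    have "2 * m = mob (1, 0, 1, 1) (2 * z)" by (simp add: m_def mob.simps)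
    then show ?thesis using Re_Leta_mob[of 1 1 0 1 "2 * z"] z by (simp add: l_def)
  qed
  have L4: "Re (Leta (4 * m)) = Re (Leta (z + 1 / 2)) + l / 2 - ln 2 / 2"
  proof -
    have e: "z + 1 / 2 = (2 * z + 1) / 2" by (simp add: field_simps)
    \<comment> \<open>The matrix with rows (4, 0), (2, 1) factors as the one with rows (2, -1), (1,
      0) times the one with rows (2, 1), (0, 2); hence the shift by 1/2.\<close>
    have "4 * m = mob (2, - 1, 1, 0) (z + 1 / 2)" using nz unfolding m_def e by (simp add: field_simps mob.simps)
    then have "Re (Leta (4 * m)) = Re (Leta (z + 1 / 2)) + ln (cmod (z + 1 / 2)) / 2"
      using Re_Leta_mob[of 2 0 "- 1" 1 "z + 1 / 2"] z by simp
    also have "ln (cmod (z + 1 / 2)) = l - ln 2" unfolding e l_def using nz by (simp add: norm_divide ln_div)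
    finally show ?thesis by (simp add: diff_divide_distrib)
  qed
  have f: "norm (f m) = exp (r1 * Re (Leta z) + r2 * Re (Leta (2 * z)) + r4 * Re (Leta (z + 1 / 2)) + k * l - r4 * ln 2 / 2)"
    unfolding norm_f L1 L2 L4 by (simp add: k_def r1_def field_simps)
  have "r1 * Re (Leta z) + r2 * Re (Leta (2 * z)) + r4 * Re (Leta (z + 1 / 2)) \<ge>
     (- r1 * pi * Im z / 12 - \<bar>r1\<bar> * Leta_bound) + (- r2 * pi * Im (2 * z) / 12 - \<bar>r2\<bar> * Leta_bound) + (- r4 * pi * Im (z + 1 / 2) / 12 - \<bar>r4\<bar> * Leta_bound)"
    using z by (intro add_mono mult_Re_Leta_ge) auto
  also have "(- r1 * pi * Im z / 12 - \<bar>r1\<bar> * Leta_bound) + (- r2 * pi * Im (2 * z) / 12 - \<bar>r2\<bar> * Leta_bound) + (- r4 * pi * Im (z + 1 / 2) / 12 - \<bar>r4\<bar> * Leta_bound)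
     = - ((\<bar>r1\<bar> + \<bar>r2\<bar> + \<bar>r4\<bar>) * Leta_bound) - 2 * pi * (- r4 / 8) * Im z / 1" by (simp add: r1_def field_simps)
  finally have "norm (f m) \<ge> exp (- ((\<bar>r1\<bar> + \<bar>r2\<bar> + \<bar>r4\<bar>) * Leta_bound) - 2 * pi * (- r4 / 8) * Im z / 1 + k * l - r4 * ln 2 / 2)"
    unfolding f by simp
  also have "exp (- ((\<bar>r1\<bar> + \<bar>r2\<bar> + \<bar>r4\<bar>) * Leta_bound) - 2 * pi * (- r4 / 8) * Im z / 1 + k * l - r4 * ln 2 / 2)
     = exp (- ((\<bar>r1\<bar> + \<bar>r2\<bar> + \<bar>r4\<bar>) * Leta_bound + r4 * ln 2 / 2)) * cmod (2 * z + 1) powr k * exp (- 2 * pi * (- r4 / 8) * Im z / 1)"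
    using nz unfolding powr_def l_def by (simp add: mult.commute[of k] flip: exp_add)
  finally show "norm (f (mob (1, 0, 2, 1) z)) \<ge> exp (- ((\<bar>r1\<bar> + \<bar>r2\<bar> + \<bar>r4\<bar>) * Leta_bound + r4 * ln 2 / 2))
       * cmod (of_int 2 * z + of_int 1) powr k * exp (- 2 * pi * (- r4 / 8) * Im z / 1)"
    unfolding m_def by simp
qed (use order_at_half in auto)

section \<open>The value of the constant\<close>

lemma F_constant: "\<exists>c. \<forall>\<tau>. Im \<tau> > 0 \<longrightarrow> F \<tau> = c"
  by (intro Gamma0_4_invariant_constant F_holomorphic F_invariant cusp_bounded_infinity cusp_bounded_0 cusp_bounded_half)

lemma fg_unit:
  assumes "d = 1 \<or> d = - 1" "Im \<tau> > 0"
  shows "f \<tau> * g (0, d) \<tau> = 1"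
proof -
  have "(d, 0, 0, d) \<in> Gamma0_4" using assms by (auto simp: Gamma0_4_def)
  moreover have "mob (d, 0, 0, d) \<tau> = \<tau>" using assms by (auto simp: mob.simps)
  ultimately show ?thesis using g_eq[of d 0 0 d \<tau>] assms by simp
qed

lemma f_limit: "(\<lambda>n. f (\<i> * of_nat n)) \<longlonglongrightarrow> 1"
proof -
  have S: "(\<lambda>n. eta_log_series (of_nat m * (\<i> * of_nat n))) \<longlonglongrightarrow> 0" if m: "m > 0" for m :: nat
  proof (rule Lim_null_comparison)
    define \<rho> where "\<rho> = (\<lambda>n::nat. exp (- 2 * pi * real n))"
    have "\<rho> = (\<lambda>n. exp (- 2 * pi) ^ n)" by (simp add: \<rho>_def fun_eq_iff mult_ac flip: exp_of_nat_mult)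
    moreover have "(\<lambda>n. exp (- 2 * pi) ^ n) \<longlonglongrightarrow> 0" by (rule LIMSEQ_realpow_zero) auto
    ultimately have "\<rho> \<longlonglongrightarrow> 0" by (simp only:)
    then have "(\<lambda>n. \<rho> n / (1 - \<rho> n)\<^sup>2) \<longlonglongrightarrow> 0 / (1 - 0)\<^sup>2" by (intro tendsto_intros) auto
    then show "(\<lambda>n. \<rho> n / (1 - \<rho> n)\<^sup>2) \<longlonglongrightarrow> 0" by simp
    show "\<forall>\<^sub>F n in sequentially. norm (eta_log_series (of_nat m * (\<i> * of_nat n))) \<le> \<rho> n / (1 - \<rho> n)\<^sup>2"
      using eventually_gt_at_top[of 0]
    proof eventually_elim
      case (elim n)
      then show ?case unfolding \<rho>_def using m by (intro norm_eta_log_series_le) auto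
    qed
  qed
  have "(\<lambda>n. exp (of_real r1 * eta_log_series (of_nat 1 * (\<i> * of_nat n)) + of_real r2 * eta_log_series (of_nat 2 * (\<i> * of_nat n))
      + of_real r4 * eta_log_series (of_nat 4 * (\<i> * of_nat n)))) \<longlonglongrightarrow> exp (of_real r1 * 0 + of_real r2 * 0 + of_real r4 * 0)"
    by (intro tendsto_exp tendsto_add tendsto_mult tendsto_const S) auto
  moreover have "exp (of_real r1 * eta_log_series (of_nat 1 * (\<i> * of_nat n)) + of_real r2 * eta_log_series (of_nat 2 * (\<i> * of_nat n))
      + of_real r4 * eta_log_series (of_nat 4 * (\<i> * of_nat n))) = f (\<i> * of_nat n)" for n
    unfolding f_def Leta_def by (rule arg_cong[of _ _ exp]) (simp add: r1_def field_simps)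
  ultimately show ?thesis by simp
qed

theorem F_eq_2:
  assumes "Im \<tau> > 0"
  shows "F \<tau> = 2"
proof -
  obtain c where c: "\<And>\<tau>. Im \<tau> > 0 \<Longrightarrow> F \<tau> = c" using F_constant by blast
  \<comment> \<open>Half of the surplus over 2: the part \<epsilon> of the exponent yields the decay
    in n, and the remaining k - \<epsilon> > 2 keeps the lattice sum finite.\<close>
  define \<epsilon> where "\<epsilon> = (k - 2) / 2"
  have \<epsilon>: "\<epsilon> > 0" "k - \<epsilon> > 2" using k_gt_2 by (auto simp: \<epsilon>_def field_simps)
  define \<phi> where "\<phi> = (\<lambda>(u::int, v::int). cmod (of_int u * \<i> + of_int v) powr (- (k - \<epsilon>)))"
  define X where "X = row_set - {(0, 1), (0, - 1)}"
  have "\<phi> summable_on UNIV" unfolding \<phi>_def by (rule summable_on_linear_form_powr) (use \<epsilon> in auto)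
  then have "\<phi> summable_on X" by (rule summable_on_subset_banach) auto
  then have \<phi>: "(\<phi> has_sum infsum \<phi> X) X" by (rule has_sum_infsum)
  have le: "norm (f (\<i> * of_nat n) * c - 2) \<le> real n powr (- \<epsilon>) * infsum \<phi> X" if n: "n \<ge> 1" for n :: nat
  proof -
    define t where "t = \<i> * of_nat n"
    have t: "Im t > 0" using n by (simp add: t_def)
    have "((\<lambda>p. f t * g p t) has_sum (f t * c)) row_set"
      using has_sum_infsum[OF summable_fg[OF t]] unfolding f_times_F[symmetric] c[OF t] .
    moreover have "((\<lambda>p. f t * g p t) has_sum 2) {(0, 1), (0, - 1)}"
      by (rule has_sum_finiteI) (auto simp: fg_unit t)
    ultimately have "((\<lambda>p. f t * g p t) has_sum (f t * c - 2)) X"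
      unfolding X_def by (rule has_sum_Diff) (auto simp: row_set_def)
    moreover have "((\<lambda>p. real n powr (- \<epsilon>) * \<phi> p) has_sum (real n powr (- \<epsilon>) * infsum \<phi> X)) X"
      by (rule has_sum_cmult_right[OF \<phi>])
    moreover have "norm (f t * g p t) \<le> real n powr (- \<epsilon>) * \<phi> p" if p: "p \<in> X" for p
    proof -
      obtain u v where uv: "p = (u, v)" by (cases p)
      have mem: "(u, v) \<in> row_set" using p unfolding uv X_def by simp
      have u: "u \<noteq> 0"
      proof
        assume "u = 0"
        then have "\<bar>v\<bar> = 1" using mem by (simp add: row_set_def)
        then show False using p \<open>u = 0\<close> unfolding uv X_def by auto
      qed
      define N where "N = cmod (of_int u * t + of_int v)"
      have "1 * real n \<le> \<bar>real_of_int u\<bar> * real n" using u by (intro mult_right_mono) auto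
      also have "\<dots> = \<bar>Im (of_int u * t + of_int v)\<bar>" by (simp add: t_def abs_mult)
      also have "\<dots> \<le> N" unfolding N_def by (rule abs_Im_le_cmod)
      finally have N1: "real n \<le> N" by simp
      \<comment> \<open>Raising the imaginary part only enlarges the linear form, so the lattice sum
        at \<i> serves for all n.\<close>
      have "cmod (of_int u * \<i> + of_int v) \<le> N"
      proof -
        have "(real_of_int u)\<^sup>2 * 1 \<le> (real_of_int u)\<^sup>2 * (real n)\<^sup>2" using n by (intro mult_left_mono) auto
        then show ?thesis unfolding N_def cmod_def t_def by (simp add: power_mult_distrib)
      qed
      moreover have "of_int u * \<i> + of_int v \<noteq> 0" using linear_form_nonzero[of \<i> u v] u by simp
      ultimately have N2: "N powr (- (k - \<epsilon>)) \<le> \<phi> p" unfolding \<phi>_def uv using \<epsilon> by (simp add: powr_mono2')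
      have "N powr (- \<epsilon>) \<le> real n powr (- \<epsilon>)" using N1 n \<epsilon> by (intro powr_mono2') auto
      then have "N powr (- \<epsilon>) * N powr (- (k - \<epsilon>)) \<le> real n powr (- \<epsilon>) * \<phi> p"
        using N2 by (intro mult_mono) auto
      moreover have "N powr (- \<epsilon>) * N powr (- (k - \<epsilon>)) = N powr (- k)"
        unfolding powr_add[symmetric] by simp
      moreover have "norm (f t * g p t) = N powr (- k)"
        using mem t unfolding N_def uv by (simp add: norm_mult norm_g)
      ultimately show ?thesis by simp
    qed
    ultimately show ?thesis unfolding t_def by (rule norm_infsum_le)
  qed
  have l1: "(\<lambda>n. norm (f (\<i> * of_nat n) * c - 2)) \<longlonglongrightarrow> norm (1 * c - 2)"
    by (intro tendsto_intros f_limit)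
  have l2: "(\<lambda>n. real n powr (- \<epsilon>) * infsum \<phi> X) \<longlonglongrightarrow> 0 * infsum \<phi> X"
    using \<epsilon> by (intro tendsto_mult tendsto_const tendsto_neg_powr filterlim_real_sequentially) auto
  have "norm (1 * c - 2) \<le> 0 * infsum \<phi> X"
    by (rule LIMSEQ_le[OF l1 l2]) (use le in blast)
  then show ?thesis using c[OF assms] by simp
qed

end

section \<open>Cosets of the D-fold cover\<close>

text \<open>Powers of T have automorphy factor 1 and change only the upper row; comparing the
  factors at \<i> recovers \<epsilon>.\<close>

lemma Tcoset_eq:
  assumes h: "((a, b, c, d), \<epsilon>) \<in> GammaT D"
  shows "Tcoset D ((a, b, c, d), \<epsilon>) = {g \<in> GammaT D. snd (snd (fst g)) = (c, d) \<and> snd g = \<epsilon>}"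
proof (intro equalityI subsetI)
  have det: "a * d - b * c = 1" using h by (auto simp: GammaT_def Gamma0_4_def)
  fix g assume g: "g \<in> Tcoset D ((a, b, c, d), \<epsilon>)"
  obtain a' b' c' d' \<epsilon>' where gd: "g = ((a', b', c', d'), \<epsilon>')" by (metis surj_pair)
  from g have G: "g \<in> GammaT D" by (simp add: Tcoset_def)
  from g obtain n where n: "fst g = mmul (fst (Ttilde_pow n)) (fst ((a, b, c, d), \<epsilon>))"
    "\<forall>\<tau>. Im \<tau> > 0 \<longrightarrow> autf D g \<tau> = autf D (Ttilde_pow n) (mob (fst ((a, b, c, d), \<epsilon>)) \<tau>) * autf D ((a, b, c, d), \<epsilon>) \<tau>"
    unfolding Tcoset_def by blast
  have cd: "c' = c" "d' = d" using n(1) by (auto simp: gd Ttilde_pow_def)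
  have "of_int c * \<i> + of_int d \<noteq> 0" using det by (intro linear_form_nonzero) auto
  then have "\<epsilon>' = \<epsilon>" using n(2)[rule_format, of \<i>] by (simp add: gd cd Ttilde_pow_def)
  then show "g \<in> {g \<in> GammaT D. snd (snd (fst g)) = (c, d) \<and> snd g = \<epsilon>}" using G by (simp add: gd cd)
next
  have det: "a * d - b * c = 1" using h by (auto simp: GammaT_def Gamma0_4_def)
  fix g assume g: "g \<in> {g \<in> GammaT D. snd (snd (fst g)) = (c, d) \<and> snd g = \<epsilon>}"
  then obtain a' b' where gd: "g = ((a', b', c, d), \<epsilon>)" by (cases g) auto
  have "a' * d - b' * c = 1" using g unfolding gd by (auto simp: GammaT_def Gamma0_4_def)
  then obtain n where n: "a' = a + n * c" "b' = b + n * d" using same_row_translate[OF det] by blast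
  have "fst g = mmul (fst (Ttilde_pow n)) (fst ((a, b, c, d), \<epsilon>))"
    by (simp add: gd n Ttilde_pow_def)
  moreover have "autf D g \<tau> = autf D (Ttilde_pow n) (mob (fst ((a, b, c, d), \<epsilon>)) \<tau>) * autf D ((a, b, c, d), \<epsilon>) \<tau>" for \<tau>
    by (simp add: gd Ttilde_pow_def)
  ultimately show "g \<in> Tcoset D ((a, b, c, d), \<epsilon>)" using g unfolding Tcoset_def by blast
qed

text \<open>A coset seen through its two invariants, row and root of unity, instead of through a
  representative.\<close>

definition row_fibre :: "nat \<Rightarrow> (int \<times> int) \<times> complex \<Rightarrow> (mat2 \<times> complex) set" where
  "row_fibre D = (\<lambda>(p, \<epsilon>). {g \<in> GammaT D. snd (snd (fst g)) = p \<and> snd g = \<epsilon>})"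

lemma row_fibre_nonempty:
  assumes "p \<in> row_set" "\<epsilon> ^ D = 1"
  shows "(row_matrix p, \<epsilon>) \<in> row_fibre D (p, \<epsilon>)"
  using row_matrix[OF assms(1)] assms(2) by (simp add: row_fibre_def GammaT_def)

lemma bij_betw_row_fibre: "bij_betw (row_fibre D) (row_set \<times> {\<epsilon>. \<epsilon> ^ D = 1}) (Tcosets D)"
  unfolding bij_betw_def
proof
  show "inj_on (row_fibre D) (row_set \<times> {\<epsilon>. \<epsilon> ^ D = 1})"
  proof (rule inj_onI)
    fix x y assume x: "x \<in> row_set \<times> {\<epsilon>. \<epsilon> ^ D = 1}" and eq: "row_fibre D x = row_fibre D y"
    obtain p \<epsilon> where xd: "x = (p, \<epsilon>)" by (cases x)
    have p: "p \<in> row_set" "\<epsilon> ^ D = 1" using x by (auto simp: xd)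
    have "(row_matrix p, \<epsilon>) \<in> row_fibre D y"
      using row_fibre_nonempty[OF p] eq by (simp add: xd)
    then show "x = y" using row_matrix[OF p(1)] by (cases y) (simp add: row_fibre_def xd)
  qed
  show "row_fibre D ` (row_set \<times> {\<epsilon>. \<epsilon> ^ D = 1}) = Tcosets D"
  proof (intro equalityI subsetI)
    fix C assume "C \<in> row_fibre D ` (row_set \<times> {\<epsilon>. \<epsilon> ^ D = 1})"
    then obtain c d \<epsilon> where C: "C = row_fibre D ((c, d), \<epsilon>)" "(c, d) \<in> row_set" "\<epsilon> ^ D = 1" by auto
    obtain a b where R: "row_matrix (c, d) = (a, b, c, d)" by (rule row_matrixE[OF C(2)])
    have mem: "((a, b, c, d), \<epsilon>) \<in> GammaT D" using row_matrix[OF C(2)] C(3) by (simp add: GammaT_def R)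
    have "C = Tcoset D ((a, b, c, d), \<epsilon>)" unfolding Tcoset_eq[OF mem] C(1) row_fibre_def by simp
    then show "C \<in> Tcosets D" using mem by (auto simp: Tcosets_def)
  next
    fix C assume "C \<in> Tcosets D"
    then obtain h where h: "h \<in> GammaT D" "C = Tcoset D h" by (auto simp: Tcosets_def)
    obtain a b c d \<epsilon> where hd: "h = ((a, b, c, d), \<epsilon>)" by (metis surj_pair)
    note C = h[unfolded hd]
    have "C = row_fibre D ((c, d), \<epsilon>)" unfolding C(2) Tcoset_eq[OF C(1)] row_fibre_def by simp
    moreover have "(c, d) \<in> row_set" "\<epsilon> ^ D = 1" using C(1) Gamma0_4_row by (auto simp: GammaT_def)
    ultimately show "C \<in> row_fibre D ` (row_set \<times> {\<epsilon>. \<epsilon> ^ D = 1})" by blast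
  qed
qed

lemma divisors_4: "{n::nat. n dvd 4} = {1, 2, 4}"
proof -
  have "n \<in> {1, 2, 4}" if "n dvd 4" for n :: nat
  proof -
    have "n \<le> 4" using that by (intro dvd_imp_le) auto
    then have "n \<in> {0, 1, 2, 3, 4}" by auto
    then show ?thesis using that by auto
  qed
  then show ?thesis by auto
qed

text \<open>Absolute convergence secures summability over the product; the finite fibres then
  determine the value.\<close>

lemma has_sum_times_finite:
  fixes t :: "'a \<Rightarrow> complex"
  assumes t: "(\<lambda>p. norm (t p)) summable_on A" "(t has_sum S) A" and U: "finite U"
  shows "((\<lambda>(p, \<epsilon>). t p) has_sum (of_nat (card U) * S)) (A \<times> U)"
proof -
  have "(\<lambda>x. norm ((\<lambda>(p, \<epsilon>). t p) x)) summable_on (A \<times> U)"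
    unfolding Infinite_Sum.abs_summable_on_Sigma_iff
    using t(1) U by (auto simp: abs_mult intro!: summable_on_cmult_right)
  then obtain S' where S': "((\<lambda>(p, \<epsilon>). t p) has_sum S') (A \<times> U)"
    using abs_summable_summable by (auto simp: summable_on_def)
  have "((\<lambda>p. of_nat (card U) * t p) has_sum S') A"
    by (rule has_sum_SigmaD[OF S']) (auto intro: has_sum_finiteI U)
  moreover have "((\<lambda>p. of_nat (card U) * t p) has_sum (of_nat (card U) * S)) A"
    by (rule has_sum_cmult_right[OF t(2)])
  ultimately show ?thesis using S' has_sum_unique by metis
qed

text \<open>With an integral exponent \<open>powr\<close> is an ordinary power and therefore
  multiplicative; this is how the evenness conditions on D dispose of the principal branch.\<close>

lemma root_powr_of_int:
  assumes "\<epsilon> \<noteq> 0" "z \<noteq> 0"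
  shows "(\<epsilon> * z powr s) powr of_int m = \<epsilon> powr of_int m * exp (of_int m * s * Ln z)"
proof -
  have "(\<epsilon> * z powr s) powr of_int m = (\<epsilon> * exp (s * Ln z)) powi m"
    using assms by (simp add: complex_powr_of_int powr_def[of z])
  also have "\<dots> = \<epsilon> powi m * exp (of_int m * (s * Ln z))"
    by (simp add: power_int_mult_distrib exp_power_int)
  also have "\<epsilon> powi m = \<epsilon> powr of_int m" using assms by (simp add: complex_powr_of_int)
  finally show ?thesis by (simp add: mult.assoc)
qed

theorem theorem8p4:
  fixes r2 r4 :: rat and D :: nat and \<tau> :: complex
  assumes "0 \<le> -2*r2 - 5*r4" and "-2*r2 - 5*r4 < 8"
    and "0 \<le> -r4" and "-r4 < 8"
    and "(-2*r2 - 5*r4) + (-r4) > 8"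
    and "D \<ge> 1"
    and "\<exists>m::int. of_nat D * r2 = 2 * of_int m"
    and "\<exists>m::int. of_nat D * r4 = 2 * of_int m"
    and "Im \<tau> > 0"
  shows "(EIk_term D r2 r4 \<tau> has_sum (2 * of_nat D * eta_quot 4 (rvec r2 r4) \<tau>)) (Tcosets D)"
proof -
  define R2 R4 where "R2 = real_of_rat r2" and "R4 = real_of_rat r4"
  have lin: "real_of_rat (x * r2 + y * r4) = real_of_rat x * R2 + real_of_rat y * R4" for x y
    by (simp add: R2_def R4_def of_rat_add of_rat_mult)
  interpret Q: eta_quotient R2 R4
  proof
    have "real_of_rat (-2 * r2 + -5 * r4) < real_of_rat 8"
      using assms(2) unfolding of_rat_less by simp
    then show "- 2 * R2 - 5 * R4 < 8" unfolding lin by (simp add: of_rat_minus)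
    have "real_of_rat (0 * r2 + -1 * r4) < real_of_rat 8"
      using assms(4) unfolding of_rat_less by simp
    then show "- R4 < 8" unfolding lin by (simp add: of_rat_minus)
    have "real_of_rat 8 < real_of_rat (-2 * r2 + -6 * r4)"
      using assms(5) unfolding of_rat_less by simp
    then show "(- 2 * R2 - 5 * R4) + (- R4) > 8" unfolding lin by (simp add: of_rat_minus)
  qed
  note \<tau> = \<open>Im \<tau> > 0\<close>
  have rv: "rvec r2 r4 1 = Q.r1" "rvec r2 r4 2 = R2" "rvec r2 r4 4 = R4"
    unfolding Q.r1_def by (simp_all add: rvec_def R2_def R4_def of_rat_diff of_rat_mult of_rat_minus)
  have k: "real_of_rat ((- r2 - 3 * r4) / 2) = Q.k"
    unfolding Q.k_def by (simp add: R2_def R4_def of_rat_diff of_rat_mult of_rat_minus of_rat_divide)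
  have quot: "eta_quot 4 (rvec r2 r4) \<tau> = Q.f \<tau>"
    unfolding eta_quot_def divisors_4 eta_pow_def Q.f_def
    using \<tau> rv by (simp add: logeta_eq_Leta exp_add)
  obtain m2 m4 :: int where m24: "of_nat D * r2 = 2 * of_int m2" "of_nat D * r4 = 2 * of_int m4"
    using assms(7,8) by blast
  have m2: "real D * R2 = 2 * of_int m2" and m4: "real D * R4 = 2 * of_int m4"
    using m24[THEN arg_cong[of _ _ real_of_rat]] by (simp_all add: of_rat_mult R2_def R4_def)
  \<comment> \<open>This integer is -Dk = D (r2 + 3 r4) / 2.\<close>
  define m where "m = m2 + 3 * m4"
  have m: "- real D * Q.k = of_int m"
    using m2 m4 by (simp add: Q.k_def m_def field_simps)
  have "of_int m * (1 / real D) = - Q.k" using m assms(6) by (simp add: field_simps)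
  then have mD: "of_int m * complex_of_real (1 / real D) = - of_real Q.k"
    by (metis of_real_minus of_real_mult of_real_of_int_eq)
  \<comment> \<open>Shown for every member of the fibre, as nothing more is known of the
    representative picked by \<open>SOME\<close>. The same power of \<epsilon> occurs in the
    character and in the slash factor and cancels.\<close>
  have trm: "inverse (eta_char 4 D (rvec r2 r4) g) * slash_one D (real_of_rat ((- r2 - 3 * r4) / 2)) g \<tau> = Q.f \<tau> * Q.g p \<tau>"
    if g: "g \<in> row_fibre D (p, \<epsilon>)" for g p \<epsilon>
  proof -
    obtain a b c d where gd: "g = ((a, b, c, d), \<epsilon>)" "p = (c, d)" "(a, b, c, d) \<in> Gamma0_4" "\<epsilon> ^ D = 1"
      using g by (cases g) (auto simp: row_fibre_def GammaT_def)
    have \<epsilon>: "\<epsilon> \<noteq> 0" using gd(4) assms(6) by (auto simp: power_0_left)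
    define z where "z = of_int c * \<tau> + of_int d"
    have z: "z \<noteq> 0" unfolding z_def using gd(3) \<tau> by (intro linear_form_nonzero) (auto simp: Gamma0_4_def)
    define \<theta> where "\<theta> = ee (of_real ((Q.r1 * Psi (a, b, c, d) + R2 * Psi (a, b * 2, c div 2, d) + R4 * Psi (a, b * 4, c div 4, d)) / 24))"
    have s1: "(\<Sum>n\<in>{n. n dvd 4}. rvec r2 r4 n) = 2 * Q.k"
      using rv by (simp add: divisors_4 Q.k_def Q.r1_def)
    have s2: "1 / 24 * (\<Sum>n\<in>{n. n dvd 4}. rvec r2 r4 n * Psi (a, b * int n, c div int n, d))
        = (Q.r1 * Psi (a, b, c, d) + R2 * Psi (a, b * 2, c div 2, d) + R4 * Psi (a, b * 4, c div 4, d)) / 24"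
      using rv by (simp add: divisors_4 add.assoc)
    have e: "- real D * (1 / 2 * (2 * Q.k)) = of_int m" using m by simp
    have chi: "eta_char 4 D (rvec r2 r4) g = \<epsilon> powr of_int m * \<theta>"
      unfolding gd(1) \<theta>_def eta_char.simps s1 s2 e by simp
    have "slash_one D Q.k g \<tau> = (\<epsilon> * z powr of_real (1 / real D)) powr of_int m"
      unfolding slash_one_def gd(1) autf.simps z_def m by simp
    also have "\<dots> = \<epsilon> powr of_int m * exp (of_int m * of_real (1 / real D) * Ln z)"
      by (rule root_powr_of_int[OF \<epsilon> z])
    also have "\<dots> = \<epsilon> powr of_int m * inverse (exp (of_real Q.k * Ln z))"
      unfolding mD by (simp add: exp_minus)
    finally have sl: "slash_one D Q.k g \<tau> = \<epsilon> powr of_int m * inverse (exp (of_real Q.k * Ln z))" .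
    have fm: "Q.f (mob (a, b, c, d) \<tau>) = \<theta> * exp (of_real Q.k * Ln z) * Q.f \<tau>"
      unfolding \<theta>_def z_def by (rule Q.f_mob[OF gd(3) \<tau>])
    have "\<epsilon> powr of_int m \<noteq> 0" using \<epsilon> by simp
    moreover have "\<theta> \<noteq> 0" by (simp add: \<theta>_def)
    ultimately show ?thesis
      unfolding k chi sl gd(2) Q.g_eq[OF gd(3) \<tau>] fm by (simp add: field_simps)
  qed
  have term_eq: "EIk_term D r2 r4 \<tau> (row_fibre D (p, \<epsilon>)) = Q.f \<tau> * Q.g p \<tau>"
    if "p \<in> row_set" "\<epsilon> ^ D = 1" for p \<epsilon>
    unfolding EIk_term_def Let_def
    by (rule trm[of _ p \<epsilon>], rule someI[of "\<lambda>g. g \<in> row_fibre D (p, \<epsilon>)"], rule row_fibre_nonempty[OF that])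
  have sum: "((\<lambda>p. Q.f \<tau> * Q.g p \<tau>) has_sum (Q.f \<tau> * 2)) row_set"
    using has_sum_infsum[OF Q.summable_fg[OF \<tau>]] unfolding Q.f_times_F[symmetric] Q.F_eq_2[OF \<tau>] .
  have "((\<lambda>(p, \<epsilon>). Q.f \<tau> * Q.g p \<tau>) has_sum (of_nat (card {\<epsilon>::complex. \<epsilon> ^ D = 1}) * (Q.f \<tau> * 2))) (row_set \<times> {\<epsilon>::complex. \<epsilon> ^ D = 1})"
    by (rule has_sum_times_finite[OF Q.summable_norm_fg[OF \<tau>] sum finite_roots_unity[OF assms(6)]])
  moreover have "card {\<epsilon>::complex. \<epsilon> ^ D = 1} = D" using assms(6) by (intro card_roots_unity_eq) auto
  ultimately have "((\<lambda>(p, \<epsilon>). Q.f \<tau> * Q.g p \<tau>) has_sum (2 * of_nat D * Q.f \<tau>)) (row_set \<times> {\<epsilon>::complex. \<epsilon> ^ D = 1})"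
    by (simp add: mult_ac)
  then have "((\<lambda>x. EIk_term D r2 r4 \<tau> (row_fibre D x)) has_sum (2 * of_nat D * Q.f \<tau>)) (row_set \<times> {\<epsilon>::complex. \<epsilon> ^ D = 1})"
    by (rule has_sum_cong[THEN iffD1, rotated]) (auto simp: term_eq)
  then show ?thesis unfolding quot
    using has_sum_reindex_bij_betw[OF bij_betw_row_fibre] by blast
qed

end
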